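(* Let $G_1,\ldots,G_r$ be finite simple graphs, each having at least one edge, such that \[ |(V(G_1)\cup\cdots\cup V(G_{i-1}))\cap V(G_i)|\leq 1\quad\text{for all } i=2,\ldots,r, \] and let $G=G_1\cup\cdots\cup G_r$. Then \[ \operatorname{proj\,dim} I(G)=\sum_{k=1}^r\operatorname{proj\,dim} I(G_k) \quad\text{and}\quad \operatorname{reg} I(G)=\sum_{k=1}^r\operatorname{reg} I(G_k). \]
   Context: For a finite simple graph $G$ with edge set $E(G)=\{e_1,\dots,e_m\}$, $m\geq 1$, let $S=K[s_1,\dots,s_m,t_1,\dots,t_m]$ be the standard graded polynomial ring over a field $K$ with one pair of variables $s_i,t_i$ for each edge $e_i$. For $A\subseteq V(G)$ the cut monomial of $A$ is $u_A=\alpha_1\cdots\alpha_m$, where $\alpha_i=s_i$ if exactly one of the two vertices of $e_i$ belongs to $A$, and $\alpha_i=t_i$ otherwise. The monomial cut ideal of $G$ is $I(G)=\langle u_A: A\subseteq V(G)\rangle\subseteq S$. For a subgraph $G_j$ of $G$, the ideal $I(G_j)$ is formed using only the edges of $G_j$ and the variables belonging to these edges, and is regarded (extended) as an ideal of $S$. The union $G_1\cup\cdots\cup G_r$ is the graph with vertex set $\bigcup_i V(G_i)$ and edge set $\bigcup_i E(G_i)$. For a nonzero finitely generated graded $S$-module $M$, let $\beta_{ij}(M)=\dim_K\operatorname{Tor}_i^S(M,K)_j$; $\operatorname{proj\,dim}M=\max\{i:\beta_{ij}(M)\neq 0\text{ for some }j\}$ and $\operatorname{reg}M=\max\{j:\beta_{i,i+j}(M)\neq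 0\text{ for some }i\}$. *)

theory Defs
  imports
    Complex_Main
    "HOL-Algebra.Ideal"
    "HOL-Algebra.Module"
    "HOL-Library.Poly_Mapping"
    "HOL-Library.Function_Algebras"
begin

type_synonym ('x, 'k) mpoly = "('x \<Rightarrow>\<^sub>0 nat) \<Rightarrow>\<^sub>0 'k"

definition var :: "'x \<Rightarrow> ('x, 'k::field) mpoly" where
  "var x = Poly_Mapping.single (Poly_Mapping.single x 1) 1"

text \<open>The polynomial ring \<open>K[X]\<close>, where \<open>K\<close> is the type \<open>'k\<close> and \<open>X\<close> is a set of variables, is
  carved out of the type of all polynomials with variables in the type \<open>'x\<close>.\<close>

definition poly_ring :: "'x set \<Rightarrow> ('x, 'k::field) mpoly ring" where
  "poly_ring X =
     \<lparr>carrier = {p. \<forall>m\<in>Poly_Mapping.keys p. Poly_Mapping.keys m \<subseteq> X},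
      mult = (*), one = 1, zero = 0, add = (+)\<rparr>"

definition mono_deg :: "('x \<Rightarrow>\<^sub>0 nat) \<Rightarrow> nat" where
  "mono_deg m = (\<Sum>x\<in>Poly_Mapping.keys m. Poly_Mapping.lookup m x)"

text \<open>Homogeneous polynomials of degree \<open>d\<close>, including 0; for \<open>d < 0\<close> only 0.\<close>

definition homog :: "int \<Rightarrow> ('x, 'k::field) mpoly set" where
  "homog d = {p. \<forall>m\<in>Poly_Mapping.keys p. int (mono_deg m) = d}"

text \<open>Residue of a polynomial in \<open>K = S / \<mm>\<close>, where \<open>\<mm>\<close> is generated by the variables.\<close>

definition const_coeff :: "('x, 'k::field) mpoly \<Rightarrow> 'k" where
  "const_coeff p = Poly_Mapping.lookup p 0"

record ('a, 'm) gmodule = "('a, 'm) module" +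
  gcomp :: "int \<Rightarrow> 'm set"

definition ideal_gmodule ::
  "('x, 'k::field) mpoly ring \<Rightarrow> ('x, 'k) mpoly set \<Rightarrow>
   (('x, 'k) mpoly, ('x, 'k) mpoly) gmodule" where
  "ideal_gmodule S I =
     \<lparr>carrier = I, mult = mult S, one = one S, zero = zero S, add = add S,
      smult = mult S, gcomp = (\<lambda>d. I \<inter> homog d)\<rparr>"

text \<open>A complex \<open>\<dots> \<rightarrow> F\<^sub>2 \<rightarrow> F\<^sub>1 \<rightarrow> F\<^sub>0 \<rightarrow> M\<close> of graded free \<open>S\<close>-modules of finite rank, given by a
  homogeneous basis of each \<open>F\<^sub>i\<close> (an index set together with the degrees of the basis elements),
  by the matrices \<open>fr_mat i\<close> of the maps \<open>F\<^bsub>i+1\<^esub> \<rightarrow> F\<^sub>i\<close> (row index first), and by the images in \<open>M\<close>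
  of the basis elements of \<open>F\<^sub>0\<close>.\<close>

record ('a, 'm) free_complex =
  fr_basis :: "nat \<Rightarrow> nat set"
  fr_deg :: "nat \<Rightarrow> nat \<Rightarrow> int"
  fr_mat :: "nat \<Rightarrow> nat \<Rightarrow> nat \<Rightarrow> 'a"
  fr_aug :: "nat \<Rightarrow> 'm"

text \<open>Elements of \<open>F\<^sub>i\<close> are coordinate functions that vanish off the index set of the basis.\<close>

definition free_part ::
  "('x, 'k::field) mpoly ring \<Rightarrow> (('x, 'k) mpoly, 'm) free_complex \<Rightarrow> nat \<Rightarrow>
   (nat \<Rightarrow> ('x, 'k) mpoly) set" where
  "free_part S F i = {v. \<forall>b. v b \<in> carrier S \<and> (b \<notin> fr_basis F i \<longrightarrow> v b = 0)}"

definition free_map ::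
  "(('x, 'k::field) mpoly, 'm) free_complex \<Rightarrow> nat \<Rightarrow>
   (nat \<Rightarrow> ('x, 'k) mpoly) \<Rightarrow> nat \<Rightarrow> ('x, 'k) mpoly" where
  "free_map F i v =
     (\<lambda>c. if c \<in> fr_basis F i then \<Sum>b\<in>fr_basis F (Suc i). fr_mat F i c b * v b else 0)"

definition free_aug ::
  "('a, 'm) gmodule \<Rightarrow> ('a, 'm) free_complex \<Rightarrow> (nat \<Rightarrow> 'a) \<Rightarrow> 'm" where
  "free_aug M F v = (\<Oplus>\<^bsub>M\<^esub>b\<in>fr_basis F 0. v b \<odot>\<^bsub>M\<^esub> fr_aug F b)"

definition graded_free_resolution ::
  "('x, 'k::field) mpoly ring \<Rightarrow> (('x, 'k) mpoly, 'm) gmodule \<Rightarrow>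
   (('x, 'k) mpoly, 'm) free_complex \<Rightarrow> bool" where
  "graded_free_resolution S M F \<longleftrightarrow>
     (\<forall>i. finite (fr_basis F i)) \<and>
     (\<forall>i. \<forall>c\<in>fr_basis F i. \<forall>b\<in>fr_basis F (Suc i).
        fr_mat F i c b \<in> carrier S \<inter> homog (fr_deg F (Suc i) b - fr_deg F i c)) \<and>
     (\<forall>b\<in>fr_basis F 0. fr_aug F b \<in> gcomp M (fr_deg F 0 b)) \<and>
     free_aug M F ` free_part S F 0 = carrier M \<and>
     free_map F 0 ` free_part S F 1 = {v \<in> free_part S F 0. free_aug M F v = \<zero>\<^bsub>M\<^esub>} \<and>
     (\<forall>i. free_map F (Suc i) ` free_part S F (Suc (Suc i)) =
          {v \<in> free_part S F (Suc i). free_map F i v = (\<lambda>_. 0)})"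

text \<open>The complex \<open>F \<otimes>\<^sub>S K\<close> consists of the vector spaces on the same bases, and its maps are
  given by the residues in \<open>K\<close> of the matrix entries; \<open>Tor\<^sub>i(M,K)\<^sub>j\<close> is the degree \<open>j\<close> part of its
  \<open>i\<close>-th homology. The map out of position 0 is zero.\<close>

definition fiber_part ::
  "(('x, 'k::field) mpoly, 'm) free_complex \<Rightarrow> nat \<Rightarrow> int \<Rightarrow> (nat \<Rightarrow> 'k) set" where
  "fiber_part F i j = {v. \<forall>b. v b \<noteq> 0 \<longrightarrow> b \<in> fr_basis F i \<and> fr_deg F i b = j}"

definition fiber_map ::
  "(('x, 'k::field) mpoly, 'm) free_complex \<Rightarrow> nat \<Rightarrow> (nat \<Rightarrow> 'k) \<Rightarrow> nat \<Rightarrow> 'k" where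
  "fiber_map F i v =
     (\<lambda>c. if c \<in> fr_basis F i
          then \<Sum>b\<in>fr_basis F (Suc i). const_coeff (fr_mat F i c b) * v b else 0)"

definition tor_cycles ::
  "(('x, 'k::field) mpoly, 'm) free_complex \<Rightarrow> nat \<Rightarrow> int \<Rightarrow> (nat \<Rightarrow> 'k) set" where
  "tor_cycles F i j =
     {v \<in> fiber_part F i j. \<forall>h. i = Suc h \<longrightarrow> fiber_map F h v = (\<lambda>_. 0)}"

definition tor_boundaries ::
  "(('x, 'k::field) mpoly, 'm) free_complex \<Rightarrow> nat \<Rightarrow> int \<Rightarrow> (nat \<Rightarrow> 'k) set" where
  "tor_boundaries F i j = fiber_map F i ` fiber_part F (Suc i) j"

definition kscale :: "'k::field \<Rightarrow> (nat \<Rightarrow> 'k) \<Rightarrow> nat \<Rightarrow> 'k" where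
  "kscale a v = (\<lambda>n. a * v n)"

lemma vector_space_kscale: "vector_space (kscale :: 'k::field \<Rightarrow> _)"
  by (rule vector_space.intro) (auto simp: kscale_def fun_eq_iff algebra_simps)

text \<open>The boundaries form a subspace of the finite-dimensional space of cycles, so the
  difference is the dimension of the quotient.\<close>

definition tor_dim ::
  "(('x, 'k::field) mpoly, 'm) free_complex \<Rightarrow> nat \<Rightarrow> int \<Rightarrow> nat" where
  "tor_dim F i j =
     vector_space.dim kscale (tor_cycles F i j) - vector_space.dim kscale (tor_boundaries F i j)"

text \<open>As usual, Tor is computed from a chosen graded free resolution; the dimensions do not
  depend on the choice.\<close>

definition betti ::
  "('x, 'k::field) mpoly ring \<Rightarrow> (('x, 'k) mpoly, 'm) gmodule \<Rightarrow> nat \<Rightarrow> int \<Rightarrow> nat" where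
  "betti S M i j = tor_dim (SOME F. graded_free_resolution S M F) i j"

definition proj_dim ::
  "('x, 'k::field) mpoly ring \<Rightarrow> (('x, 'k) mpoly, 'm) gmodule \<Rightarrow> nat" where
  "proj_dim S M = Max {i. \<exists>j. betti S M i j \<noteq> 0}"

definition regularity ::
  "('x, 'k::field) mpoly ring \<Rightarrow> (('x, 'k) mpoly, 'm) gmodule \<Rightarrow> int" where
  "regularity S M = Max {j. \<exists>i. betti S M i (int i + j) \<noteq> 0}"

record 'v graph =
  verts :: "'v set"
  edges :: "'v set set"

definition finite_simple_graph :: "'v graph \<Rightarrow> bool" where
  "finite_simple_graph G \<longleftrightarrow>
     finite (verts G) \<and> (\<forall>e\<in>edges G. e \<subseteq> verts G \<and> card e = 2)"

definition graph_Union :: "'i set \<Rightarrow> ('i \<Rightarrow> 'v graph) \<Rightarrow> 'v graph" where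
  "graph_Union J Gs = \<lparr>verts = (\<Union>i\<in>J. verts (Gs i)), edges = (\<Union>i\<in>J. edges (Gs i))\<rparr>"

text \<open>The variables \<open>s\<^sub>e\<close> and \<open>t\<^sub>e\<close> are named by the edge \<open>e\<close> itself, so that the variables of a
  subgraph are among those of the graph.\<close>

datatype 'v cut_var = SVar "'v set" | TVar "'v set"

definition cut_ring :: "'v graph \<Rightarrow> ('v cut_var, 'k::field) mpoly ring" where
  "cut_ring G = poly_ring (SVar ` edges G \<union> TVar ` edges G)"

definition cut_monomial :: "'v graph \<Rightarrow> 'v set \<Rightarrow> ('v cut_var, 'k::field) mpoly" where
  "cut_monomial G A =
     (\<Prod>e\<in>edges G. if card (e \<inter> A) = 1 then var (SVar e) else var (TVar e))"

definition cut_ideal :: "'v graph \<Rightarrow> ('v cut_var, 'k::field) mpoly set" where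
  "cut_ideal G = Idl\<^bsub>cut_ring G\<^esub> {cut_monomial G A |A. A \<subseteq> verts G}"

end

theory Submission
  imports Defs
begin

text \<open>All cut ideals are monomial ideals. If the graphs \<open>G\<^sub>1\<close> and \<open>G\<^sub>2\<close> share at most one vertex, they
  have no common edge, and a cut of \<open>G\<^sub>1\<close> and a cut of \<open>G\<^sub>2\<close> can always be glued to a cut of the union:
  replacing a vertex set by its complement does not change the cut, so the two sets can be made to
  agree at the common vertex (\<open>cut_exps_union\<close>). Hence the cut monomials of the union are exactly the
  products of a cut monomial of \<open>G\<^sub>1\<close> and one of \<open>G\<^sub>2\<close>, and \<open>I(G)\<close> is the product of the ideals
  \<open>I(G\<^sub>k)\<close>, which live in pairwise disjoint sets of variables.

  It remains to see that projective dimension and regularity are additive on products \<open>I J\<close> of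
  monomial ideals in disjoint sets of variables (\<open>proj_dim_regularity_product\<close>). Here the tensor
  product of a minimal resolution of \<open>I\<close> and a minimal resolution of \<open>J\<close> is a minimal resolution of
  \<open>I J\<close>. The pairs \<open>(i, j)\<close> with nonzero Tor are the homological and internal degrees of the basis
  elements of a minimal resolution, so these pairs add up, and so do the maxima of \<open>i\<close> and of \<open>j - i\<close>.

  The resolutions are built multigraded. If every basis element \<open>b\<close> has a monomial \<open>g b\<close> as its degree,
  the entries of the differential are scalars \<open>D c b\<close> times the monomial \<open>g b - g c\<close> (in exponents), so
  the resolution is a matrix of scalars. In a fixed multidegree \<open>a\<close> it is the complex of vector
  spaces spanned by the \<open>b\<close> with \<open>g b\<close> dividing \<open>a\<close>, and exactness there can be witnessed by a
  contracting homotopy, that is by matrix identities. This makes three constructions elementary.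
  Adding one generator to the ideal is a mapping cone (\<open>monomial_resolution_cone\<close>; iterating it gives
  the Taylor resolution), a resolution becomes minimal by cancelling invertible entries
  (\<open>monomial_resolution_minimize\<close>), and homotopies can be tensored (\<open>minimal_resolution_tensor\<close>; disjointness of
  the variables makes the basis elements of multidegree dividing \<open>a\<close> a cartesian product).

  Betti numbers are defined from some graded free resolution. The comparison of resolutions by chain
  maps and homotopies shows that the vanishing of Tor does not depend on it (\<open>betti_nonzero_iff\<close>), so that
  it can be read off the minimal multigraded resolution (\<open>betti_minimal_resolution\<close>).\<close>

section \<open>Scalar complexes and their contractions\<close>

definition mat_mult :: "'b set \<Rightarrow> ('a \<Rightarrow> 'b \<Rightarrow> 'k::field) \<Rightarrow> ('b \<Rightarrow> 'c \<Rightarrow> 'k) \<Rightarrow> 'a \<Rightarrow> 'c \<Rightarrow> 'k" where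
  "mat_mult B M N x y = (\<Sum>z\<in>B. M x z * N z y)"

definition id_mat :: "'b \<Rightarrow> 'b \<Rightarrow> 'k::field" where
  "id_mat x y = (if x = y then 1 else 0)"

text \<open>All homological degrees of a complex with basis \<open>B\<close> are collected in a single matrix: \<open>D x y\<close> is the
  coefficient of \<open>x\<close> in the boundary of \<open>y\<close>, and \<open>h\<close> gives the homological degrees. The row \<open>\<epsilon>\<close> is an
  augmentation to the ground field.\<close>

definition augmented_complex ::
  "'b set \<Rightarrow> ('b \<Rightarrow> nat) \<Rightarrow> ('b \<Rightarrow> 'b \<Rightarrow> 'k::field) \<Rightarrow> ('b \<Rightarrow> 'k) \<Rightarrow> bool" where
  "augmented_complex B h D \<epsilon> \<longleftrightarrow>
     finite B \<and>
     (\<forall>x\<in>B. \<forall>y\<in>B. D x y \<noteq> 0 \<longrightarrow> h y = Suc (h x)) \<and>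
     (\<forall>x\<in>B. \<epsilon> x \<noteq> 0 \<longrightarrow> h x = 0) \<and>
     (\<forall>x\<in>B. \<forall>y\<in>B. mat_mult B D D x y = 0) \<and>
     (\<forall>y\<in>B. (\<Sum>x\<in>B. \<epsilon> x * D x y) = 0)"

text \<open>A contracting homotopy of the augmented complex: \<open>s\<close> raises the homological degree by one and \<open>u\<close> is
  the image of \<open>1\<close> under a section of \<open>\<epsilon>\<close>. It says that the augmented complex is exact, but
  in the form of matrix identities, which pass to tensor products and to retracts.\<close>

definition contraction ::
  "'b set \<Rightarrow> ('b \<Rightarrow> nat) \<Rightarrow> ('b \<Rightarrow> 'b \<Rightarrow> 'k::field) \<Rightarrow> ('b \<Rightarrow> 'k) \<Rightarrow>
   ('b \<Rightarrow> 'b \<Rightarrow> 'k) \<Rightarrow> ('b \<Rightarrow> 'k) \<Rightarrow> bool" where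
  "contraction B h D \<epsilon> s u \<longleftrightarrow>
     (\<forall>x\<in>B. \<forall>y\<in>B. s x y \<noteq> 0 \<longrightarrow> h x = Suc (h y)) \<and>
     (\<forall>x\<in>B. u x \<noteq> 0 \<longrightarrow> h x = 0) \<and>
     (\<Sum>x\<in>B. \<epsilon> x * u x) = 1 \<and>
     (\<forall>x\<in>B. \<forall>y\<in>B. mat_mult B D s x y + mat_mult B s D x y + u x * \<epsilon> y = id_mat x y)"

definition contractible where
  "contractible B h D \<epsilon> \<longleftrightarrow> (\<exists>s u. contraction B h D \<epsilon> s u)"

lemma contractible_cong:
  assumes "\<And>x. x \<in> B \<Longrightarrow> h x = h' x" "\<And>x. x \<in> B \<Longrightarrow> \<epsilon> x = \<epsilon>' x"
    "\<And>x y. x \<in> B \<Longrightarrow> y \<in> B \<Longrightarrow> D x y = D' x y"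
  shows "contractible B h D \<epsilon> = contractible B h' D' \<epsilon>'"
proof -
  have "contraction B h D \<epsilon> s u = contraction B h' D' \<epsilon>' s u" for s u
    unfolding contraction_def mat_mult_def using assms by (simp cong: sum.cong)
  then show ?thesis by (simp add: contractible_def)
qed

lemma contractible_nonempty: "contractible B h D \<epsilon> \<Longrightarrow> B \<noteq> {}"
  by (auto simp: contractible_def contraction_def)

lemma contractible_image:
  assumes inj: "inj_on f B"
    and c: "contractible B (\<lambda>x. h (f x)) (\<lambda>x y. D (f x) (f y)) (\<lambda>x. \<epsilon> (f x))"
  shows "contractible (f ` B) h D \<epsilon>"
proof -
  obtain s u where c: "contraction B (\<lambda>x. h (f x)) (\<lambda>x y. D (f x) (f y)) (\<lambda>x. \<epsilon> (f x)) s u"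
    using c by (auto simp: contractible_def)
  let ?g = "the_inv_into B f"
  have g: "?g (f x) = x" if "x \<in> B" for x using that inj by (simp add: the_inv_into_f_f)
  have "contraction (f ` B) h D \<epsilon> (\<lambda>x y. s (?g x) (?g y)) (\<lambda>x. u (?g x))"
    using c inj unfolding contraction_def mat_mult_def
    by (simp add: sum.reindex g id_mat_def inj_on_eq_iff cong: sum.cong)
  then show ?thesis by (auto simp: contractible_def)
qed

lemma augmented_complex_image:
  assumes inj: "inj_on f B"
    and c: "augmented_complex B (\<lambda>x. h (f x)) (\<lambda>x y. D (f x) (f y)) (\<lambda>x. \<epsilon> (f x))"
  shows "augmented_complex (f ` B) h D \<epsilon>"
  using c inj unfolding augmented_complex_def mat_mult_def
  by (simp add: sum.reindex cong: sum.cong)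

lemma mat_mult_add_left: "mat_mult B (\<lambda>x y. M x y + N x y) L x y = mat_mult B M L x y + mat_mult B N L x y"
  by (simp add: mat_mult_def algebra_simps sum.distrib)

lemma mat_mult_add_right: "mat_mult B L (\<lambda>x y. M x y + N x y) x y = mat_mult B L M x y + mat_mult B L N x y"
  by (simp add: mat_mult_def algebra_simps sum.distrib)

lemma mat_mult_assoc:
  "mat_mult B (mat_mult A L M) N x y = mat_mult A L (mat_mult B M N) x y"
proof -
  have "mat_mult B (mat_mult A L M) N x y = (\<Sum>z\<in>B. \<Sum>w\<in>A. L x w * M w z * N z y)"
    by (simp add: mat_mult_def sum_distrib_right)
  also have "\<dots> = (\<Sum>w\<in>A. \<Sum>z\<in>B. L x w * M w z * N z y)" by (rule sum.swap)
  also have "\<dots> = mat_mult A L (mat_mult B M N) x y"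
    by (simp add: mat_mult_def sum_distrib_left mult.assoc)
  finally show ?thesis .
qed

lemma mat_mult_cong:
  assumes "\<And>z. z \<in> B \<Longrightarrow> M x z = M' x z" "\<And>z. z \<in> B \<Longrightarrow> N z y = N' z y"
  shows "mat_mult B M N x y = mat_mult B M' N' x y"
  unfolding mat_mult_def using assms by (auto intro: sum.cong)

lemma mat_mult_id_left: "finite B \<Longrightarrow> x \<in> B \<Longrightarrow> mat_mult B id_mat M x y = M x y"
  by (simp add: mat_mult_def id_mat_def if_distrib[of "\<lambda>c. c * _"] cong: if_cong)

lemma mat_mult_id_right: "finite B \<Longrightarrow> y \<in> B \<Longrightarrow> mat_mult B M id_mat x y = M x y"
  by (simp add: mat_mult_def id_mat_def if_distrib[of "\<lambda>c. _ * c"] cong: if_cong)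

section \<open>Mapping cones\<close>

text \<open>The mapping cone that adds one generator. The basis elements \<open>Inl b\<close> are the old ones, \<open>Inr None\<close> is
  the new generator, and \<open>Inr (Some b)\<close> is the cone over \<open>b\<close> with the new generator as its apex.\<close>

definition cone_set :: "'b set \<Rightarrow> ('b + 'b option) set" where
  "cone_set B = Inl ` B \<union> insert (Inr None) (Inr ` Some ` B)"

fun cone_height :: "('b \<Rightarrow> nat) \<Rightarrow> ('b + 'b option) \<Rightarrow> nat" where
  "cone_height h (Inl b) = h b"
| "cone_height h (Inr None) = 0"
| "cone_height h (Inr (Some b)) = Suc (h b)"

fun cone_diff :: "('b \<Rightarrow> 'b \<Rightarrow> 'k::field) \<Rightarrow> ('b \<Rightarrow> 'k) \<Rightarrow> ('b + 'b option) \<Rightarrow> ('b + 'b option) \<Rightarrow> 'k" where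
  "cone_diff D \<epsilon> (Inl c) (Inl b) = D c b"
| "cone_diff D \<epsilon> (Inl c) (Inr (Some b)) = id_mat c b"
| "cone_diff D \<epsilon> (Inr None) (Inr (Some b)) = - \<epsilon> b"
| "cone_diff D \<epsilon> (Inr (Some c)) (Inr (Some b)) = - D c b"
| "cone_diff D \<epsilon> _ _ = 0"

fun cone_aug :: "('b \<Rightarrow> 'k::field) \<Rightarrow> ('b + 'b option) \<Rightarrow> 'k" where
  "cone_aug \<epsilon> (Inl b) = \<epsilon> b"
| "cone_aug \<epsilon> (Inr None) = 1"
| "cone_aug \<epsilon> (Inr (Some b)) = 0"

lemma sum_cone_set:
  assumes "finite B"
  shows "(\<Sum>z\<in>cone_set B. f z) = (\<Sum>z\<in>B. f (Inl z)) + f (Inr None) + (\<Sum>z\<in>B. f (Inr (Some z)))"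
proof -
  have "cone_set B = Inl ` B \<union> ({Inr None} \<union> (\<lambda>z. Inr (Some z)) ` B)" by (auto simp: cone_set_def)
  then have "(\<Sum>z\<in>cone_set B. f z) = (\<Sum>z\<in>Inl ` B. f z) + ((\<Sum>z\<in>{Inr None}. f z) + (\<Sum>z\<in>(\<lambda>z. Inr (Some z)) ` B. f z))"
    using assms by (simp only:) (subst sum.union_disjoint; (subst sum.union_disjoint)?; auto)+
  then show ?thesis by (simp add: sum.reindex inj_on_def algebra_simps)
qed

lemma ball_cone_set:
  "(\<forall>x\<in>cone_set B. P x) \<longleftrightarrow> (\<forall>x\<in>B. P (Inl x)) \<and> P (Inr None) \<and> (\<forall>x\<in>B. P (Inr (Some x)))"
  by (auto simp: cone_set_def)

lemma augmented_complex_cone: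
  assumes c: "augmented_complex B h D \<epsilon>"
  shows "augmented_complex (cone_set B) (cone_height h) (cone_diff D \<epsilon>) (cone_aug \<epsilon>)"
proof -
  have fin: "finite B" using c by (simp add: augmented_complex_def)
  have [simp]: "(\<Sum>z\<in>B. D x z * D z y) = 0" if "x \<in> B" "y \<in> B" for x y
    using c that by (simp add: augmented_complex_def mat_mult_def)
  have [simp]: "(\<Sum>z\<in>B. \<epsilon> z * D z y) = 0" if "y \<in> B" for y
    using c that by (simp add: augmented_complex_def mat_mult_def)
  have [simp]: "(\<Sum>z\<in>B. D x z * id_mat z y) = D x y" "(\<Sum>z\<in>B. \<epsilon> z * id_mat z y) = \<epsilon> y" if "y \<in> B" for x y
    using that fin mat_mult_id_right[of B y D] mat_mult_id_right[of B y "\<lambda>_. \<epsilon>"] by (simp_all add: mat_mult_def)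
  have [simp]: "(\<Sum>z\<in>B. id_mat x z * D z y) = D x y" if "x \<in> B" for x y
    using that fin mat_mult_id_left[of B x D] by (simp add: mat_mult_def)
  have 1: "finite (cone_set B)" using fin by (simp add: cone_set_def)
  have 2: "\<forall>x\<in>cone_set B. \<forall>y\<in>cone_set B. cone_diff D \<epsilon> x y \<noteq> 0 \<longrightarrow> cone_height h y = Suc (cone_height h x)"
    using c by (auto simp: ball_cone_set augmented_complex_def id_mat_def)
  have 3: "\<forall>x\<in>cone_set B. cone_aug \<epsilon> x \<noteq> 0 \<longrightarrow> cone_height h x = 0"
    using c by (auto simp: ball_cone_set augmented_complex_def)
  have 4: "\<forall>x\<in>cone_set B. \<forall>y\<in>cone_set B. mat_mult (cone_set B) (cone_diff D \<epsilon>) (cone_diff D \<epsilon>) x y = 0"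
    by (simp add: ball_cone_set mat_mult_def sum_cone_set fin sum_negf)
  have 5: "\<forall>y\<in>cone_set B. (\<Sum>x\<in>cone_set B. cone_aug \<epsilon> x * cone_diff D \<epsilon> x y) = 0"
    by (simp add: ball_cone_set sum_cone_set fin)
  show ?thesis unfolding augmented_complex_def using 1 2 3 4 5 by blast
qed

text \<open>Sending \<open>b\<close> to the cone over \<open>b\<close> contracts everything to the apex.\<close>

lemma contractible_cone:
  fixes B :: "'b set"
  assumes fin: "finite B"
  shows "contractible (cone_set B) (cone_height h) (cone_diff D \<epsilon>) (cone_aug \<epsilon> :: _ \<Rightarrow> 'k::field)"
proof -
  define s :: "'b + 'b option \<Rightarrow> 'b + 'b option \<Rightarrow> 'k" where
    "s x y = (case (x, y) of (Inr (Some c), Inl b) \<Rightarrow> id_mat c b | _ \<Rightarrow> 0)" for x y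
  define u :: "'b + 'b option \<Rightarrow> 'k" where "u = id_mat (Inr None)"
  have [simp]: "(\<Sum>z\<in>B. D x z * id_mat z y) = D x y" "(\<Sum>z\<in>B. \<epsilon> z * id_mat z y) = \<epsilon> y"
    "(\<Sum>z\<in>B. id_mat x z * id_mat z y) = (id_mat x y :: 'k)" if "y \<in> B" for x y
    using that fin mat_mult_id_right[of B y D] mat_mult_id_right[of B y "\<lambda>_. \<epsilon>"]
      mat_mult_id_right[of B y id_mat] by (simp_all add: mat_mult_def)
  have [simp]: "(\<Sum>z\<in>B. id_mat x z * D z y) = D x y" if "x \<in> B" for x y
    using that fin mat_mult_id_left[of B x D] by (simp add: mat_mult_def)
  have "contraction (cone_set B) (cone_height h) (cone_diff D \<epsilon>) (cone_aug \<epsilon>) s u"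
    unfolding contraction_def
    by (simp add: ball_cone_set mat_mult_def sum_cone_set fin s_def u_def sum_negf)
       (auto simp: id_mat_def)
  then show ?thesis by (auto simp: contractible_def)
qed

section \<open>Tensor products\<close>

text \<open>The differential \<open>D \<otimes> 1 + \<sigma> \<otimes> D'\<close>, where the Koszul sign \<open>\<sigma>\<close> makes the two summands anticommute.\<close>

definition tensor_diff :: "('a \<Rightarrow> nat) \<Rightarrow> ('a \<Rightarrow> 'a \<Rightarrow> 'k::field) \<Rightarrow> ('b \<Rightarrow> 'b \<Rightarrow> 'k) \<Rightarrow> 'a \<times> 'b \<Rightarrow> 'a \<times> 'b \<Rightarrow> 'k" where
  "tensor_diff h D D' x y = D (fst x) (fst y) * id_mat (snd x) (snd y)
     + ((-1) ^ h (fst x) * id_mat (fst x) (fst y)) * D' (snd x) (snd y)"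

definition kron :: "('a \<Rightarrow> 'a \<Rightarrow> 'k::field) \<Rightarrow> ('b \<Rightarrow> 'b \<Rightarrow> 'k) \<Rightarrow> 'a \<times> 'b \<Rightarrow> 'a \<times> 'b \<Rightarrow> 'k" where
  "kron M N x y = M (fst x) (fst y) * N (snd x) (snd y)"

lemma mat_mult_kron:
  "mat_mult (A \<times> B) (kron M N) (kron M' N') x y =
    mat_mult A M M' (fst x) (fst y) * mat_mult B N N' (snd x) (snd y)"
proof -
  have "mat_mult (A \<times> B) (kron M N) (kron M' N') x y =
     (\<Sum>z\<in>A. \<Sum>z'\<in>B. (M (fst x) z * M' z (fst y)) * (N (snd x) z' * N' z' (snd y)))"
    by (simp add: mat_mult_def kron_def sum.cartesian_product' algebra_simps split: prod.splits)
  then show ?thesis by (simp add: mat_mult_def sum_product)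
qed

definition sign_mat :: "('a \<Rightarrow> nat) \<Rightarrow> 'a \<Rightarrow> 'a \<Rightarrow> 'k::field" where
  "sign_mat h x y = (-1) ^ h x * id_mat x y"

lemma tensor_diff_kron: "tensor_diff h D D' = (\<lambda>x y. kron D id_mat x y + kron (sign_mat h) D' x y)"
  by (simp add: tensor_diff_def kron_def sign_mat_def fun_eq_iff)

lemma mat_mult_sign_left:
  assumes "finite B" "x \<in> B" shows "mat_mult B (sign_mat h) M x y = (-1) ^ h x * M x y"
proof -
  have "mat_mult B (sign_mat h) M x y = (-1) ^ h x * mat_mult B id_mat M x y"
    by (simp add: mat_mult_def sign_mat_def sum_distrib_left mult.assoc)
  then show ?thesis using assms by (simp add: mat_mult_id_left)
qed

lemma mat_mult_sign_right:
  assumes "finite B" "y \<in> B" shows "mat_mult B M (sign_mat h) x y = (-1) ^ h y * M x y"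
proof -
  have "mat_mult B M (sign_mat h) x y = (-1) ^ h y * mat_mult B M id_mat x y"
    unfolding mat_mult_def sum_distrib_left by (intro sum.cong) (auto simp: sign_mat_def id_mat_def)
  then show ?thesis using assms by (simp add: mat_mult_id_right)
qed

lemma augmented_complex_tensor:
  assumes c: "augmented_complex A h D \<epsilon>" and c': "augmented_complex B h' D' \<epsilon>'"
  shows "augmented_complex (A \<times> B) (\<lambda>x. h (fst x) + h' (snd x)) (tensor_diff h D D')
           (\<lambda>x. \<epsilon> (fst x) * \<epsilon>' (snd x))"
proof -
  have fin: "finite A" "finite B" using c c' by (auto simp: augmented_complex_def)
  have D: "D x y \<noteq> 0 \<Longrightarrow> h y = Suc (h x)" if "x \<in> A" "y \<in> A" for x y
    using c that by (auto simp: augmented_complex_def)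
  have 4: "mat_mult (A \<times> B) (tensor_diff h D D') (tensor_diff h D D') x y = 0"
    if "x \<in> A \<times> B" "y \<in> A \<times> B" for x y
  proof -
    have xy: "fst x \<in> A" "fst y \<in> A" "snd x \<in> B" "snd y \<in> B" using that by auto
    have "(-1) ^ h (fst x) * D (fst x) (fst y) + (-1) ^ h (fst y) * D (fst x) (fst y) = 0"
      using D[OF xy(1,2)] by (cases "D (fst x) (fst y) = 0") auto
    then have "D' (snd x) (snd y) * ((-1) ^ h (fst x) * D (fst x) (fst y) + (-1) ^ h (fst y) * D (fst x) (fst y)) = 0" by simp
    then show ?thesis using xy c c' unfolding tensor_diff_kron mat_mult_add_left mat_mult_add_right mat_mult_kron
      by (simp add: mat_mult_id_left mat_mult_id_right mat_mult_sign_left mat_mult_sign_right fin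
        augmented_complex_def algebra_simps)
  qed
  have 5: "(\<Sum>x\<in>A \<times> B. \<epsilon> (fst x) * \<epsilon>' (snd x) * tensor_diff h D D' x y) = 0" if "y \<in> A \<times> B" for y
  proof -
    have xy: "fst y \<in> A" "snd y \<in> B" using that by auto
    let ?E = "\<lambda>_. \<epsilon>" and ?E' = "\<lambda>_. \<epsilon>'"
    have "(\<Sum>x\<in>A \<times> B. \<epsilon> (fst x) * \<epsilon>' (snd x) * tensor_diff h D D' x y)
      = mat_mult (A \<times> B) (kron ?E ?E') (tensor_diff h D D') y y"
      by (simp add: mat_mult_def kron_def)
    also have "\<dots> = 0"
      using xy c c' unfolding tensor_diff_kron mat_mult_add_right mat_mult_kron
      by (simp add: augmented_complex_def mat_mult_def)
    finally show ?thesis .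
  qed
  have 2: "h (fst y) + h' (snd y) = Suc (h (fst x) + h' (snd x))"
    if "x \<in> A \<times> B" "y \<in> A \<times> B" "tensor_diff h D D' x y \<noteq> 0" for x y
  proof -
    from that(3) consider "D (fst x) (fst y) \<noteq> 0" "snd x = snd y" | "D' (snd x) (snd y) \<noteq> 0" "fst x = fst y"
      by (cases "D (fst x) (fst y) = 0") (auto simp: tensor_diff_def id_mat_def split: if_splits)
    then show ?thesis using c c' that(1,2) by cases (auto simp: augmented_complex_def)
  qed
  have 3: "h (fst x) + h' (snd x) = 0" if "x \<in> A \<times> B" "\<epsilon> (fst x) * \<epsilon>' (snd x) \<noteq> 0" for x
    using c c' that by (auto simp: augmented_complex_def)
  show ?thesis unfolding augmented_complex_def
    by (intro conjI ballI impI) ((rule 2 3 4 5; assumption) | simp add: fin)+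
qed

text \<open>If \<open>(s, u)\<close> and \<open>(s', u')\<close> are contractions, then \<open>s \<otimes> 1 + u \<epsilon> \<otimes> s'\<close> is a contraction: first contract the left
  factor to the line spanned by \<open>u\<close>, then contract the right factor over this line.\<close>

lemma contractible_tensor:
  fixes D :: "'a \<Rightarrow> 'a \<Rightarrow> 'k::field"
  assumes c: "augmented_complex A h D \<epsilon>" and c': "augmented_complex B h' D' \<epsilon>'"
    and e: "contractible A h D \<epsilon>" and e': "contractible B h' D' \<epsilon>'"
  shows "contractible (A \<times> B) (\<lambda>x. h (fst x) + h' (snd x)) (tensor_diff h D D')
           (\<lambda>x. \<epsilon> (fst x) * \<epsilon>' (snd x))"
proof -
  have fin: "finite A" "finite B" using c c' by (auto simp: augmented_complex_def)
  obtain s u where s: "contraction A h D \<epsilon> s u" using e by (auto simp: contractible_def)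
  obtain s' u' where s': "contraction B h' D' \<epsilon>' s' u'" using e' by (auto simp: contractible_def)
  let ?P = "\<lambda>x y. u x * \<epsilon> y"
  define t where "t = (\<lambda>x y. kron s id_mat x y + kron ?P s' x y)"
  have main: "mat_mult (A \<times> B) (tensor_diff h D D') t x y + mat_mult (A \<times> B) t (tensor_diff h D D') x y
       + (u (fst x) * u' (snd x)) * (\<epsilon> (fst y) * \<epsilon>' (snd y)) = id_mat x y"
    if "x \<in> A \<times> B" "y \<in> A \<times> B" for x y
  proof -
    have xy: "fst x \<in> A" "fst y \<in> A" "snd x \<in> B" "snd y \<in> B" using that by auto
    have DP: "mat_mult A D ?P (fst x) (fst y) = 0"
    proof -
      have "D (fst x) z * (u z * \<epsilon> (fst y)) = 0" if "z \<in> A" for z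
        using c s xy that unfolding augmented_complex_def contraction_def by (metis Zero_not_Suc mult_zero_left mult_zero_right)
      then show ?thesis unfolding mat_mult_def by (simp add: sum.neutral)
    qed
    have PD: "mat_mult A ?P D (fst x) (fst y) = 0"
    proof -
      have "mat_mult A ?P D (fst x) (fst y) = u (fst x) * (\<Sum>z\<in>A. \<epsilon> z * D z (fst y))"
        by (simp add: mat_mult_def sum_distrib_left mult.assoc)
      then show ?thesis using c xy by (simp add: augmented_complex_def)
    qed
    have \<sigma>s: "(-1) ^ h (fst x) * s (fst x) (fst y) = - ((-1) ^ h (fst y) * s (fst x) (fst y))"
      using s xy unfolding contraction_def by (cases "s (fst x) (fst y) = 0") auto
    have \<sigma>P: "(-1) ^ h (fst x) * (u (fst x) * \<epsilon> (fst y)) = u (fst x) * \<epsilon> (fst y)"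
      using s xy unfolding contraction_def by (cases "u (fst x) = 0") auto
    have P\<sigma>: "(-1) ^ h (fst y) * (u (fst x) * \<epsilon> (fst y)) = u (fst x) * \<epsilon> (fst y)"
      using c xy unfolding augmented_complex_def by (cases "\<epsilon> (fst y) = 0") auto
    have H: "mat_mult A D s (fst x) (fst y) = id_mat (fst x) (fst y) - mat_mult A s D (fst x) (fst y) - u (fst x) * \<epsilon> (fst y)"
      using s xy unfolding contraction_def by (simp add: algebra_simps)
    have H': "mat_mult B D' s' (snd x) (snd y) = id_mat (snd x) (snd y) - mat_mult B s' D' (snd x) (snd y) - u' (snd x) * \<epsilon>' (snd y)"
      using s' xy unfolding contraction_def by (simp add: algebra_simps)
    have id: "id_mat (fst x) (fst y) * id_mat (snd x) (snd y) = (id_mat x y :: 'k)"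
      by (auto simp: id_mat_def prod_eq_iff)
    have "mat_mult (A \<times> B) (tensor_diff h D D') t x y + mat_mult (A \<times> B) t (tensor_diff h D D') x y
       + (u (fst x) * u' (snd x)) * (\<epsilon> (fst y) * \<epsilon>' (snd y))
      = (mat_mult A D s (fst x) (fst y) + mat_mult A s D (fst x) (fst y)) * id_mat (snd x) (snd y)
        + ((-1) ^ h (fst x) * s (fst x) (fst y) + (-1) ^ h (fst y) * s (fst x) (fst y)) * D' (snd x) (snd y)
        + (((-1) ^ h (fst x) * (u (fst x) * \<epsilon> (fst y))) * mat_mult B D' s' (snd x) (snd y)
          + ((-1) ^ h (fst y) * (u (fst x) * \<epsilon> (fst y))) * mat_mult B s' D' (snd x) (snd y))
        + (u (fst x) * \<epsilon> (fst y)) * (u' (snd x) * \<epsilon>' (snd y))"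
      unfolding tensor_diff_kron t_def mat_mult_add_left mat_mult_add_right mat_mult_kron
      by (simp only: xy fin mat_mult_id_left mat_mult_id_right mat_mult_sign_left mat_mult_sign_right DP PD)
        (simp add: algebra_simps)
    also have "\<dots> = id_mat x y"
      unfolding \<sigma>s \<sigma>P P\<sigma> H H' id[symmetric] by (simp add: algebra_simps)
    finally show ?thesis .
  qed
  have "(\<Sum>x\<in>A \<times> B. (\<epsilon> (fst x) * \<epsilon>' (snd x)) * (u (fst x) * u' (snd x))) =
     (\<Sum>x\<in>A. \<epsilon> x * u x) * (\<Sum>x\<in>B. \<epsilon>' x * u' x)"
    by (simp add: sum.cartesian_product' sum_product algebra_simps split: prod.splits)
  also have "\<dots> = 1" using s s' by (simp add: contraction_def)
  finally have 3: "(\<Sum>x\<in>A \<times> B. (\<epsilon> (fst x) * \<epsilon>' (snd x)) * (u (fst x) * u' (snd x))) = 1" .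
  have 1: "h (fst x) + h' (snd x) = Suc (h (fst y) + h' (snd y))"
    if "x \<in> A \<times> B" "y \<in> A \<times> B" "t x y \<noteq> 0" for x y
  proof -
    from that(3) consider "s (fst x) (fst y) \<noteq> 0" "snd x = snd y"
      | "s' (snd x) (snd y) \<noteq> 0" "u (fst x) \<noteq> 0" "\<epsilon> (fst y) \<noteq> 0"
      by (cases "s (fst x) (fst y) = 0") (auto simp: t_def kron_def id_mat_def split: if_splits)
    then show ?thesis
    proof cases
      case 1 then show ?thesis using s that(1,2) by (auto simp: contraction_def)
    next
      case 2
      then have "h (fst x) = 0" "h (fst y) = 0" "h' (snd x) = Suc (h' (snd y))"
        using s s' c that(1,2) by (auto simp: contraction_def augmented_complex_def)
      then show ?thesis by simp
    qed
  qed
  have 2: "h (fst x) + h' (snd x) = 0" if "x \<in> A \<times> B" "u (fst x) * u' (snd x) \<noteq> 0" for x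
    using s s' that by (auto simp: contraction_def)
  have "contraction (A \<times> B) (\<lambda>x. h (fst x) + h' (snd x)) (tensor_diff h D D')
     (\<lambda>x. \<epsilon> (fst x) * \<epsilon>' (snd x)) t (\<lambda>x. u (fst x) * u' (snd x))"
    unfolding contraction_def
    by (intro conjI ballI impI) (fact 3 | (rule 1 2 main; assumption))+
  then show ?thesis by (auto simp: contractible_def)
qed

section \<open>Cancelling an invertible entry\<close>

text \<open>Gaussian elimination with pivot \<open>D c b\<close>: the Schur complement of the pivot.\<close>

definition cancel_diff :: "('b \<Rightarrow> 'b \<Rightarrow> 'k::field) \<Rightarrow> 'b \<Rightarrow> 'b \<Rightarrow> 'b \<Rightarrow> 'b \<Rightarrow> 'k" where
  "cancel_diff D c b x y = D x y - D x b * D c y / D c b"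

text \<open>A chain map \<open>\<iota>\<close> with a retraction \<open>p\<close> that is also a chain map transports contractions: \<open>D'\<close> is
  necessarily \<open>p D \<iota>\<close>, and \<open>p s \<iota>\<close> is a homotopy for it.\<close>

lemma contractible_retract:
  assumes B': "B' \<subseteq> B" "finite B"
    and c: "augmented_complex B h D \<epsilon>"
    and p\<iota>: "\<And>x y. x \<in> B' \<Longrightarrow> y \<in> B' \<Longrightarrow> mat_mult B p \<iota> x y = id_mat x y"
    and pD: "\<And>x y. x \<in> B' \<Longrightarrow> y \<in> B \<Longrightarrow> mat_mult B' D' p x y = mat_mult B p D x y"
    and \<iota>D: "\<And>x y. x \<in> B \<Longrightarrow> y \<in> B' \<Longrightarrow> mat_mult B' \<iota> D' x y = mat_mult B D \<iota> x y"
    and \<epsilon>p: "\<And>y. y \<in> B \<Longrightarrow> (\<Sum>x\<in>B'. \<epsilon> x * p x y) = \<epsilon> y"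
    and \<epsilon>\<iota>: "\<And>y. y \<in> B' \<Longrightarrow> (\<Sum>x\<in>B. \<epsilon> x * \<iota> x y) = \<epsilon> y"
    and hp: "\<And>x y. x \<in> B' \<Longrightarrow> y \<in> B \<Longrightarrow> p x y \<noteq> 0 \<Longrightarrow> h x = h y"
    and h\<iota>: "\<And>x y. x \<in> B \<Longrightarrow> y \<in> B' \<Longrightarrow> \<iota> x y \<noteq> 0 \<Longrightarrow> h x = h y"
    and hD': "\<And>x y. x \<in> B' \<Longrightarrow> y \<in> B' \<Longrightarrow> D' x y \<noteq> 0 \<Longrightarrow> h y = Suc (h x)"
  shows "augmented_complex B' h D' \<epsilon>"
    and "contractible B h D \<epsilon> \<Longrightarrow> contractible B' h D' \<epsilon>"
proof -
  have fin': "finite B'" using B' finite_subset by blast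
  have sub: "x \<in> B' \<Longrightarrow> x \<in> B" for x using B' by auto
  have D': "D' x y = mat_mult B p (mat_mult B D \<iota>) x y" if "x \<in> B'" "y \<in> B'" for x y
  proof -
    have "D' x y = mat_mult B' D' (mat_mult B p \<iota>) x y"
      using that fin' mat_mult_id_right[of B' y D' x]
      by (simp add: p\<iota> cong: mat_mult_cong)
    also have "\<dots> = mat_mult B (mat_mult B' D' p) \<iota> x y" by (simp add: mat_mult_assoc)
    also have "\<dots> = mat_mult B (mat_mult B p D) \<iota> x y" using that by (intro mat_mult_cong) (simp_all add: pD)
    finally show ?thesis by (simp add: mat_mult_assoc)
  qed
  have DD: "mat_mult B' D' D' x y = 0" if "x \<in> B'" "y \<in> B'" for x y
  proof -
    have "mat_mult B' D' D' x y = mat_mult B' (mat_mult B p (mat_mult B D \<iota>)) D' x y"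
      using that by (intro mat_mult_cong) (simp_all add: D')
    also have "\<dots> = mat_mult B p (mat_mult B D (mat_mult B' \<iota> D')) x y"
      by (simp add: mat_mult_assoc mat_mult_assoc[abs_def])
    also have "\<dots> = mat_mult B p (mat_mult B D (mat_mult B D \<iota>)) x y"
      using that by (intro mat_mult_cong) (simp_all add: \<iota>D)
    also have "\<dots> = mat_mult B p (mat_mult B (mat_mult B D D) \<iota>) x y"
      by (simp add: mat_mult_assoc[abs_def])
    also have "\<dots> = mat_mult B p (\<lambda>_ _. 0) x y"
      using c by (intro mat_mult_cong) (simp_all add: mat_mult_def[of B "mat_mult B D D"] augmented_complex_def)
    finally show ?thesis by (simp add: mat_mult_def)
  qed
  have \<epsilon>D: "(\<Sum>x\<in>B'. \<epsilon> x * D' x y) = 0" if y: "y \<in> B'" for y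
  proof -
    let ?E = "\<lambda>_::unit. \<epsilon>"
    have "(\<Sum>x\<in>B'. \<epsilon> x * D' x y) = mat_mult B' ?E (mat_mult B p (mat_mult B D \<iota>)) () y"
      unfolding mat_mult_def[of B'] using y by (intro sum.cong) (simp_all add: D')
    also have "\<dots> = mat_mult B (mat_mult B' ?E p) (mat_mult B D \<iota>) () y" by (simp add: mat_mult_assoc)
    also have "\<dots> = mat_mult B ?E (mat_mult B D \<iota>) () y"
      by (intro mat_mult_cong) (simp_all add: mat_mult_def[of B'] \<epsilon>p)
    also have "\<dots> = mat_mult B (mat_mult B ?E D) \<iota> () y" by (simp add: mat_mult_assoc)
    also have "\<dots> = mat_mult B (\<lambda>_ _. 0) \<iota> () y"
      using c by (intro mat_mult_cong) (simp_all add: mat_mult_def augmented_complex_def)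
    finally show ?thesis by (simp add: mat_mult_def)
  qed
  show "augmented_complex B' h D' \<epsilon>"
    using c fin' hD' DD \<epsilon>D sub unfolding augmented_complex_def by simp
  assume "contractible B h D \<epsilon>"
  then obtain s u where su: "contraction B h D \<epsilon> s u" by (auto simp: contractible_def)
  let ?P = "\<lambda>x y. u x * \<epsilon> y"
  define s' where "s' = mat_mult B p (mat_mult B s \<iota>)"
  define u' where "u' x = (\<Sum>z\<in>B. p x z * u z)" for x
  have "mat_mult B' D' s' x y + mat_mult B' s' D' x y + u' x * \<epsilon> y = id_mat x y"
    if xy: "x \<in> B'" "y \<in> B'" for x y
  proof -
    have 1: "mat_mult B' D' s' x y = mat_mult B p (mat_mult B (mat_mult B D s) \<iota>) x y"
    proof -
      have "mat_mult B' D' s' x y = mat_mult B (mat_mult B' D' p) (mat_mult B s \<iota>) x y"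
        by (simp add: s'_def mat_mult_assoc)
      also have "\<dots> = mat_mult B (mat_mult B p D) (mat_mult B s \<iota>) x y"
        using xy by (intro mat_mult_cong) (simp_all add: pD)
      finally show ?thesis by (simp add: mat_mult_assoc mat_mult_assoc[abs_def])
    qed
    have 2: "mat_mult B' s' D' x y = mat_mult B p (mat_mult B (mat_mult B s D) \<iota>) x y"
    proof -
      have "mat_mult B' s' D' x y = mat_mult B p (mat_mult B s (mat_mult B' \<iota> D')) x y"
        by (simp add: s'_def mat_mult_assoc mat_mult_assoc[abs_def])
      also have "\<dots> = mat_mult B p (mat_mult B s (mat_mult B D \<iota>)) x y"
        using xy by (intro mat_mult_cong) (simp_all add: \<iota>D)
      finally show ?thesis by (simp add: mat_mult_assoc[abs_def])
    qed
    have 3: "u' x * \<epsilon> y = mat_mult B p (mat_mult B ?P \<iota>) x y"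
    proof -
      have "mat_mult B ?P \<iota> z y = u z * \<epsilon> y" for z
        using \<epsilon>\<iota>[OF xy(2)] by (simp add: mat_mult_def sum_distrib_left[symmetric] mult.assoc)
      then show ?thesis by (simp add: u'_def mat_mult_def[of B p] sum_distrib_right mult.assoc)
    qed
    have "mat_mult B' D' s' x y + mat_mult B' s' D' x y + u' x * \<epsilon> y =
       mat_mult B p (mat_mult B (\<lambda>x y. mat_mult B D s x y + mat_mult B s D x y + ?P x y) \<iota>) x y"
      unfolding 1 2 3 by (simp only: mat_mult_add_left[abs_def] mat_mult_add_right)
    also have "\<dots> = mat_mult B p \<iota> x y"
    proof (intro mat_mult_cong refl)
      fix z assume z: "z \<in> B"
      have "mat_mult B (\<lambda>x y. mat_mult B D s x y + mat_mult B s D x y + ?P x y) \<iota> z y = mat_mult B id_mat \<iota> z y"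
        using su z by (intro mat_mult_cong) (simp_all add: contraction_def)
      then show "mat_mult B (\<lambda>x y. mat_mult B D s x y + mat_mult B s D x y + ?P x y) \<iota> z y = \<iota> z y"
        using z B' by (simp add: mat_mult_id_left)
    qed
    finally show ?thesis using p\<iota> xy by simp
  qed
  moreover have "h x = Suc (h y)" if xy: "x \<in> B'" "y \<in> B'" "s' x y \<noteq> 0" for x y
  proof -
    obtain z where z: "z \<in> B" "p x z \<noteq> 0" "mat_mult B s \<iota> z y \<noteq> 0"
      using xy(3) unfolding s'_def mat_mult_def[of B p] by (auto elim!: sum.not_neutral_contains_not_neutral)
    then obtain w where "w \<in> B" "s z w \<noteq> 0" "\<iota> w y \<noteq> 0"
      unfolding mat_mult_def by (auto elim!: sum.not_neutral_contains_not_neutral)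
    then show ?thesis using z hp[of x z] h\<iota>[of w y] su xy by (auto simp: contraction_def)
  qed
  moreover have "h x = 0" if x: "x \<in> B'" "u' x \<noteq> 0" for x
  proof -
    obtain z where z: "z \<in> B" "p x z \<noteq> 0" "u z \<noteq> 0"
      using x(2) unfolding u'_def by (auto elim!: sum.not_neutral_contains_not_neutral)
    then show ?thesis using hp[of x z] su x by (auto simp: contraction_def)
  qed
  moreover have "(\<Sum>x\<in>B'. \<epsilon> x * u' x) = 1"
  proof -
    have "(\<Sum>x\<in>B'. \<epsilon> x * u' x) = mat_mult B' (\<lambda>_. \<epsilon>) (mat_mult B p (\<lambda>x _. u x)) () ()"
      by (simp add: mat_mult_def u'_def)
    also have "\<dots> = mat_mult B (mat_mult B' (\<lambda>_. \<epsilon>) p) (\<lambda>x _. u x) () ()" by (simp add: mat_mult_assoc)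
    also have "\<dots> = mat_mult B (\<lambda>_. \<epsilon>) (\<lambda>x _. u x) () ()"
      by (intro mat_mult_cong) (simp_all add: mat_mult_def[of B'] \<epsilon>p)
    finally show ?thesis using su by (simp add: mat_mult_def contraction_def)
  qed
  ultimately have "contraction B' h D' \<epsilon> s' u'" unfolding contraction_def by blast
  then show "contractible B' h D' \<epsilon>" by (auto simp: contractible_def)
qed

text \<open>The pivot spans a contractible subcomplex with basis \<open>b\<close> and \<open>D b\<close>, and what is left after dividing it
  out is a retract of the whole complex.\<close>

lemma contractible_cancel:
  assumes c: "augmented_complex B h D \<epsilon>" and bc: "c \<in> B" "b \<in> B" "D c b \<noteq> 0"
  defines "B' \<equiv> B - {b, c}"
  shows "augmented_complex B' h (cancel_diff D c b) \<epsilon>" (is ?A)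
    and "contractible B h D \<epsilon> \<Longrightarrow> contractible B' h (cancel_diff D c b) \<epsilon>" (is "_ \<Longrightarrow> ?C")
proof -
  \<comment> \<open>The projection sends \<open>b\<close> to 0 and \<open>c\<close> to the vector that it equals modulo the boundary of \<open>b\<close>;
    the inclusion corrects \<open>y\<close> by a multiple of \<open>b\<close> so that \<open>c\<close> does not occur in its boundary.\<close>
  define p where "p x y = (if y = b then 0 else if y = c then - D x b / D c b else id_mat x y)" for x y
  define \<iota> where "\<iota> x y = (if x = b then - D c y / D c b else id_mat x y)" for x y
  have fin: "finite B" using c by (simp add: augmented_complex_def)
  have hD: "D x y \<noteq> 0 \<Longrightarrow> h y = Suc (h x)" if "x \<in> B" "y \<in> B" for x y
    using c that by (auto simp: augmented_complex_def)
  have hbc: "h b = Suc (h c)" using hD bc by auto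
  then have bnc: "b \<noteq> c" by auto
  have B: "B = insert b (insert c B')" "b \<notin> insert c B'" "c \<notin> B'" "finite B'"
    using bc bnc fin by (auto simp: B'_def)
  have sumB: "(\<Sum>z\<in>B. f z) = f b + f c + (\<Sum>z\<in>B'. f z)" for f :: "_ \<Rightarrow> 'b"
    by (subst B(1)) (use B in \<open>simp add: add.assoc\<close>)
  have Dbb: "D c c = 0" "D b b = 0" "D b c = 0" using hD[of c c] hD[of b b] hD[of b c] bc hbc by auto
  have eb: "\<epsilon> b = 0" using c bc hbc by (auto simp: augmented_complex_def)
  have DDs: "(\<Sum>z\<in>B'. D x z * D z y) = - (D x b * D b y) - D x c * D c y" if "x \<in> B" "y \<in> B" for x y
  proof -
    have "(\<Sum>z\<in>B. D x z * D z y) = 0" using c that by (simp add: augmented_complex_def mat_mult_def)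
    then show ?thesis unfolding sumB by (simp add: eq_diff_eq eq_neg_iff_add_eq_0 ac_simps)
  qed
  have \<epsilon>Ds: "(\<Sum>z\<in>B'. \<epsilon> z * D z y) = - \<epsilon> c * D c y" if "y \<in> B" for y
  proof -
    have "(\<Sum>z\<in>B. \<epsilon> z * D z y) = 0" using c that by (simp add: augmented_complex_def)
    then show ?thesis unfolding sumB by (simp add: eb add_eq_0_iff2)
  qed
  have idl: "(\<Sum>z\<in>B'. id_mat x z * f z) = f x" if "x \<in> B'" for x and f :: "_ \<Rightarrow> 'b"
    using that B(4) mat_mult_id_left[of B' x "\<lambda>z _. f z"] by (simp add: mat_mult_def)
  have idr: "(\<Sum>z\<in>B'. f z * id_mat z x) = f x" if "x \<in> B'" for x and f :: "_ \<Rightarrow> 'b"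
    using that B(4) mat_mult_id_right[of B' x "\<lambda>_ z. f z"] by (simp add: mat_mult_def)
  have id0: "id_mat b x = (0::'b)" "id_mat c x = (0::'b)" "id_mat x b = (0::'b)" "id_mat x c = (0::'b)" if "x \<in> B'" for x
    using that by (auto simp: id_mat_def B'_def)
  have nB': "x \<noteq> b \<and> x \<noteq> c" if "x \<in> B'" for x using that by (auto simp: B'_def)
  have p': "p x z = id_mat x z" if "z \<in> B'" for x z using nB'[OF that] by (simp add: p_def)
  have \<iota>': "\<iota> z x = id_mat z x" if "z \<in> B'" for x z using nB'[OF that] by (simp add: \<iota>_def)
  note R = contractible_retract[of B' B h D \<epsilon> p \<iota> "cancel_diff D c b"]
  have 1: "mat_mult B p \<iota> x y = id_mat x y" if "x \<in> B'" "y \<in> B'" for x y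
    unfolding mat_mult_def sumB using that
    by (simp add: p' \<iota>' idl cong: sum.cong) (simp add: p_def \<iota>_def bnc id0)
  have 2: "mat_mult B' (cancel_diff D c b) p x y = mat_mult B p D x y" if xy: "x \<in> B'" "y \<in> B" for x y
  proof -
    have xB: "x \<in> B" using xy by (simp add: B'_def)
    have r: "mat_mult B p D x y = - D x b / D c b * D c y + D x y"
      unfolding mat_mult_def sumB using xy by (simp add: p' idl cong: sum.cong) (simp add: p_def bnc bnc[symmetric])
    consider "y = b" | "y = c" | "y \<in> B'" using xy by (auto simp: B'_def)
    then show ?thesis
    proof cases
      case 1 then show ?thesis unfolding r using bc by (simp add: mat_mult_def p_def)
    next
      case 2
      have "mat_mult B' (cancel_diff D c b) p x c =
          (\<Sum>z\<in>B'. D x b / (D c b * D c b) * (D c z * D z b) - 1 / D c b * (D x z * D z b))"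
        unfolding mat_mult_def using bnc by (intro sum.cong) (simp_all add: cancel_diff_def p_def algebra_simps)
      also have "\<dots> = D x b / (D c b * D c b) * (\<Sum>z\<in>B'. D c z * D z b) - 1 / D c b * (\<Sum>z\<in>B'. D x z * D z b)"
        by (simp add: sum_subtractf sum_distrib_left)
      also have "\<dots> = D x c" using bc xB by (simp add: DDs Dbb)
      finally show ?thesis using r Dbb unfolding 2 by simp
    next
      case 3
      then have "mat_mult B' (cancel_diff D c b) p x y = cancel_diff D c b x y"
        unfolding mat_mult_def by (simp add: p_def nB' idr)
      then show ?thesis unfolding r by (simp add: cancel_diff_def)
    qed
  qed
  have 3: "mat_mult B' \<iota> (cancel_diff D c b) x y = mat_mult B D \<iota> x y" if xy: "x \<in> B" "y \<in> B'" for x y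
  proof -
    have yB: "y \<in> B" using xy by (simp add: B'_def)
    have r: "mat_mult B D \<iota> x y = D x y - D x b * D c y / D c b"
      unfolding mat_mult_def sumB using xy by (simp add: \<iota>' idr cong: sum.cong) (simp add: \<iota>_def bnc[symmetric] id0)
    consider "x = b" | "x = c" | "x \<in> B'" using xy by (auto simp: B'_def)
    then show ?thesis
    proof cases
      case 1
      have "mat_mult B' \<iota> (cancel_diff D c b) b y =
          (\<Sum>z\<in>B'. D c y / (D c b * D c b) * (D c z * D z b) - 1 / D c b * (D c z * D z y))"
        unfolding mat_mult_def by (intro sum.cong) (simp_all add: cancel_diff_def \<iota>_def algebra_simps)
      also have "\<dots> = D c y / (D c b * D c b) * (\<Sum>z\<in>B'. D c z * D z b) - 1 / D c b * (\<Sum>z\<in>B'. D c z * D z y)"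
        by (simp add: sum_subtractf sum_distrib_left)
      also have "\<dots> = D b y" using bc yB by (simp add: DDs Dbb)
      finally show ?thesis using r Dbb unfolding 1 by simp
    next
      case 2 
      have "mat_mult B' \<iota> (cancel_diff D c b) c y = 0"
        unfolding mat_mult_def using bnc by (intro sum.neutral) (simp add: \<iota>_def id0)
      then show ?thesis using r bc unfolding 2 by simp
    next
      case 3
      then have "mat_mult B' \<iota> (cancel_diff D c b) x y = cancel_diff D c b x y"
        unfolding mat_mult_def by (simp add: \<iota>_def nB' idl)
      then show ?thesis unfolding r by (simp add: cancel_diff_def)
    qed
  qed
  have 4: "(\<Sum>x\<in>B'. \<epsilon> x * p x y) = \<epsilon> y" if y: "y \<in> B" for y
  proof -
    consider "y = b" | "y = c" | "y \<in> B'" using y by (auto simp: B'_def)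
    then show ?thesis
    proof cases
      case 1 then show ?thesis by (simp add: p_def eb)
    next
      case 2
      have "(\<Sum>x\<in>B'. \<epsilon> x * p x c) = - (1 / D c b) * (\<Sum>x\<in>B'. \<epsilon> x * D x b)"
        unfolding sum_distrib_left using bnc by (intro sum.cong) (simp_all add: p_def)
      then show ?thesis using 2 bc by (simp add: \<epsilon>Ds)
    next
      case 3 then show ?thesis by (simp add: p' idr)
    qed
  qed
  have 5: "(\<Sum>x\<in>B. \<epsilon> x * \<iota> x y) = \<epsilon> y" if "y \<in> B'" for y
    unfolding sumB using that by (simp add: \<iota>' idr eb cong: sum.cong) (simp add: \<iota>_def bnc[symmetric] id0)
  have 6: "h x = h y" if "x \<in> B'" "y \<in> B" "p x y \<noteq> 0" for x y
    using that hD[of x b] bc hbc by (auto simp: p_def id_mat_def B'_def split: if_splits)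
  have 7: "h x = h y" if "x \<in> B" "y \<in> B'" "\<iota> x y \<noteq> 0" for x y
    using that hD[of c y] bc hbc by (auto simp: \<iota>_def id_mat_def B'_def split: if_splits)
  have 8: "h y = Suc (h x)" if "x \<in> B'" "y \<in> B'" "cancel_diff D c b x y \<noteq> 0" for x y
  proof -
    have "D x y \<noteq> 0 \<or> (D x b \<noteq> 0 \<and> D c y \<noteq> 0)" using that by (auto simp: cancel_diff_def)
    then show ?thesis using that hD[of x y] hD[of x b] hD[of c y] bc hbc by (auto simp: B'_def)
  qed
  have B'B: "B' \<subseteq> B" by (auto simp: B'_def)
  show ?A by (rule R(1)[OF B'B fin c 1 2 3 4 5 6 7 8])
  show ?C if "contractible B h D \<epsilon>" by (rule R(2)[OF B'B fin c 1 2 3 4 5 6 7 8 that])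
qed

section \<open>Monomials\<close>

abbreviation keys :: "('a \<Rightarrow>\<^sub>0 'b::zero) \<Rightarrow> 'a set" where "keys \<equiv> Poly_Mapping.keys"
abbreviation lookup :: "('a \<Rightarrow>\<^sub>0 'b::zero) \<Rightarrow> 'a \<Rightarrow> 'b" where "lookup \<equiv> Poly_Mapping.lookup"
abbreviation single :: "'a \<Rightarrow> 'b \<Rightarrow> 'a \<Rightarrow>\<^sub>0 'b::zero" where "single \<equiv> Poly_Mapping.single"

definition mdvd :: "('x \<Rightarrow>\<^sub>0 nat) \<Rightarrow> ('x \<Rightarrow>\<^sub>0 nat) \<Rightarrow> bool" where
  "mdvd m a \<longleftrightarrow> (\<forall>x. lookup m x \<le> lookup a x)"

lemma mdvd_refl [simp]: "mdvd m m" by (simp add: mdvd_def)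

lemma mdvd_trans: "mdvd l m \<Longrightarrow> mdvd m n \<Longrightarrow> mdvd l n"
  unfolding mdvd_def by (meson order_trans)

lemma mdvd_zero [simp]: "mdvd 0 m" by (simp add: mdvd_def)

lemma mdvd_add [simp]: "mdvd m (m + n)" "mdvd n (m + n)"
  by (simp_all add: mdvd_def lookup_add)

lemma mdvd_minus_add: "mdvd m a \<Longrightarrow> (a - m) + m = a"
  by (rule poly_mapping_eqI) (simp add: mdvd_def lookup_add lookup_minus)

lemma in_keys_nat: "x \<in> keys m \<longleftrightarrow> lookup m x \<noteq> (0::nat)"
  by (simp add: in_keys_iff)

lemma keys_add_nat: "keys (m + n) = keys m \<union> keys (n :: 'x \<Rightarrow>\<^sub>0 nat)"
  by (auto simp: in_keys_nat lookup_add)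

lemma keys_minus_nat: "keys (m - n) \<subseteq> keys (m :: 'x \<Rightarrow>\<^sub>0 nat)"
  by (auto simp: in_keys_nat lookup_minus)

text \<open>The least common multiple: subtraction of exponents is truncated, so the sum is the pointwise
  maximum.\<close>

definition mlcm :: "('x \<Rightarrow>\<^sub>0 nat) \<Rightarrow> ('x \<Rightarrow>\<^sub>0 nat) \<Rightarrow> 'x \<Rightarrow>\<^sub>0 nat" where
  "mlcm m n = m + (n - m)"

lemma mlcm_mdvd_iff: "mdvd (mlcm m n) a \<longleftrightarrow> mdvd m a \<and> mdvd n a"
proof -
  have "p + (q - p) \<le> c \<longleftrightarrow> p \<le> c \<and> q \<le> c" for p q c :: nat by auto
  then show ?thesis by (auto simp: mdvd_def mlcm_def lookup_add lookup_minus)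
qed

lemma keys_mlcm: "keys (mlcm m n) \<subseteq> keys m \<union> keys n"
  using keys_minus_nat[of n m] by (auto simp: mlcm_def keys_add_nat)

lemma mdvd_add_coprime_iff:
  assumes "keys m \<inter> keys n = {}"
  shows "mdvd (m + n) a \<longleftrightarrow> mdvd m a \<and> mdvd n a"
proof -
  have "lookup m x = 0 \<or> lookup n x = 0" for x
    using assms by (auto simp: in_keys_nat)
  then have "lookup (m + n) x \<le> lookup a x \<longleftrightarrow>
    lookup m x \<le> lookup a x \<and> lookup n x \<le> lookup a x" for x
    by (metis add_0 add_0_right lookup_add le0)
  then show ?thesis by (auto simp: mdvd_def)
qed

section \<open>Multigraded resolutions of monomial ideals\<close>

text \<open>The basis elements that contribute to multidegree \<open>a\<close>.\<close>

definition below :: "('b \<Rightarrow> ('x \<Rightarrow>\<^sub>0 nat)) \<Rightarrow> 'b set \<Rightarrow> ('x \<Rightarrow>\<^sub>0 nat) \<Rightarrow> 'b set" where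
  "below g B a = {b \<in> B. mdvd (g b) a}"

text \<open>A multigraded free resolution of the monomial ideal generated by \<open>U\<close>, encoded by scalars. Entry
  \<open>(x, y)\<close> of the differential is \<open>D x y\<close> times the quotient of \<open>g y\<close> by \<open>g x\<close>. In multidegree \<open>a\<close> the ideal
  is the ground field if some \<open>u \<in> U\<close> divides \<open>a\<close> and zero otherwise, so being a resolution means that the
  strand in multidegree \<open>a\<close> is contractible or empty, accordingly. The condition on the variables is
  what keeps resolutions of ideals in disjoint variables apart.\<close>

definition monomial_resolution ::
  "('x \<Rightarrow>\<^sub>0 nat) set \<Rightarrow> 'b set \<Rightarrow> ('b \<Rightarrow> nat) \<Rightarrow> ('b \<Rightarrow> ('x \<Rightarrow>\<^sub>0 nat)) \<Rightarrow>
   ('b \<Rightarrow> 'b \<Rightarrow> 'k::field) \<Rightarrow> ('b \<Rightarrow> 'k) \<Rightarrow> bool" where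
  "monomial_resolution U B h g D \<epsilon> \<longleftrightarrow>
     augmented_complex B h D \<epsilon> \<and>
     (\<forall>x\<in>B. \<forall>y\<in>B. D x y \<noteq> 0 \<longrightarrow> mdvd (g x) (g y)) \<and>
     (\<forall>b\<in>B. keys (g b) \<subseteq> (\<Union>u\<in>U. keys u)) \<and>
     (\<forall>a. below g B a \<noteq> {} \<longleftrightarrow> (\<exists>u\<in>U. mdvd u a)) \<and>
     (\<forall>a. below g B a \<noteq> {} \<longrightarrow> contractible (below g B a) h D \<epsilon>)"

text \<open>An entry of the differential has a nonzero constant term just when it is nonzero and its row and
  column have the same degree; minimality excludes this.\<close>

definition minimal_resolution where
  "minimal_resolution U B h g D \<epsilon> \<longleftrightarrow>
     monomial_resolution U B h g D \<epsilon> \<and> (\<forall>x\<in>B. \<forall>y\<in>B. g x = g y \<longrightarrow> D x y = 0)"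

lemma below_empty [simp]: "below g {} a = {}" by (simp add: below_def)

text \<open>The boundary of a basis element only involves basis elements whose degrees divide its own, so
  each strand is a subcomplex.\<close>

lemma augmented_complex_below:
  assumes c: "augmented_complex B h D \<epsilon>"
    and m: "\<And>x y. x \<in> B \<Longrightarrow> y \<in> B \<Longrightarrow> D x y \<noteq> 0 \<Longrightarrow> mdvd (g x) (g y)"
  shows "augmented_complex (below g B a) h D \<epsilon>"
proof -
  have sub: "below g B a \<subseteq> B" "finite B" using c by (auto simp: below_def augmented_complex_def)
  have "(\<Sum>z\<in>below g B a. f z * D z y) = (\<Sum>z\<in>B. f z * D z y)" if "y \<in> below g B a" for f y
    by (rule sum.mono_neutral_left) (use sub that m mdvd_trans in \<open>fastforce simp: below_def\<close>)+
  then show ?thesis using c sub unfolding augmented_complex_def mat_mult_def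
    by (simp add: finite_subset subset_iff)
qed

lemma minimal_resolution_image:
  fixes f :: "'b \<Rightarrow> 'c"
  assumes f: "inj_on f B"
    and r: "minimal_resolution U B (\<lambda>x. h (f x)) (\<lambda>x. g (f x)) (\<lambda>x y. D (f x) (f y)) (\<lambda>x. \<epsilon> (f x))"
  shows "minimal_resolution U (f ` B) h g D \<epsilon>"
proof -
  have b: "below g (f ` B) a = f ` below (\<lambda>x. g (f x)) B a" for a by (auto simp: below_def)
  have "contractible (f ` below (\<lambda>x. g (f x)) B a) h D \<epsilon>" if "below (\<lambda>x. g (f x)) B a \<noteq> {}" for a
    by (rule contractible_image) (use r f that in \<open>auto simp: minimal_resolution_def monomial_resolution_def below_def intro: inj_on_subset\<close>)
  moreover have "augmented_complex (f ` B) h D \<epsilon>"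
    using r by (intro augmented_complex_image f) (simp add: minimal_resolution_def monomial_resolution_def)
  ultimately show ?thesis using r
    unfolding minimal_resolution_def monomial_resolution_def b ball_simps image_is_empty by blast
qed

lemma monomial_resolution_empty: "monomial_resolution {} {} h g D \<epsilon>"
  by (simp add: monomial_resolution_def augmented_complex_def)

fun cone_degree :: "('x \<Rightarrow>\<^sub>0 nat) \<Rightarrow> ('b \<Rightarrow> ('x \<Rightarrow>\<^sub>0 nat)) \<Rightarrow> 'b + 'b option \<Rightarrow> ('x \<Rightarrow>\<^sub>0 nat)" where
  "cone_degree m g (Inl b) = g b"
| "cone_degree m g (Inr None) = m"
| "cone_degree m g (Inr (Some b)) = mlcm m (g b)"

text \<open>In a multidegree divisible by \<open>m\<close> the strand is a cone and hence contractible, since \<open>lcm(m, g b)\<close> divides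
  \<open>a\<close> exactly if \<open>g b\<close> does. In the other multidegrees nothing changes.\<close>

lemma monomial_resolution_cone:
  assumes r: "monomial_resolution U B h g D \<epsilon>"
  shows "monomial_resolution (insert m U) (cone_set B) (cone_height h) (cone_degree m g) (cone_diff D \<epsilon>) (cone_aug \<epsilon>)"
proof -
  have c: "augmented_complex B h D \<epsilon>" using r by (simp add: monomial_resolution_def)
  have m: "mdvd (g x) (g y)" if "x \<in> B" "y \<in> B" "D x y \<noteq> 0" for x y
    using r that by (auto simp: monomial_resolution_def)
  have b: "below (cone_degree m g) (cone_set B) a = (if mdvd m a then cone_set (below g B a) else Inl ` below g B a)" for a
    by (auto simp: below_def cone_set_def mlcm_mdvd_iff)
  have "contractible (below (cone_degree m g) (cone_set B) a) (cone_height h) (cone_diff D \<epsilon>) (cone_aug \<epsilon>)"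
    if "below (cone_degree m g) (cone_set B) a \<noteq> {}" for a
  proof (cases "mdvd m a")
    case True
    moreover have "finite (below g B a)" using c by (auto simp: below_def augmented_complex_def)
    ultimately show ?thesis unfolding b by (simp add: contractible_cone)
  next
    case False
    then have "contractible (below g B a) h D \<epsilon>" using r that unfolding b by (auto simp: monomial_resolution_def)
    then show ?thesis using False unfolding b by (auto intro!: contractible_image)
  qed
  moreover have "\<forall>x\<in>cone_set B. \<forall>y\<in>cone_set B. cone_diff D \<epsilon> x y \<noteq> 0 \<longrightarrow> mdvd (cone_degree m g x) (cone_degree m g y)"
  proof -
    have l: "mdvd m (mlcm m n)" "mdvd n (mlcm m n)" for n :: "'a \<Rightarrow>\<^sub>0 nat" using mlcm_mdvd_iff mdvd_refl by blast+
    have l': "mdvd (g x) (mlcm m (g y))" if "x \<in> B" "y \<in> B" "D x y \<noteq> 0" for x y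
      using m[OF that] l(2) by (rule mdvd_trans)
    show ?thesis by (simp add: ball_cone_set mlcm_mdvd_iff l l' m id_mat_def)
  qed
  moreover have "\<forall>x\<in>cone_set B. keys (cone_degree m g x) \<subseteq> (\<Union>u\<in>insert m U. keys u)"
  proof -
    have k: "keys (g x) \<subseteq> (\<Union>u\<in>U. keys u)" if "x \<in> B" for x
      using r that by (simp add: monomial_resolution_def)
    have k': "keys (mlcm m (g x)) \<subseteq> keys m \<union> (\<Union>u\<in>U. keys u)" if "x \<in> B" for x
      using k[OF that] keys_mlcm[of m "g x"] by blast
    show ?thesis by (simp add: ball_cone_set k k' le_supI2)
  qed
  moreover have "(below (cone_degree m g) (cone_set B) a \<noteq> {}) = (\<exists>u\<in>insert m U. mdvd u a)" for a
    using r unfolding b by (auto simp: monomial_resolution_def cone_set_def)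
  ultimately show ?thesis using augmented_complex_cone[OF c] unfolding monomial_resolution_def by blast
qed

text \<open>Since \<open>g c = g b\<close>, a strand contains both \<open>b\<close> and \<open>c\<close> or neither. In the first case the
  pivot is cancelled in the strand. In the second case the correction term vanishes on the strand, because
  \<open>D c y \<noteq> 0\<close> would force \<open>g c\<close> to divide \<open>a\<close>.\<close>

lemma monomial_resolution_cancel:
  assumes r: "monomial_resolution U B h g D \<epsilon>"
    and bc: "c \<in> B" "b \<in> B" "D c b \<noteq> 0" "g c = g b"
  shows "monomial_resolution U (B - {b, c}) h g (cancel_diff D c b) \<epsilon>"
proof -
  let ?B = "B - {b, c}"
  have c: "augmented_complex B h D \<epsilon>" using r by (simp add: monomial_resolution_def)
  have m: "mdvd (g x) (g y)" if "x \<in> B" "y \<in> B" "D x y \<noteq> 0" for x y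
    using r that by (auto simp: monomial_resolution_def)
  have con: "contractible (below g ?B a) h (cancel_diff D c b) \<epsilon>" if ne: "below g B a \<noteq> {}" for a
  proof -
    have con: "contractible (below g B a) h D \<epsilon>" using r ne by (simp add: monomial_resolution_def)
    show ?thesis
    proof (cases "mdvd (g b) a")
      case True
      have "below g ?B a = below g B a - {b, c}" by (auto simp: below_def)
      moreover have "contractible (below g B a - {b, c}) h (cancel_diff D c b) \<epsilon>"
        by (rule contractible_cancel(2)[OF augmented_complex_below]) (use True bc c m con in \<open>auto simp: below_def\<close>)
      ultimately show ?thesis by simp
    next
      case False
      then have "below g ?B a = below g B a" using bc by (auto simp: below_def)
      moreover have "D c y = 0" if "y \<in> below g B a" for y
        using m[of c y] that bc False mdvd_trans by (fastforce simp: below_def)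
      ultimately show ?thesis using con by (subst contractible_cong) (auto simp: cancel_diff_def)
    qed
  qed
  have ne: "below g ?B a \<noteq> {} \<longleftrightarrow> below g B a \<noteq> {}" for a
    using contractible_nonempty[OF con[of a]] by (auto simp: below_def)
  have "mdvd (g x) (g y)" if xy: "x \<in> ?B" "y \<in> ?B" "cancel_diff D c b x y \<noteq> 0" for x y
  proof -
    consider "D x y \<noteq> 0" | "D x b \<noteq> 0" "D c y \<noteq> 0" using xy(3) by (cases "D x y = 0") (auto simp: cancel_diff_def)
    then show ?thesis using xy m[of x y] m[of x b] m[of c y] bc mdvd_trans by cases auto
  qed
  then show ?thesis using r con contractible_cancel(1)[OF c bc(1-3)] unfolding monomial_resolution_def ne by simp
qed

lemma monomial_resolution_minimize:
  assumes "monomial_resolution U B h g (D :: 'b \<Rightarrow> 'b \<Rightarrow> 'k::field) \<epsilon>"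
  shows "\<exists>B' D'. minimal_resolution U B' h g (D' :: 'b \<Rightarrow> 'b \<Rightarrow> 'k) \<epsilon>"
  using assms
proof (induction "card B" arbitrary: B D rule: less_induct)
  case less
  show ?case
  proof (cases "\<forall>x\<in>B. \<forall>y\<in>B. g x = g y \<longrightarrow> D x y = 0")
    case True
    then show ?thesis using less.prems by (auto simp: minimal_resolution_def)
  next
    case False
    then obtain b c where bc: "c \<in> B" "b \<in> B" "D c b \<noteq> 0" "g c = g b" by auto
    have "finite B" using less.prems by (simp add: monomial_resolution_def augmented_complex_def)
    then have "card (B - {b, c}) < card B" using bc by (intro psubset_card_mono) auto
    then show ?thesis using less.hyps monomial_resolution_cancel[OF less.prems bc] by blast
  qed
qed

text \<open>Free complexes have bases of natural numbers, while tensor products are indexed by pairs.\<close>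

lemma minimal_resolution_reindex:
  assumes r: "minimal_resolution U (B :: 'b set) h g (D :: _ \<Rightarrow> _ \<Rightarrow> 'k::field) \<epsilon>"
  shows "\<exists>f::'b \<Rightarrow> nat. \<exists>h' g' (D' :: nat \<Rightarrow> nat \<Rightarrow> 'k) \<epsilon>'. inj_on f B \<and> minimal_resolution U (f ` B) h' g' D' \<epsilon>'
     \<and> (\<forall>b\<in>B. h' (f b) = h b \<and> g' (f b) = g b)"
proof -
  have fin: "finite B" using r by (simp add: minimal_resolution_def monomial_resolution_def augmented_complex_def)
  then obtain f :: "'b \<Rightarrow> nat" where f: "inj_on f B" using finite_imp_inj_to_nat_seg by meson
  let ?i = "the_inv_into B f"
  have i [simp]: "?i (f x) = x" if "x \<in> B" for x using that f by (simp add: the_inv_into_f_f)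
  have b: "below (\<lambda>x. g (?i (f x))) B a = below g B a" for a by (auto simp: below_def)
  have bi: "x \<in> below g B a \<Longrightarrow> ?i (f x) = x" for x a by (simp add: below_def)
  have 1: "augmented_complex B (\<lambda>x. h (?i (f x))) (\<lambda>x y. D (?i (f x)) (?i (f y))) (\<lambda>x. \<epsilon> (?i (f x)))"
    using r by (simp add: minimal_resolution_def monomial_resolution_def augmented_complex_def mat_mult_def cong: sum.cong)
  have 2: "contractible (below g B a) (\<lambda>x. h (?i (f x))) (\<lambda>x y. D (?i (f x)) (?i (f y))) (\<lambda>x. \<epsilon> (?i (f x)))
     = contractible (below g B a) h D \<epsilon>" for a by (rule contractible_cong) (simp_all add: bi)
  have "minimal_resolution U (f ` B) (\<lambda>n. h (?i n)) (\<lambda>n. g (?i n)) (\<lambda>n m. D (?i n) (?i m)) (\<lambda>n. \<epsilon> (?i n))"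
    using r 1 by (intro minimal_resolution_image f) (simp add: minimal_resolution_def monomial_resolution_def b 2)
  moreover have "\<forall>b\<in>B. h (?i (f b)) = h b \<and> g (?i (f b)) = g b" by simp
  ultimately show ?thesis using f by (intro exI conjI)
qed

lemma minimal_resolution_exists:
  assumes "finite U"
  shows "\<exists>B h g D \<epsilon>. minimal_resolution U (B :: nat set) h g (D :: nat \<Rightarrow> nat \<Rightarrow> 'k::field) \<epsilon>"
  using assms
proof (induction U)
  case empty
  then show ?case using monomial_resolution_empty by (fastforce simp: minimal_resolution_def)
next
  case (insert m U)
  then obtain B h g and D :: "nat \<Rightarrow> nat \<Rightarrow> 'k" and \<epsilon> where "minimal_resolution U (B :: nat set) h g D \<epsilon>" by blast
  then have "monomial_resolution U B h g D \<epsilon>" by (simp add: minimal_resolution_def)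
  from monomial_resolution_cone[OF this, of m] show ?case
    using monomial_resolution_minimize minimal_resolution_reindex by metis
qed

text \<open>As the degrees of the two factors have disjoint variables, their product divides \<open>a\<close> exactly if both
  divide \<open>a\<close>. Hence the strand of the tensor product in multidegree \<open>a\<close> is the tensor product of the strands.\<close>

lemma minimal_resolution_tensor:
  assumes r: "minimal_resolution U A h g D \<epsilon>" and r': "minimal_resolution W B h' g' D' \<epsilon>'"
    and disj: "\<And>u w. u \<in> U \<Longrightarrow> w \<in> W \<Longrightarrow> keys u \<inter> keys w = {}"
  shows "minimal_resolution {u + w | u w. u \<in> U \<and> w \<in> W} (A \<times> B) (\<lambda>x. h (fst x) + h' (snd x))
    (\<lambda>x. g (fst x) + g' (snd x)) (tensor_diff h D D') (\<lambda>x. \<epsilon> (fst x) * \<epsilon>' (snd x))"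
proof -
  have k: "keys (g x) \<subseteq> (\<Union>u\<in>U. keys u)" if "x \<in> A" for x
    using r that by (auto simp: minimal_resolution_def monomial_resolution_def)
  have k': "keys (g' x) \<subseteq> (\<Union>u\<in>W. keys u)" if "x \<in> B" for x
    using r' that by (auto simp: minimal_resolution_def monomial_resolution_def)
  have c: "augmented_complex A h D \<epsilon>" "augmented_complex B h' D' \<epsilon>'"
    using r r' by (auto simp: minimal_resolution_def monomial_resolution_def)
  have m: "mdvd (g x) (g y)" if "x \<in> A" "y \<in> A" "D x y \<noteq> 0" for x y
    using r that by (auto simp: minimal_resolution_def monomial_resolution_def)
  have m': "mdvd (g' x) (g' y)" if "x \<in> B" "y \<in> B" "D' x y \<noteq> 0" for x y
    using r' that by (auto simp: minimal_resolution_def monomial_resolution_def)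
  have "keys (g x) \<inter> keys (g' y) = {}" if "x \<in> A" "y \<in> B" for x y
    using k[OF that(1)] k'[OF that(2)] disj by blast
  then have b: "below (\<lambda>x. g (fst x) + g' (snd x)) (A \<times> B) a = below g A a \<times> below g' B a" for a
    by (auto simp: below_def mdvd_add_coprime_iff)
  have 1: "contractible (below g A a \<times> below g' B a) (\<lambda>x. h (fst x) + h' (snd x)) (tensor_diff h D D') (\<lambda>x. \<epsilon> (fst x) * \<epsilon>' (snd x))"
    if "below g A a \<times> below g' B a \<noteq> {}" for a
    using that r r' by (intro contractible_tensor augmented_complex_below c m m')
      (auto simp: minimal_resolution_def monomial_resolution_def)
  have key: "mdvd (g (fst x) + g' (snd x)) (g (fst y) + g' (snd y)) \<and> g (fst x) + g' (snd x) \<noteq> g (fst y) + g' (snd y)"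
    if xy: "x \<in> A \<times> B" "y \<in> A \<times> B" "tensor_diff h D D' x y \<noteq> 0" for x y
  proof -
    consider "D (fst x) (fst y) \<noteq> 0" "snd x = snd y" | "D' (snd x) (snd y) \<noteq> 0" "fst x = fst y"
      using xy(3) by (cases "D (fst x) (fst y) = 0") (auto simp: tensor_diff_def id_mat_def split: if_splits)
    then show ?thesis
    proof cases
      case 1
      then have "mdvd (g (fst x)) (g (fst y))" "g (fst x) \<noteq> g (fst y)"
        using xy m r by (auto simp: minimal_resolution_def)
      then show ?thesis using 1 by (auto simp: mdvd_def lookup_add)
    next
      case 2
      then have "mdvd (g' (snd x)) (g' (snd y))" "g' (snd x) \<noteq> g' (snd y)"
        using xy m' r' by (auto simp: minimal_resolution_def)
      then show ?thesis using 2 by (auto simp: mdvd_def lookup_add)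
    qed
  qed
  have 2: "(below g A a \<times> below g' B a \<noteq> {}) = (\<exists>u\<in>{u + w | u w. u \<in> U \<and> w \<in> W}. mdvd u a)" for a
  proof -
    have "(below g A a \<times> below g' B a \<noteq> {}) = ((\<exists>u\<in>U. mdvd u a) \<and> (\<exists>w\<in>W. mdvd w a))"
      using r r' unfolding minimal_resolution_def monomial_resolution_def by auto
    also have "\<dots> = (\<exists>u\<in>U. \<exists>w\<in>W. mdvd (u + w) a)" using disj by (auto simp: mdvd_add_coprime_iff)
    finally show ?thesis by blast
  qed
  have 3: "keys (g (fst x) + g' (snd x)) \<subseteq> (\<Union>u\<in>{u + w | u w. u \<in> U \<and> w \<in> W}. keys u)"
    if "x \<in> A \<times> B" for x
  proof -
    have "below g A (g (fst x)) \<noteq> {}" "below g' B (g' (snd x)) \<noteq> {}" using that by (auto simp: below_def)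
    then have ne: "U \<noteq> {}" "W \<noteq> {}" using r r' unfolding minimal_resolution_def monomial_resolution_def by auto
    have x: "fst x \<in> A" "snd x \<in> B" using that by auto
    have "(\<Union>u\<in>{u + w | u w. u \<in> U \<and> w \<in> W}. keys u) = (\<Union>u\<in>U. keys u) \<union> (\<Union>u\<in>W. keys u)"
      using ne by (auto simp: keys_add_nat; metis UnI1 UnI2 keys_add_nat)
    then show ?thesis using k[OF x(1)] k'[OF x(2)] by (auto simp: keys_add_nat)
  qed
  show ?thesis
    unfolding minimal_resolution_def monomial_resolution_def b
    using augmented_complex_tensor[OF c] 1 2 3 key by blast
qed

section \<open>Polynomials\<close>

lemma carrier_poly_ring: "p \<in> carrier (poly_ring V) \<longleftrightarrow> (\<forall>m\<in>keys p. keys m \<subseteq> V)"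
  by (simp add: poly_ring_def)

lemma poly_ring_simps [simp]:
  "mult (poly_ring V) = (*)" "one (poly_ring V) = 1" "zero (poly_ring V) = 0" "add (poly_ring V) = (+)"
  by (simp_all add: poly_ring_def)

lemma poly_ring_zero [simp]: "0 \<in> carrier (poly_ring V)" by (simp add: carrier_poly_ring)
lemma poly_ring_one [simp]: "1 \<in> carrier (poly_ring V)" by (simp add: carrier_poly_ring)

lemma poly_ring_add:
  fixes p :: "('x, 'k::field) mpoly"
  shows "p \<in> carrier (poly_ring V) \<Longrightarrow> q \<in> carrier (poly_ring V) \<Longrightarrow> p + q \<in> carrier (poly_ring V)"
  using keys_add[of p q] unfolding carrier_poly_ring by blast

lemma keys_uminus: "keys (- p) = keys (p :: ('x, 'k::field) mpoly)"
  by (auto simp: in_keys_iff)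

lemma poly_ring_uminus: 
  fixes p :: "('x, 'k::field) mpoly"
  shows "p \<in> carrier (poly_ring V) \<Longrightarrow> - p \<in> carrier (poly_ring V)"
  unfolding carrier_poly_ring keys_uminus .

lemma poly_ring_diff:
  fixes p :: "('x, 'k::field) mpoly"
  shows "p \<in> carrier (poly_ring V) \<Longrightarrow> q \<in> carrier (poly_ring V) \<Longrightarrow> p - q \<in> carrier (poly_ring V)"
  using poly_ring_add[of p V "- q"] poly_ring_uminus[of q V] by simp

lemma poly_ring_mult:
  fixes p :: "('x, 'k::field) mpoly"
  assumes "p \<in> carrier (poly_ring V)" "q \<in> carrier (poly_ring V)"
  shows "p * q \<in> carrier (poly_ring V)"
  unfolding carrier_poly_ring
proof
  fix m assume "m \<in> keys (p * q)"
  then obtain a b where "m = a + b" "a \<in> keys p" "b \<in> keys q"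
    using keys_mult[of p q] by blast
  then show "keys m \<subseteq> V" using assms by (auto simp: carrier_poly_ring keys_add_nat)
qed

lemma poly_ring_sum:
  fixes f :: "'b \<Rightarrow> ('x, 'k::field) mpoly"
  shows "(\<And>b. b \<in> A \<Longrightarrow> f b \<in> carrier (poly_ring V)) \<Longrightarrow> (\<Sum>b\<in>A. f b) \<in> carrier (poly_ring V)"
  by (induction A rule: infinite_finite_induct) (auto intro: poly_ring_add)

lemma poly_ring_single: "keys m \<subseteq> V \<Longrightarrow> single m k \<in> carrier (poly_ring V)"
  by (simp add: carrier_poly_ring)

lemma cring_poly_ring: "cring (poly_ring V :: ('x, 'k::field) mpoly ring)"
proof (rule cringI)
  show "abelian_group (poly_ring V :: ('x, 'k) mpoly ring)"
  proof (rule abelian_groupI)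
    fix p :: "('x, 'k) mpoly" assume "p \<in> carrier (poly_ring V)"
    then show "\<exists>q\<in>carrier (poly_ring V). q \<oplus>\<^bsub>poly_ring V\<^esub> p = \<zero>\<^bsub>poly_ring V\<^esub>"
      by (intro bexI[of _ "- p"]) (auto simp: poly_ring_uminus)
  qed (auto simp: poly_ring_add algebra_simps)
  show "Group.comm_monoid (poly_ring V :: ('x, 'k) mpoly ring)"
    by (rule comm_monoidI) (auto simp: poly_ring_mult algebra_simps)
qed (auto simp: algebra_simps)

lemma lookup_single_mult:
  fixes p :: "('x, 'k::field) mpoly"
  shows "lookup (single m k * p) n =
     (if mdvd m n then k * lookup p (n - m) else 0)"
proof -
  have eq: "n = m + q \<longleftrightarrow> mdvd m n \<and> q = n - m" for q
    using mdvd_minus_add[of m n] by (auto simp: add.commute)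
  have "lookup (single m k * p) n =
     (\<Sum>l. (k * (\<Sum>q. lookup p q when n = l + q)) when m = l)"
    by (simp add: lookup_mult lookup_single when_mult)
  also have "\<dots> = k * (\<Sum>q. lookup p q when n = m + q)" by simp
  also have "\<dots> = (if mdvd m n then k * lookup p (n - m) else 0)"
    unfolding eq by simp
  finally show ?thesis .
qed

lemma mono_deg_eq_sum:
  "finite A \<Longrightarrow> keys m \<subseteq> A \<Longrightarrow> mono_deg m = (\<Sum>x\<in>A. lookup m x)"
  unfolding mono_deg_def by (rule sum.mono_neutral_left) (auto simp: in_keys_iff)

lemma mono_deg_add: "mono_deg (m + n) = mono_deg m + mono_deg n"
  using mono_deg_eq_sum[of "keys m \<union> keys n"]
  by (simp add: keys_add_nat lookup_add sum.distrib)

lemma mono_deg_minus: "mdvd m n \<Longrightarrow> int (mono_deg (n - m)) = int (mono_deg n) - int (mono_deg m)"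
  using mono_deg_add[of "n - m" m] mdvd_minus_add[of m n] by simp

lemma mono_deg_zero [simp]: "mono_deg 0 = 0"
  by (simp add: mono_deg_def)

lemma homog_zero [simp]: "0 \<in> homog d" by (simp add: homog_def)

lemma homog_add: "p \<in> homog d \<Longrightarrow> q \<in> homog d \<Longrightarrow> (p :: ('x, 'k::field) mpoly) + q \<in> homog d"
  using keys_add[of p q] unfolding homog_def by blast

lemma homog_diff: "p \<in> homog d \<Longrightarrow> q \<in> homog d \<Longrightarrow> (p :: ('x, 'k::field) mpoly) - q \<in> homog d"
  using homog_add[of p d "- q"] by (simp add: homog_def keys_uminus)

lemma homog_sum: "(\<And>b. b \<in> A \<Longrightarrow> f b \<in> homog d) \<Longrightarrow> (\<Sum>b\<in>A. f b :: ('x, 'k::field) mpoly) \<in> homog d"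
  by (induction A rule: infinite_finite_induct) (auto intro: homog_add)

lemma homog_mult:
  fixes p :: "('x, 'k::field) mpoly"
  assumes "p \<in> homog d" "q \<in> homog e" shows "p * q \<in> homog (d + e)"
  unfolding homog_def mem_Collect_eq
proof
  fix m assume "m \<in> keys (p * q)"
  then obtain a b where "m = a + b" "a \<in> keys p" "b \<in> keys q"
    using keys_mult[of p q] by blast
  then show "int (mono_deg m) = d + e" using assms by (auto simp: homog_def mono_deg_add)
qed

lemma homog_single: "(k \<noteq> 0 \<Longrightarrow> int (mono_deg m) = d) \<Longrightarrow> single m k \<in> homog d"
  by (simp add: homog_def)

text \<open>The homogeneous component of degree \<open>d\<close>.\<close>

definition hpart :: "int \<Rightarrow> ('x, 'k::field) mpoly \<Rightarrow> ('x, 'k) mpoly" where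
  "hpart d p = Abs_poly_mapping (\<lambda>m. if int (mono_deg m) = d then lookup p m else 0)"

lemma lookup_hpart: "lookup (hpart d p) m = (if int (mono_deg m) = d then lookup p m else 0)"
proof -
  have "finite {m. (if int (mono_deg m) = d then lookup p m else 0) \<noteq> 0}"
    by (rule finite_subset[OF _ finite_keys[of p]]) (auto simp: in_keys_iff split: if_splits)
  then show ?thesis by (simp add: hpart_def)
qed

lemma keys_hpart: "keys (hpart d p) = {m \<in> keys p. int (mono_deg m) = d}"
  by (auto simp: in_keys_iff lookup_hpart split: if_splits)

lemma hpart_homog [simp]: "hpart d p \<in> homog d" by (simp add: homog_def keys_hpart)

lemma hpart_id: "p \<in> homog d \<Longrightarrow> hpart d p = p"
  by (rule poly_mapping_eqI) (auto simp: lookup_hpart homog_def in_keys_iff)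

lemma hpart_add: "hpart d (p + q) = hpart d p + hpart d q"
  by (rule poly_mapping_eqI) (simp add: lookup_hpart lookup_add)

lemma hpart_zero [simp]: "hpart d 0 = 0" by (rule poly_mapping_eqI) (simp add: lookup_hpart)

lemma hpart_sum: "hpart d (\<Sum>b\<in>A. f b) = (\<Sum>b\<in>A. hpart d (f b))"
  by (induction A rule: infinite_finite_induct) (simp_all add: hpart_add)

lemma hpart_mult:
  fixes p :: "('x, 'k::field) mpoly"
  assumes p: "p \<in> homog d" shows "hpart (d + e) (p * q) = p * hpart e q"
proof -
  let ?r = "q - hpart e q"
  have "hpart (d + e) (p * ?r) = 0"
  proof (rule poly_mapping_eqI)
    fix m
    have False if m: "int (mono_deg m) = d + e" "m \<in> keys (p * ?r)"
    proof -
      obtain a b where "m = a + b" "a \<in> keys p" "b \<in> keys ?r"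
        using m keys_mult[of p ?r] by blast
      then show False using m p by (auto simp: homog_def mono_deg_add in_keys_iff lookup_minus lookup_hpart split: if_splits)
    qed
    then show "lookup (hpart (d + e) (p * ?r)) m = lookup 0 m"
      by (auto simp: lookup_hpart in_keys_iff)
  qed
  moreover have "p * q = p * hpart e q + p * ?r" by (simp add: algebra_simps)
  moreover have "hpart (d + e) (p * hpart e q) = p * hpart e q" using homog_mult[OF p, of "hpart e q" e] by (simp add: hpart_id)
  ultimately show ?thesis by (simp add: hpart_add)
qed

lemma const_coeff_zero [simp]: "const_coeff 0 = 0" by (simp add: const_coeff_def)
lemma const_coeff_one [simp]: "const_coeff 1 = 1" by (simp add: const_coeff_def)
lemma const_coeff_diff: "const_coeff (p - q) = const_coeff p - const_coeff q" by (simp add: const_coeff_def lookup_minus)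
lemma const_coeff_sum: "const_coeff (\<Sum>b\<in>A. f b) = (\<Sum>b\<in>A. const_coeff (f b))" by (simp add: const_coeff_def lookup_sum)

lemma const_coeff_eq_0: "p \<in> homog d \<Longrightarrow> d \<noteq> 0 \<Longrightarrow> const_coeff p = 0"
  by (rule ccontr) (auto simp: homog_def const_coeff_def in_keys_iff dest!: bspec[of _ _ 0])

text \<open>Subtracting its constant term from \<open>p\<close> leaves a polynomial whose multiples have no constant term.\<close>

lemma const_coeff_mult: "const_coeff (p * q) = const_coeff p * const_coeff (q :: ('x, 'k::field) mpoly)"
proof -
  let ?r = "p - single 0 (const_coeff p)"
  have "lookup (?r * q) 0 = 0"
  proof (rule ccontr)
    assume "\<not> ?thesis"
    then have "0 \<in> keys (?r * q)" by (simp add: in_keys_iff)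
    then obtain a b where ab: "0 = a + b" "a \<in> keys ?r"
      using keys_mult[of ?r q] by blast
    have "a = 0"
      by (rule poly_mapping_eqI) (metis ab(1) add_is_0 lookup_add lookup_zero)
    then show False using ab(2) by (simp add: in_keys_iff lookup_minus const_coeff_def)
  qed
  moreover have "p * q = ?r * q + single 0 (const_coeff p) * q" by (simp add: algebra_simps)
  moreover have "q - 0 = q" by simp
  ultimately show ?thesis by (simp add: const_coeff_def lookup_add lookup_single_mult)
qed

section \<open>Monomial ideals\<close>

definition monomial_ideal :: "'x set \<Rightarrow> ('x \<Rightarrow>\<^sub>0 nat) set \<Rightarrow> ('x, 'k::field) mpoly set" where
  "monomial_ideal V U = {p \<in> carrier (poly_ring V). \<forall>m\<in>keys p. \<exists>u\<in>U. mdvd u m}"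

lemma monomial_ideal_zero [simp]: "0 \<in> monomial_ideal V U" by (simp add: monomial_ideal_def)

lemma single_in_monomial_ideal: "u \<in> U \<Longrightarrow> keys u \<subseteq> V \<Longrightarrow> single u k \<in> monomial_ideal V U"
  by (auto simp: monomial_ideal_def poly_ring_single intro: bexI[of _ u])

lemma monomial_ideal_add:
  fixes p :: "('x, 'k::field) mpoly"
  shows "p \<in> monomial_ideal V U \<Longrightarrow> q \<in> monomial_ideal V U \<Longrightarrow> p + q \<in> monomial_ideal V U"
  using keys_add[of p q] poly_ring_add[of p V q] unfolding monomial_ideal_def by blast

lemma monomial_ideal_mult:
  fixes p :: "('x, 'k::field) mpoly"
  assumes "p \<in> monomial_ideal V U" "q \<in> carrier (poly_ring V)"
  shows "q * p \<in> monomial_ideal V U"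
proof -
  have "\<exists>u\<in>U. mdvd u m" if m: "m \<in> keys (q * p)" for m
  proof -
    obtain a b where "m = a + b" "a \<in> keys q" "b \<in> keys p"
      using m keys_mult[of q p] by blast
    moreover from this obtain u where "u \<in> U" "mdvd u b" using assms by (auto simp: monomial_ideal_def)
    ultimately show ?thesis using mdvd_trans[of u b m] by auto
  qed
  then show ?thesis using assms poly_ring_mult by (auto simp: monomial_ideal_def)
qed

lemma monomial_ideal_ideal: "ideal (monomial_ideal V U :: ('x, 'k::field) mpoly set) (poly_ring V)"
proof -
  interpret R: cring "poly_ring V :: ('x, 'k) mpoly ring" by (rule cring_poly_ring)
  have neg: "- p \<in> monomial_ideal V U" if "p \<in> monomial_ideal V U" for p :: "('x, 'k) mpoly"
    using that by (simp add: monomial_ideal_def keys_uminus poly_ring_uminus)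
  have inv: "\<ominus>\<^bsub>poly_ring V\<^esub> p = - p" if "p \<in> carrier (poly_ring V)" for p :: "('x, 'k) mpoly"
    using R.minus_equality[of "- p" p] that poly_ring_uminus[of p V] by simp
  have sub: "monomial_ideal V U \<subseteq> (carrier (poly_ring V) :: ('x, 'k) mpoly set)" by (auto simp: monomial_ideal_def)
  have sg: "subgroup (monomial_ideal V U :: ('x, 'k) mpoly set) (add_monoid (poly_ring V))"
  proof (rule subgroup.intro)
    show "inv\<^bsub>add_monoid (poly_ring V)\<^esub> p \<in> monomial_ideal V U" if "p \<in> monomial_ideal V U" for p :: "('x, 'k) mpoly"
      using inv[of p] neg[of p] that sub unfolding a_inv_def by auto
  qed (use sub in \<open>auto simp: monomial_ideal_add\<close>)
  show ?thesis
  proof (rule idealI[OF R.ring_axioms sg])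
    fix p q :: "('x, 'k) mpoly"
    assume pq: "p \<in> monomial_ideal V U" "q \<in> carrier (poly_ring V)"
    show "q \<otimes>\<^bsub>poly_ring V\<^esub> p \<in> monomial_ideal V U" using monomial_ideal_mult[OF pq] by simp
    show "p \<otimes>\<^bsub>poly_ring V\<^esub> q \<in> monomial_ideal V U" using monomial_ideal_mult[OF pq] by (simp add: mult.commute)
  qed
qed

text \<open>The set \<open>T\<close> is left open between the monomials and the ideal that they generate, so that this also
  covers the extension of an ideal to a larger polynomial ring.\<close>

lemma genideal_monomials:
  fixes T :: "('x, 'k::field) mpoly set"
  assumes T: "(\<lambda>u. single u 1) ` U \<subseteq> T" "T \<subseteq> monomial_ideal V U"
    and U: "\<And>u. u \<in> U \<Longrightarrow> keys u \<subseteq> V"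
  shows "Idl\<^bsub>poly_ring V\<^esub> T = monomial_ideal V U"
proof
  interpret R: cring "poly_ring V :: ('x, 'k) mpoly ring" by (rule cring_poly_ring)
  show "Idl\<^bsub>poly_ring V\<^esub> T \<subseteq> monomial_ideal V U"
    using R.genideal_minimal[OF monomial_ideal_ideal T(2)] .
  have "T \<subseteq> carrier (poly_ring V)" using T by (auto simp: monomial_ideal_def)
  then have id: "ideal (Idl\<^bsub>poly_ring V\<^esub> T) (poly_ring V)" and self: "T \<subseteq> Idl\<^bsub>poly_ring V\<^esub> T"
    by (rule R.genideal_ideal, rule R.genideal_self)
  interpret I: ideal "Idl\<^bsub>poly_ring V\<^esub> T" "poly_ring V" by (rule id)
  show "monomial_ideal V U \<subseteq> Idl\<^bsub>poly_ring V\<^esub> T"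
  proof
    fix p :: "('x, 'k) mpoly" assume p: "p \<in> monomial_ideal V U"
    have monom: "single m (lookup p m) \<in> Idl\<^bsub>poly_ring V\<^esub> T" if m: "m \<in> keys p" for m
    proof -
      obtain u where u: "u \<in> U" "mdvd u m" using p m by (auto simp: monomial_ideal_def)
      have "keys (m - u) \<subseteq> V" using p m keys_minus_nat[of m u] by (auto simp: monomial_ideal_def carrier_poly_ring)
      then have c: "single (m - u) (lookup p m) \<in> carrier (poly_ring V)" by (rule poly_ring_single)
      have "single u 1 \<in> Idl\<^bsub>poly_ring V\<^esub> T" using self T u by blast
      from I.I_l_closed[OF this c] show ?thesis using mdvd_minus_add[OF u(2)] by (simp add: mult_single)
    qed
    have sums: "(\<Sum>m\<in>A. single m (lookup p m)) \<in> Idl\<^bsub>poly_ring V\<^esub> T"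
      if "finite A" "A \<subseteq> keys p" for A
      using that
    proof (induction A rule: finite_induct)
      case empty
      show ?case using I.zero_closed by simp
    next
      case (insert m A)
      then show ?case using I.a_closed[of "single m (lookup p m)"] by (simp add: monom)
    qed
    from sums[of "keys p"]
    show "p \<in> Idl\<^bsub>poly_ring V\<^esub> T"
    proof (rule back_subst[where P = "\<lambda>q. q \<in> _"])
      show "(\<Sum>m\<in>keys p. single m (lookup p m)) = p"
        by (rule poly_mapping_eqI) (simp add: lookup_sum lookup_single when_def in_keys_iff)
    qed simp_all
  qed
qed

section \<open>Linear maps given by columns\<close>

text \<open>The linear map that sends the basis vector \<open>b \<in> B\<close> to the column \<open>\<phi> b\<close>. It is used over the
  polynomial ring and, after passing to constant terms, over the field.\<close>

definition lin :: "'i set \<Rightarrow> ('i \<Rightarrow> 'c \<Rightarrow> 'a::comm_ring_1) \<Rightarrow> ('i \<Rightarrow> 'a) \<Rightarrow> 'c \<Rightarrow> 'a" where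
  "lin B \<phi> v = (\<lambda>c. \<Sum>b\<in>B. \<phi> b c * v b)"

definition unit_vec :: "'i \<Rightarrow> 'i \<Rightarrow> 'a::comm_ring_1" where
  "unit_vec b c = (if b = c then 1 else 0)"

lemma lin_cong: "(\<And>b. b \<in> B \<Longrightarrow> \<phi> b = \<psi> b) \<Longrightarrow> lin B \<phi> v = lin B \<psi> v"
  by (simp add: lin_def cong: sum.cong)

lemma lin_zero [simp]: "lin B \<phi> 0 = 0" "lin B 0 v = 0"
  by (simp_all add: lin_def fun_eq_iff)

lemma lin_add_right: "lin B \<phi> (v + w) = lin B \<phi> v + lin B \<phi> w"
  by (simp add: lin_def fun_eq_iff algebra_simps sum.distrib)

lemma lin_diff_right: "lin B \<phi> (v - w) = lin B \<phi> v - lin B \<phi> w"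
  by (simp add: lin_def fun_eq_iff algebra_simps sum_subtractf)

lemma lin_diff_left: "lin B (\<lambda>b. \<phi> b - \<psi> b) v = lin B \<phi> v - lin B \<psi> v"
  by (simp add: lin_def fun_eq_iff algebra_simps sum_subtractf)

lemma lin_lin: "lin B \<phi> (lin A \<psi> v) = lin A (\<lambda>a. lin B \<phi> (\<psi> a)) v"
proof
  fix c
  have "lin B \<phi> (lin A \<psi> v) c = (\<Sum>b\<in>B. \<Sum>a\<in>A. \<phi> b c * (\<psi> a b * v a))" by (simp add: lin_def sum_distrib_left)
  also have "\<dots> = (\<Sum>a\<in>A. \<Sum>b\<in>B. \<phi> b c * (\<psi> a b * v a))" by (rule sum.swap)
  also have "\<dots> = lin A (\<lambda>a. lin B \<phi> (\<psi> a)) v c" by (simp add: lin_def sum_distrib_right mult.assoc)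
  finally show "lin B \<phi> (lin A \<psi> v) c = lin A (\<lambda>a. lin B \<phi> (\<psi> a)) v c" .
qed

lemma lin_unit_right: "finite B \<Longrightarrow> b \<in> B \<Longrightarrow> lin B \<phi> (unit_vec b) = \<phi> b"
  by (simp add: lin_def unit_vec_def fun_eq_iff if_distrib[of "\<lambda>c. _ * c"] cong: if_cong)

lemma lin_unit_left: "finite B \<Longrightarrow> (\<And>b. b \<notin> B \<Longrightarrow> v b = 0) \<Longrightarrow> lin B unit_vec v = v"
  by (auto simp: lin_def unit_vec_def fun_eq_iff if_distrib[of "\<lambda>c. c * _"] cong: if_cong)

section \<open>Comparison of resolutions\<close>

definition boundary_col :: "('a::comm_ring_1, 'm) free_complex \<Rightarrow> nat \<Rightarrow> nat \<Rightarrow> nat \<Rightarrow> 'a" where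
  "boundary_col F i b = (\<lambda>c. if c \<in> fr_basis F i then fr_mat F i c b else 0)"

lemma free_map_lin: "free_map F i = lin (fr_basis F (Suc i)) (boundary_col F i)"
  by (simp add: free_map_def lin_def boundary_col_def fun_eq_iff)

definition const_col :: "('i \<Rightarrow> 'c \<Rightarrow> ('x, 'k::field) mpoly) \<Rightarrow> 'i \<Rightarrow> 'c \<Rightarrow> 'k" where
  "const_col \<phi> b = (\<lambda>c. const_coeff (\<phi> b c))"

lemma fiber_map_lin: "fiber_map F i = lin (fr_basis F (Suc i)) (const_col (boundary_col F i))"
  by (simp add: fiber_map_def lin_def boundary_col_def const_col_def fun_eq_iff)

lemma const_coeff_lin: "(\<lambda>c. const_coeff (lin B \<phi> w c)) = lin B (const_col \<phi>) (\<lambda>b. const_coeff (w b))"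
  by (simp add: lin_def const_col_def const_coeff_sum const_coeff_mult fun_eq_iff)

text \<open>The homogeneous elements of degree \<open>d\<close> of the free module in position \<open>i\<close>, whose basis
  elements carry the degrees given by the complex.\<close>

definition homog_vec ::
  "'x set \<Rightarrow> (('x, 'k::field) mpoly, 'm) free_complex \<Rightarrow> nat \<Rightarrow> int \<Rightarrow> (nat \<Rightarrow> ('x, 'k) mpoly) \<Rightarrow> bool" where
  "homog_vec V F i d w \<longleftrightarrow>
     w \<in> free_part (poly_ring V) F i \<and> (\<forall>c\<in>fr_basis F i. w c \<in> homog (d - fr_deg F i c))"

text \<open>Exactness in all positions except \<open>0\<close>. The ring itself, placed in position \<open>0\<close> in front of a
  resolution of an ideal, gives such a complex, so that the augmentation becomes an ordinary
  differential.\<close>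

definition acyclic_complex :: "'x set \<Rightarrow> (('x, 'k::field) mpoly, 'm) free_complex \<Rightarrow> bool" where
  "acyclic_complex V F \<longleftrightarrow>
     (\<forall>i. finite (fr_basis F i)) \<and>
     (\<forall>i. \<forall>c\<in>fr_basis F i. \<forall>b\<in>fr_basis F (Suc i).
        fr_mat F i c b \<in> carrier (poly_ring V) \<inter> homog (fr_deg F (Suc i) b - fr_deg F i c)) \<and>
     (\<forall>i. free_map F (Suc i) ` free_part (poly_ring V) F (Suc (Suc i)) =
          {v \<in> free_part (poly_ring V) F (Suc i). free_map F i v = (\<lambda>_. 0)})"

lemma homog_vec_homog: "homog_vec V F i d w \<Longrightarrow> w c \<in> homog (d - fr_deg F i c)"
  by (cases "c \<in> fr_basis F i") (auto simp: homog_vec_def free_part_def)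

lemma homog_vec_diff: "homog_vec V F i d v \<Longrightarrow> homog_vec V F i d w \<Longrightarrow> homog_vec V F i d (v - w)"
  by (simp add: homog_vec_def free_part_def poly_ring_diff homog_diff)

lemma homog_vec_zero: "homog_vec V F i d 0" by (simp add: homog_vec_def free_part_def)

lemma homog_vec_unit: "b \<in> fr_basis F i \<Longrightarrow> homog_vec V F i (fr_deg F i b) (unit_vec b)"
  by (auto simp: homog_vec_def free_part_def unit_vec_def homog_def)

lemma homog_vec_lin:
  assumes \<phi>: "\<And>b. b \<in> fr_basis F i \<Longrightarrow> homog_vec V F' i' (fr_deg F i b) (\<phi> b)"
    and w: "homog_vec V F i d w"
  shows "homog_vec V F' i' d (lin (fr_basis F i) \<phi> w)"
proof -
  have "\<phi> b c * w b \<in> homog (d - fr_deg F' i' c)" if "b \<in> fr_basis F i" for b c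
    using homog_mult[OF homog_vec_homog[OF \<phi>[OF that]] homog_vec_homog[OF w], of c b] by (simp add: algebra_simps)
  moreover have "\<phi> b c * w b \<in> carrier (poly_ring V)" if "b \<in> fr_basis F i" for b c
    using \<phi>[OF that] w by (auto simp: homog_vec_def free_part_def intro: poly_ring_mult)
  moreover have "\<phi> b c = 0" if "b \<in> fr_basis F i" "c \<notin> fr_basis F' i'" for b c
    using \<phi>[OF that(1)] that(2) by (simp add: homog_vec_def free_part_def)
  ultimately show ?thesis
    by (auto simp: homog_vec_def free_part_def lin_def intro!: poly_ring_sum homog_sum)
qed

context
  fixes V :: "'x set" and F :: "(('x, 'k::field) mpoly, 'm) free_complex"
  assumes F: "acyclic_complex V F"
begin

lemma acyclic_finite: "finite (fr_basis F i)" using F by (simp add: acyclic_complex_def)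

lemma homog_vec_boundary_col: "b \<in> fr_basis F (Suc i) \<Longrightarrow> homog_vec V F i (fr_deg F (Suc i) b) (boundary_col F i b)"
  using F by (simp add: acyclic_complex_def homog_vec_def free_part_def boundary_col_def)

lemma boundary_col_image: 
  assumes "b \<in> fr_basis F (Suc i)"
  shows "boundary_col F i b \<in> free_map F i ` free_part (poly_ring V) F (Suc i)"
proof
  show "boundary_col F i b = free_map F i (unit_vec b)"
    using assms by (simp add: free_map_lin lin_unit_right acyclic_finite)
  show "unit_vec b \<in> free_part (poly_ring V) F (Suc i)" using homog_vec_unit[OF assms] by (simp add: homog_vec_def)
qed

lemma exact:
  "free_map F i v = 0 \<Longrightarrow> v \<in> free_part (poly_ring V) F (Suc i) \<Longrightarrow>
   v \<in> free_map F (Suc i) ` free_part (poly_ring V) F (Suc (Suc i))"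
  using F by (simp add: acyclic_complex_def zero_fun_def)

lemma free_map_boundary_col: "b \<in> fr_basis F (Suc (Suc i)) \<Longrightarrow> free_map F i (boundary_col F (Suc i) b) = 0"
  using boundary_col_image[of b "Suc i"] F by (simp add: acyclic_complex_def zero_fun_def)

text \<open>The homogeneous components of any preimage of a homogeneous element form a homogeneous preimage.\<close>

lemma lift_homog:
  assumes w: "homog_vec V F i d w" "w \<in> free_map F i ` free_part (poly_ring V) F (Suc i)"
  shows "\<exists>v. homog_vec V F (Suc i) d v \<and> free_map F i v = w"
proof -
  obtain v where v: "v \<in> free_part (poly_ring V) F (Suc i)" "w = free_map F i v" using w by blast
  define v' where "v' b = hpart (d - fr_deg F (Suc i) b) (v b)" for b
  have "free_map F i v' c = w c" for c
  proof (cases "c \<in> fr_basis F i")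
    case True
    have "fr_mat F i c b * v' b = hpart (d - fr_deg F i c) (fr_mat F i c b * v b)" if "b \<in> fr_basis F (Suc i)" for b
      using hpart_mult[of "fr_mat F i c b" "fr_deg F (Suc i) b - fr_deg F i c" "d - fr_deg F (Suc i) b" "v b"] F True that
      by (simp add: acyclic_complex_def v'_def)
    then have "free_map F i v' c = hpart (d - fr_deg F i c) (w c)"
      using True by (simp add: v(2) free_map_def hpart_sum)
    also have "\<dots> = w c" using homog_vec_homog[OF w(1)] by (rule hpart_id)
    finally show ?thesis .
  next
    case False then show ?thesis by (simp add: v(2) free_map_def)
  qed
  moreover have "homog_vec V F (Suc i) d v'"
    using v(1) by (auto simp: homog_vec_def free_part_def v'_def carrier_poly_ring keys_hpart)
  ultimately show ?thesis by blast
qed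

lemma lift_family:
  assumes "\<And>b. b \<in> B \<Longrightarrow> homog_vec V F i (d b) (w b) \<and> w b \<in> free_map F i ` free_part (poly_ring V) F (Suc i)"
  shows "\<exists>v. \<forall>b\<in>B. homog_vec V F (Suc i) (d b) (v b) \<and> free_map F i (v b) = w b"
  using assms lift_homog by (intro bchoice) blast

text \<open>An endomorphism \<open>\<chi>\<close> that is the identity in position \<open>0\<close> is homotopic to the identity. The homotopy is
  chosen degree by degree: the defect \<open>\<chi> - 1 - h d\<close> is a cycle and hence a boundary. In position \<open>0\<close>, where
  nothing is known about exactness, the zero map will do.\<close>

lemma null_homotopy:
  assumes \<chi>: "\<And>i b. b \<in> fr_basis F i \<Longrightarrow> homog_vec V F i (fr_deg F i b) (\<chi> i b)"
    and \<chi>0: "\<And>b. b \<in> fr_basis F 0 \<Longrightarrow> \<chi> 0 b = unit_vec b"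
    and chain: "\<And>i b. b \<in> fr_basis F (Suc i) \<Longrightarrow>
      free_map F i (\<chi> (Suc i) b) = lin (fr_basis F i) (\<chi> i) (boundary_col F i b)"
  shows "\<exists>h. h 0 = 0 \<and> (\<forall>i. \<forall>b\<in>fr_basis F i. homog_vec V F (Suc i) (fr_deg F i b) (h i b)) \<and>
    (\<forall>i. \<forall>b\<in>fr_basis F (Suc i). free_map F (Suc i) (h (Suc i) b) =
       \<chi> (Suc i) b - unit_vec b - lin (fr_basis F i) (h i) (boundary_col F i b))"
proof -
  let ?w = "\<lambda>i h b. \<chi> (Suc i) b - unit_vec b - lin (fr_basis F i) h (boundary_col F i b)"
  \<comment> \<open>\<open>P\<close> holds for a choice of \<open>h\<close> in position \<open>i\<close> for which the next defect \<open>?w\<close> is a cycle, and \<open>Q\<close>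
    says that the next choice bounds it.\<close>
  define P where "P i h \<longleftrightarrow> (i = 0 \<longrightarrow> h = 0) \<and> (\<forall>b\<in>fr_basis F i. homog_vec V F (Suc i) (fr_deg F i b) (h b)) \<and>
    (\<forall>b\<in>fr_basis F (Suc i). free_map F i (?w i h b) = 0)" for i and h :: "nat \<Rightarrow> nat \<Rightarrow> ('x, 'k) mpoly"
  define Q where "Q i h h' \<longleftrightarrow> (\<forall>b\<in>fr_basis F (Suc i). free_map F (Suc i) (h' b) = ?w i h b)"
    for i and h h' :: "nat \<Rightarrow> nat \<Rightarrow> ('x, 'k) mpoly"
  have supp: "lin (fr_basis F i) unit_vec (boundary_col F i b) = boundary_col F i b" for i b
    by (rule lin_unit_left[OF acyclic_finite]) (simp add: boundary_col_def)
  have unit: "free_map F i (unit_vec b) = boundary_col F i b" if "b \<in> fr_basis F (Suc i)" for i b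
    using that by (simp add: free_map_lin lin_unit_right acyclic_finite)
  have "\<exists>h. \<forall>i. P i (h i) \<and> Q i (h i) (h (Suc i))"
  proof (rule dependent_nat_choice)
    have "free_map F 0 (\<chi> (Suc 0) b - unit_vec b) = 0" if b: "b \<in> fr_basis F (Suc 0)" for b
    proof -
      have "lin (fr_basis F 0) (\<chi> 0) (boundary_col F 0 b) = boundary_col F 0 b"
        using \<chi>0 supp by (simp cong: lin_cong)
      then show ?thesis
        using chain[OF b] unit[OF b] by (simp add: free_map_lin lin_diff_right)
    qed
    then show "\<exists>h. P 0 h" by (intro exI[of _ 0]) (simp add: P_def homog_vec_zero)
  next
    fix h i assume P: "P i h"
    have "homog_vec V F (Suc i) (fr_deg F (Suc i) b) (?w i h b) \<and>
        ?w i h b \<in> free_map F (Suc i) ` free_part (poly_ring V) F (Suc (Suc i))"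
      if b: "b \<in> fr_basis F (Suc i)" for b
    proof -
      have *: "homog_vec V F (Suc i) (fr_deg F (Suc i) b) (?w i h b)"
        using P b by (intro homog_vec_diff \<chi> homog_vec_unit homog_vec_lin homog_vec_boundary_col) (auto simp: P_def)
      moreover have "free_map F i (?w i h b) = 0" using P b by (simp add: P_def)
      ultimately show ?thesis using exact by (simp add: homog_vec_def)
    qed
    from lift_family[of "fr_basis F (Suc i)" "Suc i" "fr_deg F (Suc i)", OF this]
    obtain h' where h': "homog_vec V F (Suc (Suc i)) (fr_deg F (Suc i) b) (h' b)"
        "free_map F (Suc i) (h' b) = ?w i h b" if "b \<in> fr_basis F (Suc i)" for b by blast
    have "free_map F (Suc i) (?w (Suc i) h' b) = 0" if b: "b \<in> fr_basis F (Suc (Suc i))" for b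
    proof -
      let ?d = "boundary_col F (Suc i) b"
      have d0: "free_map F i ?d = 0" using b by (rule free_map_boundary_col)
      have "free_map F (Suc i) (lin (fr_basis F (Suc i)) h' ?d) = lin (fr_basis F (Suc i)) (\<lambda>b. free_map F (Suc i) (h' b)) ?d"
        by (simp add: free_map_lin lin_lin)
      also have "\<dots> = lin (fr_basis F (Suc i)) (?w i h) ?d" using h'(2) by (rule lin_cong)
      also have "\<dots> = lin (fr_basis F (Suc i)) (\<chi> (Suc i)) ?d - ?d - lin (fr_basis F i) h (free_map F i ?d)"
        by (simp add: lin_diff_left supp lin_lin free_map_lin)
      also have "\<dots> = lin (fr_basis F (Suc i)) (\<chi> (Suc i)) ?d - ?d" by (simp add: d0)
      finally show ?thesis using chain[OF b] unit[OF b] by (simp add: free_map_lin lin_diff_right)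
    qed
    then show "\<exists>h'. P (Suc i) h' \<and> Q i h h'" using h' by (intro exI[of _ h']) (simp add: P_def Q_def)
  qed
  then obtain h where h: "\<And>i. P i (h i)" "\<And>i. Q i (h i) (h (Suc i))" by blast
  show ?thesis
    by (rule exI[of _ h]) (use h in \<open>simp add: P_def Q_def\<close>)
qed

end

text \<open>The images of the basis elements are chosen degree by degree; the element to be lifted is a cycle,
  hence a boundary. Between positions \<open>1\<close> and \<open>0\<close> the inclusion of the images takes the role of exactness.\<close>

lemma chain_map_exists:
  assumes F: "acyclic_complex V F" and F': "acyclic_complex V F'"
    and base: "fr_basis F 0 = fr_basis F' 0" "\<And>b. b \<in> fr_basis F 0 \<Longrightarrow> fr_deg F 0 b = fr_deg F' 0 b"
    and im: "free_map F 0 ` free_part (poly_ring V) F 1 \<subseteq> free_map F' 0 ` free_part (poly_ring V) F' 1"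
  shows "\<exists>\<phi>. \<phi> 0 = unit_vec \<and> (\<forall>i. \<forall>b\<in>fr_basis F i. homog_vec V F' i (fr_deg F i b) (\<phi> i b)) \<and>
    (\<forall>i. \<forall>b\<in>fr_basis F (Suc i). free_map F' i (\<phi> (Suc i) b) = lin (fr_basis F i) (\<phi> i) (boundary_col F i b))"
proof -
  let ?w = "\<lambda>i \<phi> b. lin (fr_basis F i) \<phi> (boundary_col F i b)"
  \<comment> \<open>\<open>P\<close> ensures that the elements \<open>?w\<close> to be lifted next are boundaries, and \<open>Q\<close> says that the
    next choice lifts them.\<close>
  define P where "P i \<phi> \<longleftrightarrow> (i = 0 \<longrightarrow> \<phi> = unit_vec) \<and> (\<forall>b\<in>fr_basis F i. homog_vec V F' i (fr_deg F i b) (\<phi> b)) \<and>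
    (\<forall>b\<in>fr_basis F (Suc i). ?w i \<phi> b \<in> free_map F' i ` free_part (poly_ring V) F' (Suc i))"
    for i and \<phi> :: "nat \<Rightarrow> nat \<Rightarrow> ('a, 'b) mpoly"
  define Q where "Q i \<phi> \<psi> \<longleftrightarrow> (\<forall>b\<in>fr_basis F (Suc i). free_map F' i (\<psi> b) = ?w i \<phi> b)"
    for i and \<phi> \<psi> :: "nat \<Rightarrow> nat \<Rightarrow> ('a, 'b) mpoly"
  have supp: "lin (fr_basis F i) unit_vec (boundary_col F i b) = boundary_col F i b" for i b
    by (rule lin_unit_left[OF acyclic_finite[OF F]]) (simp add: boundary_col_def)
  have "\<exists>\<phi>. \<forall>i. P i (\<phi> i) \<and> Q i (\<phi> i) (\<phi> (Suc i))"
  proof (rule dependent_nat_choice)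
    have "homog_vec V F' 0 (fr_deg F 0 b) (unit_vec b)" if "b \<in> fr_basis F 0" for b
      using homog_vec_unit[of b F' 0] base that by simp
    then show "\<exists>\<phi>. P 0 \<phi>" using boundary_col_image[OF F, of _ 0] im
      by (intro exI[of _ unit_vec]) (auto simp: P_def supp)
  next
    fix \<phi> i assume P: "P i \<phi>"
    have "homog_vec V F' i (fr_deg F (Suc i) b) (?w i \<phi> b) \<and>
        ?w i \<phi> b \<in> free_map F' i ` free_part (poly_ring V) F' (Suc i)"
      if b: "b \<in> fr_basis F (Suc i)" for b
      using P b homog_vec_lin[OF _ homog_vec_boundary_col[OF F b], where F' = F' and i' = i and \<phi> = \<phi>] by (auto simp: P_def)
    from lift_family[OF F', of "fr_basis F (Suc i)" i "fr_deg F (Suc i)", OF this]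
    obtain \<psi> where \<psi>: "homog_vec V F' (Suc i) (fr_deg F (Suc i) b) (\<psi> b)"
        "free_map F' i (\<psi> b) = ?w i \<phi> b" if "b \<in> fr_basis F (Suc i)" for b by blast
    have "?w (Suc i) \<psi> b \<in> free_map F' (Suc i) ` free_part (poly_ring V) F' (Suc (Suc i))"
      if b: "b \<in> fr_basis F (Suc (Suc i))" for b
    proof (rule exact[OF F'])
      let ?d = "boundary_col F (Suc i) b"
      have "free_map F' i (?w (Suc i) \<psi> b) = lin (fr_basis F (Suc i)) (\<lambda>b. free_map F' i (\<psi> b)) ?d"
        by (simp add: free_map_lin lin_lin)
      also have "\<dots> = lin (fr_basis F (Suc i)) (?w i \<phi>) ?d" using \<psi>(2) by (rule lin_cong)
      also have "\<dots> = lin (fr_basis F i) \<phi> (free_map F i ?d)" by (simp add: lin_lin free_map_lin)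
      also have "\<dots> = 0" using free_map_boundary_col[OF F b] by simp
      finally show "free_map F' i (?w (Suc i) \<psi> b) = 0" .
      show "?w (Suc i) \<psi> b \<in> free_part (poly_ring V) F' (Suc i)"
        using homog_vec_lin[OF \<psi>(1) homog_vec_boundary_col[OF F b]] by (simp add: homog_vec_def)
    qed
    then show "\<exists>\<psi>. P (Suc i) \<psi> \<and> Q i \<phi> \<psi>" using \<psi> by (intro exI[of _ \<psi>]) (simp add: P_def Q_def)
  qed
  then obtain \<phi> where h: "\<And>i. P i (\<phi> i)" "\<And>i. Q i (\<phi> i) (\<phi> (Suc i))" by blast
  show ?thesis by (rule exI[of _ \<phi>]) (use h in \<open>simp add: P_def Q_def\<close>)
qed

lemma fiber_part_lin:
  assumes "\<And>b. b \<in> fr_basis F i \<Longrightarrow> homog_vec V F' i' (fr_deg F i b) (\<phi> b)"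
    and "v \<in> fiber_part F i j"
  shows "lin (fr_basis F i) (const_col \<phi>) v \<in> fiber_part F' i' j"
  unfolding fiber_part_def mem_Collect_eq
proof (intro allI impI)
  fix c assume "lin (fr_basis F i) (const_col \<phi>) v c \<noteq> 0"
  then obtain b where b: "b \<in> fr_basis F i" "const_coeff (\<phi> b c) \<noteq> 0" "v b \<noteq> 0"
    unfolding lin_def const_col_def by (auto elim!: sum.not_neutral_contains_not_neutral)
  then have "fr_deg F i b - fr_deg F' i' c = 0"
    using const_coeff_eq_0 homog_vec_homog[OF assms(1)] by blast
  moreover have "c \<in> fr_basis F' i'" using b assms(1)[OF b(1)] by (auto simp: homog_vec_def free_part_def)
  ultimately show "c \<in> fr_basis F' i' \<and> fr_deg F' i' c = j" using b assms(2) by (auto simp: fiber_part_def)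
qed

lemma fiber_part_diff: "v \<in> fiber_part F i j \<Longrightarrow> w \<in> fiber_part F i j \<Longrightarrow> v - w \<in> fiber_part F i j"
  unfolding fiber_part_def by (simp, metis diff_self)

lemma fiber_part_add: "v \<in> fiber_part F i j \<Longrightarrow> w \<in> fiber_part F i j \<Longrightarrow> v + w \<in> fiber_part F i j"
  unfolding fiber_part_def by (simp, metis add_0)

text \<open>Vanishing of the homology of the fiber in position \<open>i + 1\<close>. The map from position \<open>1\<close> to position \<open>0\<close> is
  replaced by zero. For an augmented resolution this is the vanishing of Tor in homological degree \<open>i\<close>.\<close>

definition fiber_exact :: "(('x, 'k::field) mpoly, 'm) free_complex \<Rightarrow> nat \<Rightarrow> int \<Rightarrow> bool" where
  "fiber_exact F i j \<longleftrightarrow>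
     (\<forall>v\<in>fiber_part F (Suc i) j. (i = 0 \<or> fiber_map F i v = 0) \<longrightarrow>
        v \<in> fiber_map F (Suc i) ` fiber_part F (Suc (Suc i)) j)"

text \<open>Chain maps \<open>\<phi>\<close> and \<open>\<psi>\<close> in both directions exist, and \<open>\<chi> = \<psi> \<phi>\<close> is homotopic to the identity by \<open>h\<close>. For a cycle
  \<open>v\<close> of the fiber, \<open>\<phi> v\<close> is a boundary by assumption, hence so is \<open>\<psi> \<phi> v\<close>, which differs from \<open>v\<close> by the
  boundary of \<open>h v\<close>.\<close>

lemma fiber_exact_transfer:
  fixes F F' :: "(('x, 'k::field) mpoly, 'm) free_complex"
  assumes F: "acyclic_complex V F" and F': "acyclic_complex V F'"
    and base: "fr_basis F 0 = fr_basis F' 0" "\<And>b. b \<in> fr_basis F 0 \<Longrightarrow> fr_deg F 0 b = fr_deg F' 0 b"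
    and im: "free_map F 0 ` free_part (poly_ring V) F 1 = free_map F' 0 ` free_part (poly_ring V) F' 1"
    and ex: "fiber_exact F' i j"
  shows "fiber_exact F i j"
proof -
  obtain \<phi> where \<phi>: "\<phi> 0 = unit_vec" "\<And>i b. b \<in> fr_basis F i \<Longrightarrow> homog_vec V F' i (fr_deg F i b) (\<phi> i b)"
    "\<And>i b. b\<in>fr_basis F (Suc i) \<Longrightarrow> free_map F' i (\<phi> (Suc i) b) = lin (fr_basis F i) (\<phi> i) (boundary_col F i b)"
    using chain_map_exists[OF F F' base] im by auto
  obtain \<psi> where \<psi>: "\<psi> 0 = unit_vec" "\<And>i b. b \<in> fr_basis F' i \<Longrightarrow> homog_vec V F i (fr_deg F' i b) (\<psi> i b)"
    "\<And>i b. b\<in>fr_basis F' (Suc i) \<Longrightarrow> free_map F i (\<psi> (Suc i) b) = lin (fr_basis F' i) (\<psi> i) (boundary_col F' i b)"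
    using chain_map_exists[OF F' F] base im by auto
  define \<chi> where "\<chi> i b = lin (fr_basis F' i) (\<psi> i) (\<phi> i b)" for i b
  have "\<exists>h. h 0 = 0 \<and> (\<forall>i. \<forall>b\<in>fr_basis F i. homog_vec V F (Suc i) (fr_deg F i b) (h i b)) \<and>
    (\<forall>i. \<forall>b\<in>fr_basis F (Suc i). free_map F (Suc i) (h (Suc i) b) =
       \<chi> (Suc i) b - unit_vec b - lin (fr_basis F i) (h i) (boundary_col F i b))"
  proof (rule null_homotopy[OF F])
    show "homog_vec V F i (fr_deg F i b) (\<chi> i b)" if "b \<in> fr_basis F i" for i b
      unfolding \<chi>_def by (rule homog_vec_lin) (use \<psi>(2) \<phi>(2) that in auto)
    show "\<chi> 0 b = unit_vec b" if "b \<in> fr_basis F 0" for b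
      using that base acyclic_finite[OF F', of 0] by (simp add: \<chi>_def \<phi>(1) \<psi>(1) lin_unit_right)
    show "free_map F i (\<chi> (Suc i) b) = lin (fr_basis F i) (\<chi> i) (boundary_col F i b)" if b: "b \<in> fr_basis F (Suc i)" for i b
    proof -
      have "free_map F i (\<chi> (Suc i) b) = lin (fr_basis F' (Suc i)) (\<lambda>b. free_map F i (\<psi> (Suc i) b)) (\<phi> (Suc i) b)"
        by (simp add: \<chi>_def free_map_lin lin_lin)
      also have "\<dots> = lin (fr_basis F' (Suc i)) (\<lambda>b. lin (fr_basis F' i) (\<psi> i) (boundary_col F' i b)) (\<phi> (Suc i) b)"
        using \<psi>(3) by (rule lin_cong)
      also have "\<dots> = lin (fr_basis F' i) (\<psi> i) (free_map F' i (\<phi> (Suc i) b))" by (simp add: free_map_lin lin_lin)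
      also have "\<dots> = lin (fr_basis F i) (\<chi> i) (boundary_col F i b)"
        unfolding \<phi>(3)[OF b] by (simp add: \<chi>_def[abs_def] lin_lin)
      finally show ?thesis .
    qed
  qed
  then obtain h where h: "h 0 = 0" "\<And>i b. b \<in> fr_basis F i \<Longrightarrow> homog_vec V F (Suc i) (fr_deg F i b) (h i b)"
    "\<And>i b. b \<in> fr_basis F (Suc i) \<Longrightarrow> free_map F (Suc i) (h (Suc i) b) =
       \<chi> (Suc i) b - unit_vec b - lin (fr_basis F i) (h i) (boundary_col F i b)" by blast
  have cc\<chi>: "const_col (\<chi> i) b = lin (fr_basis F' i) (const_col (\<psi> i)) (const_col (\<phi> i) b)" for i b
    by (simp add: const_col_def[of "\<chi> i"] \<chi>_def const_coeff_lin) (simp add: const_col_def)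
  have bar: "fiber_map F' i (lin (fr_basis F (Suc i)) (const_col (\<phi> (Suc i))) v) =
      lin (fr_basis F i) (const_col (\<phi> i)) (fiber_map F i v)"
    if chain: "\<And>b. b\<in>fr_basis F (Suc i) \<Longrightarrow> free_map F' i (\<phi> (Suc i) b) = lin (fr_basis F i) (\<phi> i) (boundary_col F i b)"
    for F F' :: "(('x, 'k) mpoly, 'm) free_complex" and \<phi> i v
  proof -
    have "lin (fr_basis F' (Suc i)) (const_col (boundary_col F' i)) (const_col (\<phi> (Suc i)) b) =
       lin (fr_basis F i) (const_col (\<phi> i)) (const_col (boundary_col F i) b)" if b: "b \<in> fr_basis F (Suc i)" for b
    proof -
      have "(\<lambda>c. const_coeff (free_map F' i (\<phi> (Suc i) b) c)) = (\<lambda>c. const_coeff (lin (fr_basis F i) (\<phi> i) (boundary_col F i b) c))"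
        using chain[OF b] by simp
      then show ?thesis unfolding free_map_lin const_coeff_lin by (simp add: const_col_def)
    qed
    then show ?thesis unfolding fiber_map_lin lin_lin by (rule lin_cong)
  qed
  show ?thesis
    unfolding fiber_exact_def
  proof (intro ballI impI)
    fix v assume v: "v \<in> fiber_part F (Suc i) j" "i = 0 \<or> fiber_map F i v = 0"
    let ?\<phi>v = "lin (fr_basis F (Suc i)) (const_col (\<phi> (Suc i))) v"
    have "?\<phi>v \<in> fiber_part F' (Suc i) j" using \<phi>(2) v(1) by (rule fiber_part_lin)
    moreover have "i = 0 \<or> fiber_map F' i ?\<phi>v = 0" using v(2) bar[OF \<phi>(3), of i v] by auto
    ultimately obtain w where w: "w \<in> fiber_part F' (Suc (Suc i)) j" "?\<phi>v = fiber_map F' (Suc i) w"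
      using ex unfolding fiber_exact_def by blast
    let ?\<psi>w = "lin (fr_basis F' (Suc (Suc i))) (const_col (\<psi> (Suc (Suc i)))) w"
    let ?hv = "lin (fr_basis F (Suc i)) (const_col (h (Suc i))) v"
    have "lin (fr_basis F (Suc i)) (const_col (\<chi> (Suc i))) v = lin (fr_basis F' (Suc i)) (const_col (\<psi> (Suc i))) ?\<phi>v"
      by (simp add: cc\<chi>[abs_def] lin_lin cong: lin_cong)
    also have "\<dots> = fiber_map F (Suc i) ?\<psi>w" unfolding w(2) using bar[OF \<psi>(3), of "Suc i" w] by simp
    finally have \<chi>v: "lin (fr_basis F (Suc i)) (const_col (\<chi> (Suc i))) v = fiber_map F (Suc i) ?\<psi>w" .
    have h0: "lin (fr_basis F i) (const_col (h i)) (fiber_map F i v) = 0"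
    proof (cases "i = 0")
      case True
      then have "const_col (h i) = 0" by (simp add: h(1) const_col_def fun_eq_iff)
      then show ?thesis by simp
    qed (use v in simp)
    have "fiber_map F (Suc i) ?hv = lin (fr_basis F (Suc i)) (\<lambda>b. fiber_map F (Suc i) (const_col (h (Suc i)) b)) v"
      by (simp add: fiber_map_lin lin_lin)
    also have "\<dots> = lin (fr_basis F (Suc i)) (\<lambda>b. const_col (\<chi> (Suc i)) b - unit_vec b
         - lin (fr_basis F i) (const_col (h i)) (const_col (boundary_col F i) b)) v"
    proof (rule lin_cong)
      fix b assume b: "b \<in> fr_basis F (Suc i)"
      have "fiber_map F (Suc i) (const_col (h (Suc i)) b) = (\<lambda>c. const_coeff (free_map F (Suc i) (h (Suc i) b) c))"
        unfolding free_map_lin const_coeff_lin fiber_map_lin by (simp add: const_col_def)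
      also have "\<dots> = (\<lambda>c. const_coeff (\<chi> (Suc i) b c)) - (\<lambda>c. const_coeff (unit_vec b c :: ('x, 'k) mpoly)) -
          (\<lambda>c. const_coeff (lin (fr_basis F i) (h i) (boundary_col F i b) c))"
        unfolding h(3)[OF b] by (simp add: const_coeff_diff fun_eq_iff)
      also have "(\<lambda>c. const_coeff (unit_vec b c :: ('x, 'k) mpoly)) = unit_vec b" by (simp add: unit_vec_def fun_eq_iff)
      finally show "fiber_map F (Suc i) (const_col (h (Suc i)) b) = const_col (\<chi> (Suc i)) b - unit_vec b
         - lin (fr_basis F i) (const_col (h i)) (const_col (boundary_col F i) b)"
        unfolding const_coeff_lin by (simp add: const_col_def fun_eq_iff)
    qed
    also have "\<dots> = fiber_map F (Suc i) ?\<psi>w - v - lin (fr_basis F i) (const_col (h i)) (fiber_map F i v)"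
    proof -
      have "lin (fr_basis F (Suc i)) unit_vec v = v"
        by (rule lin_unit_left[OF acyclic_finite[OF F]]) (use v in \<open>auto simp: fiber_part_def\<close>)
      moreover have "lin (fr_basis F (Suc i)) (\<lambda>b. lin (fr_basis F i) (const_col (h i)) (const_col (boundary_col F i) b)) v
          = lin (fr_basis F i) (const_col (h i)) (fiber_map F i v)" by (simp add: fiber_map_lin lin_lin)
      ultimately show ?thesis using \<chi>v by (simp add: lin_diff_left)
    qed
    finally have "fiber_map F (Suc i) ?hv = fiber_map F (Suc i) ?\<psi>w - v" unfolding h0 by simp
    then have "v = fiber_map F (Suc i) (?\<psi>w - ?hv)"
      by (simp add: fiber_map_lin lin_diff_right)
    moreover have "?\<psi>w - ?hv \<in> fiber_part F (Suc (Suc i)) j"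
    proof -
      have "?\<psi>w \<in> fiber_part F (Suc (Suc i)) j" "?hv \<in> fiber_part F (Suc (Suc i)) j"
        by (rule fiber_part_lin[OF \<psi>(2) w(1)], simp, rule fiber_part_lin[OF h(2) v(1)], simp)
      then show ?thesis by (rule fiber_part_diff)
    qed
    ultimately show "v \<in> fiber_map F (Suc i) ` fiber_part F (Suc (Suc i)) j" by blast
  qed
qed

section \<open>Tor from an arbitrary resolution\<close>

text \<open>The resolution of an ideal, continued by the inclusion of the ideal into the ring.\<close>

definition augment :: "(('x, 'k::field) mpoly, ('x, 'k) mpoly) free_complex \<Rightarrow> (('x, 'k) mpoly, ('x, 'k) mpoly) free_complex" where
  "augment F = \<lparr>fr_basis = case_nat {0} (fr_basis F), fr_deg = case_nat (\<lambda>_. 0) (fr_deg F),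
     fr_mat = case_nat (\<lambda>_. fr_aug F) (fr_mat F), fr_aug = \<lambda>_. 0\<rparr>"

lemma augment_simps [simp]:
  "fr_basis (augment F) 0 = {0}" "fr_basis (augment F) (Suc i) = fr_basis F i"
  "fr_deg (augment F) 0 b = 0" "fr_deg (augment F) (Suc i) = fr_deg F i"
  "fr_mat (augment F) 0 c = fr_aug F" "fr_mat (augment F) (Suc i) = fr_mat F i"
  by (simp_all add: augment_def)

lemma free_part_augment [simp]: "free_part S (augment F) (Suc i) = free_part S F i"
  by (simp add: free_part_def)

lemma free_map_augment [simp]: "free_map (augment F) (Suc i) = free_map F i"
  by (simp add: free_map_def fun_eq_iff)

lemma boundary_col_augment [simp]: "boundary_col (augment F) (Suc i) = boundary_col F i"
  by (simp add: boundary_col_def fun_eq_iff)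

lemma fiber_part_augment [simp]: "fiber_part (augment F) (Suc i) = fiber_part F i"
  by (simp add: fiber_part_def fun_eq_iff)

lemma fiber_map_augment [simp]: "fiber_map (augment F) (Suc i) = fiber_map F i"
  by (simp add: fiber_map_def fun_eq_iff)

lemma ideal_gmodule_simps [simp]:
  "carrier (ideal_gmodule S I) = I" "zero (ideal_gmodule S I) = zero S" "add (ideal_gmodule S I) = add S"
  "smult (ideal_gmodule S I) = mult S" "gcomp (ideal_gmodule S I) d = I \<inter> homog d"
  by (simp_all add: ideal_gmodule_def)

lemma finsum_ideal_gmodule:
  fixes I :: "('x, 'k::field) mpoly set"
  assumes I: "ideal I (poly_ring V)" and f: "f \<in> A \<rightarrow> I" and fin: "finite A"
  shows "finsum (ideal_gmodule (poly_ring V) I) f A = (\<Sum>b\<in>A. f b)"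
proof -
  interpret I: ideal I "poly_ring V" by (rule I)
  have 0: "0 \<in> I" and add: "p \<in> I \<Longrightarrow> q \<in> I \<Longrightarrow> p + q \<in> I" for p q
    using additive_subgroup.zero_closed[OF ideal.axioms(1)[OF I]]
      additive_subgroup.a_closed[OF ideal.axioms(1)[OF I], of p q] by auto
  interpret M: abelian_monoid "ideal_gmodule (poly_ring V) I"
    by (rule abelian_monoidI) (auto simp: 0 add algebra_simps)
  show ?thesis using fin f
  proof (induction A rule: finite_induct)
    case (insert b A)
    then show ?case by (subst M.finsum_insert) auto
  qed simp
qed

lemma free_aug_ideal:
  fixes I :: "('x, 'k::field) mpoly set"
  assumes I: "ideal I (poly_ring V)" and fin: "finite (fr_basis F 0)"
    and aug: "\<And>b. b \<in> fr_basis F 0 \<Longrightarrow> fr_aug F b \<in> I" and v: "v \<in> free_part (poly_ring V) F 0"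
  shows "free_aug (ideal_gmodule (poly_ring V) I) F v = (\<Sum>b\<in>fr_basis F 0. fr_aug F b * v b)"
proof -
  interpret I: ideal I "poly_ring V" by (rule I)
  have "v b * fr_aug F b \<in> I" if "b \<in> fr_basis F 0" for b
    using I.I_l_closed[OF aug[OF that], of "v b"] v by (simp add: free_part_def)
  then show ?thesis
    unfolding free_aug_def using finsum_ideal_gmodule[OF I _ fin, of "\<lambda>b. v b * fr_aug F b"]
    by (simp add: mult.commute)
qed

lemma resolution_ideal_aug:
  fixes I :: "('x, 'k::field) mpoly set"
  assumes r: "graded_free_resolution (poly_ring V) (ideal_gmodule (poly_ring V) I) F" and I: "ideal I (poly_ring V)"
    and v: "v \<in> free_part (poly_ring V) F 0"
  shows "free_map (augment F) 0 v = (\<lambda>c. if c = 0 then free_aug (ideal_gmodule (poly_ring V) I) F v else 0)"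
proof -
  have "free_aug (ideal_gmodule (poly_ring V) I) F v = (\<Sum>b\<in>fr_basis F 0. fr_aug F b * v b)"
    using r by (intro free_aug_ideal I v) (auto simp: graded_free_resolution_def)
  then show ?thesis by (simp add: free_map_def fun_eq_iff)
qed

lemma acyclic_augment:
  fixes I :: "('x, 'k::field) mpoly set"
  assumes r: "graded_free_resolution (poly_ring V) (ideal_gmodule (poly_ring V) I) F" and I: "ideal I (poly_ring V)"
  shows "acyclic_complex V (augment F)"
    and "free_map (augment F) 0 ` free_part (poly_ring V) (augment F) 1 = {w :: nat \<Rightarrow> _. w 0 \<in> I \<and> (\<forall>c. c \<noteq> 0 \<longrightarrow> w c = 0)}"
proof -
  interpret I: ideal I "poly_ring V" by (rule I)
  note a = resolution_ideal_aug[OF r I]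
  have fin: "finite (fr_basis (augment F) i)" for i
    using r by (cases i) (auto simp: graded_free_resolution_def)
  have mat: "fr_mat (augment F) i c b \<in> carrier (poly_ring V) \<inter> homog (fr_deg (augment F) (Suc i) b - fr_deg (augment F) i c)"
    if "c \<in> fr_basis (augment F) i" "b \<in> fr_basis (augment F) (Suc i)" for i c b
    using r that I.Icarr by (cases i) (auto simp: graded_free_resolution_def)
  have ker: "{v \<in> free_part (poly_ring V) F 0. free_aug (ideal_gmodule (poly_ring V) I) F v = \<zero>\<^bsub>ideal_gmodule (poly_ring V) I\<^esub>} =
      {v \<in> free_part (poly_ring V) F 0. free_map (augment F) 0 v = (\<lambda>_. 0)}"
    by (auto simp: a fun_eq_iff split: if_splits dest: spec[of _ 0])
  have ex: "free_map (augment F) (Suc i) ` free_part (poly_ring V) (augment F) (Suc (Suc i)) =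
      {v \<in> free_part (poly_ring V) (augment F) (Suc i). free_map (augment F) i v = (\<lambda>_. 0)}" for i
    using r ker by (cases i) (auto simp: graded_free_resolution_def)
  show "acyclic_complex V (augment F)" unfolding acyclic_complex_def using fin mat ex by blast
  have "free_aug (ideal_gmodule (poly_ring V) I) F ` free_part (poly_ring V) F 0 = I"
    using r by (simp add: graded_free_resolution_def)
  then have I': "p \<in> I \<longleftrightarrow> (\<exists>v\<in>free_part (poly_ring V) F 0. free_aug (ideal_gmodule (poly_ring V) I) F v = p)" for p
    by (metis imageE imageI)
  show "free_map (augment F) 0 ` free_part (poly_ring V) (augment F) 1 = {w :: nat \<Rightarrow> _. w 0 \<in> I \<and> (\<forall>c. c \<noteq> 0 \<longrightarrow> w c = 0)}"
    unfolding One_nat_def free_part_augment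
  proof (intro subset_antisym subsetI)
    fix w assume "w \<in> free_map (augment F) 0 ` free_part (poly_ring V) F 0"
    then show "w \<in> {w :: nat \<Rightarrow> _. w 0 \<in> I \<and> (\<forall>c. c \<noteq> 0 \<longrightarrow> w c = 0)}" using I' by (auto simp: a)
  next
    fix w :: "nat \<Rightarrow> ('x, 'k) mpoly" assume w: "w \<in> {w :: nat \<Rightarrow> _. w 0 \<in> I \<and> (\<forall>c. c \<noteq> 0 \<longrightarrow> w c = 0)}"
    then obtain v where v: "v \<in> free_part (poly_ring V) F 0" "free_aug (ideal_gmodule (poly_ring V) I) F v = w 0"
      using I'[of "w 0"] by auto
    then have "free_map (augment F) 0 v = w" using w by (auto simp: a)
    then show "w \<in> free_map (augment F) 0 ` free_part (poly_ring V) F 0" using v by blast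
  qed
qed

lemma sum_fun_apply: "(\<Sum>a\<in>A. f a) x = (\<Sum>a\<in>A. f a x)"
  by (induction A rule: infinite_finite_induct) simp_all

interpretation kspace: vector_space "kscale :: 'k::field \<Rightarrow> _"
  by (rule vector_space_kscale)

lemma (in vector_space) dim_diff_subspace:
  assumes B: "subspace B" and Z: "Z \<subseteq> span W" "finite W" and BZ: "B \<subseteq> Z"
  shows "dim Z - dim B \<noteq> 0 \<longleftrightarrow> B \<noteq> Z"
proof
  assume "B \<noteq> Z"
  obtain b where b: "b \<subseteq> B" "independent b" "B \<subseteq> span b" "card b = dim B" using basis_exists .
  obtain z where z: "b \<subseteq> z" "z \<subseteq> Z" "independent z" "Z \<subseteq> span z"
    by (rule maximal_independent_subset_extend[of b Z]) (use b BZ in auto)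
  have fin: "finite z" using independent_span_bound[OF Z(2) z(3)] z(2) Z(1) by auto
  have "span b \<subseteq> B" using b(1) B by (rule span_minimal)
  then have "b \<noteq> z" using z(4) \<open>B \<noteq> Z\<close> BZ by auto
  then have "card b < card z" using z(1) fin by (intro psubset_card_mono) auto
  then show "dim Z - dim B \<noteq> 0" using basis_card_eq_dim[OF z(2,4,3)] b(4) by simp
qed auto

text \<open>The dimension of Tor is a truncated difference of dimensions; it is nonzero exactly if the boundaries,
  which form a subspace of the finite-dimensional space of cycles, are not all of it.\<close>

lemma tor_dim_nonzero_iff:
  fixes F :: "(('x, 'k::field) mpoly, ('x, 'k) mpoly) free_complex"
  assumes F: "acyclic_complex V (augment F)"
  shows "tor_dim F i j \<noteq> 0 \<longleftrightarrow> \<not> fiber_exact (augment F) i j"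
proof -
  let ?E = "\<lambda>i. fr_basis F i"
  have fin: "finite (?E i)" for i using acyclic_finite[OF F, of "Suc i"] by simp
  have col: "homog_vec V F i (fr_deg F (Suc i) b) (boundary_col F i b)" if "b \<in> ?E (Suc i)" for i b
    using homog_vec_boundary_col[OF F, of b "Suc i"] that by (simp add: homog_vec_def)
  have map: "fiber_map F i v \<in> fiber_part F i j" if "v \<in> fiber_part F (Suc i) j" for i v
    unfolding fiber_map_lin using col that by (rule fiber_part_lin)
  have dd: "fiber_map F i (fiber_map F (Suc i) v) = 0" for i v
  proof -
    have "lin (?E (Suc i)) (const_col (boundary_col F i)) (const_col (boundary_col F (Suc i)) b) = 0" if "b \<in> ?E (Suc (Suc i))" for b
    proof -
      have *: "free_map F i (boundary_col F (Suc i) b) = 0"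
        using free_map_boundary_col[OF F, of b "Suc i"] that by simp
      have "lin (?E (Suc i)) (const_col (boundary_col F i)) (const_col (boundary_col F (Suc i)) b) =
         (\<lambda>c. const_coeff (free_map F i (boundary_col F (Suc i) b) c))"
        unfolding free_map_lin const_coeff_lin by (simp add: const_col_def)
      then show ?thesis by (simp add: * fun_eq_iff)
    qed
    then have "fiber_map F i (fiber_map F (Suc i) v) = lin (?E (Suc (Suc i))) (\<lambda>_. 0) v"
      unfolding fiber_map_lin lin_lin by (intro lin_cong)
    then show ?thesis by (simp add: lin_def fun_eq_iff)
  qed
  have sub: "tor_boundaries F i j \<subseteq> tor_cycles F i j"
    using map dd by (auto simp: tor_boundaries_def tor_cycles_def zero_fun_def)
  have "kspace.subspace (tor_boundaries F i j)"
  proof (rule kspace.subspaceI)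
    show "0 \<in> tor_boundaries F i j"
      unfolding tor_boundaries_def by (rule image_eqI[of _ _ 0]) (auto simp: fiber_map_lin fiber_part_def)
  next
    fix x y assume "x \<in> tor_boundaries F i j" "y \<in> tor_boundaries F i j"
    then obtain v w where "v \<in> fiber_part F (Suc i) j" "w \<in> fiber_part F (Suc i) j" "x = fiber_map F i v" "y = fiber_map F i w"
      by (auto simp: tor_boundaries_def)
    moreover from this have "v + w \<in> fiber_part F (Suc i) j" by (blast intro: fiber_part_add)
    ultimately show "x + y \<in> tor_boundaries F i j"
      unfolding tor_boundaries_def by (intro image_eqI[of _ _ "v + w"]) (auto simp: fiber_map_lin lin_add_right)
  next
    fix a x assume "x \<in> tor_boundaries F i j"
    then obtain v where "v \<in> fiber_part F (Suc i) j" "x = fiber_map F i v" by (auto simp: tor_boundaries_def)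
    then show "kscale a x \<in> tor_boundaries F i j"
      unfolding tor_boundaries_def
      by (intro image_eqI[of _ _ "kscale a v"])
        (auto simp: fiber_map_lin lin_def kscale_def fiber_part_def sum_distrib_left algebra_simps)
  qed
  moreover have "tor_cycles F i j \<subseteq> kspace.span (unit_vec ` ?E i)"
  proof
    fix v assume "v \<in> tor_cycles F i j"
    then have "v b = 0" if "b \<notin> ?E i" for b using that by (auto simp: tor_cycles_def fiber_part_def)
    then have "v = (\<Sum>b\<in>?E i. kscale (v b) (unit_vec b))"
      using fin[of i] by (auto simp: fun_eq_iff sum_fun_apply kscale_def unit_vec_def if_distrib[of "\<lambda>c. _ * c"] cong: if_cong)
    also have "\<dots> \<in> kspace.span (unit_vec ` ?E i)"
      by (intro kspace.span_sum kspace.span_scale kspace.span_base) auto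
    finally show "v \<in> kspace.span (unit_vec ` ?E i)" .
  qed
  ultimately have "tor_dim F i j \<noteq> 0 \<longleftrightarrow> tor_boundaries F i j \<noteq> tor_cycles F i j"
    unfolding tor_dim_def using sub fin by (intro kspace.dim_diff_subspace) auto
  also have "\<dots> \<longleftrightarrow> \<not> tor_cycles F i j \<subseteq> tor_boundaries F i j" using sub by auto
  also have "tor_cycles F i j \<subseteq> tor_boundaries F i j \<longleftrightarrow> fiber_exact (augment F) i j"
    by (cases i) (auto simp: fiber_exact_def tor_cycles_def tor_boundaries_def zero_fun_def)
  finally show ?thesis .
qed

text \<open>Betti numbers refer to a chosen resolution, but whether they vanish can be tested on any other one.\<close>

lemma betti_nonzero_iff:
  fixes I :: "('x, 'k::field) mpoly set"
  assumes r: "graded_free_resolution (poly_ring V) (ideal_gmodule (poly_ring V) I) F" and I: "ideal I (poly_ring V)"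
  shows "betti (poly_ring V) (ideal_gmodule (poly_ring V) I) i j \<noteq> 0 \<longleftrightarrow> \<not> fiber_exact (augment F) i j"
proof -
  define F' where "F' = (SOME F. graded_free_resolution (poly_ring V) (ideal_gmodule (poly_ring V) I) F)"
  have r': "graded_free_resolution (poly_ring V) (ideal_gmodule (poly_ring V) I) F'"
    unfolding F'_def using r by (rule someI)
  note a = acyclic_augment[OF r I] and a' = acyclic_augment[OF r' I]
  have "fiber_exact (augment F) i j \<longleftrightarrow> fiber_exact (augment F') i j"
    using fiber_exact_transfer[OF a(1) a'(1)] fiber_exact_transfer[OF a'(1) a(1)] a(2) a'(2) by auto
  then show ?thesis unfolding betti_def F'_def[symmetric] using tor_dim_nonzero_iff[OF a'(1)] by simp
qed

section \<open>Free resolutions from multigraded scalar complexes\<close>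

definition res_complex ::
  "nat set \<Rightarrow> (nat \<Rightarrow> nat) \<Rightarrow> (nat \<Rightarrow> ('x \<Rightarrow>\<^sub>0 nat)) \<Rightarrow> (nat \<Rightarrow> nat \<Rightarrow> 'k::field) \<Rightarrow> (nat \<Rightarrow> 'k) \<Rightarrow>
   (('x, 'k) mpoly, ('x, 'k) mpoly) free_complex" where
  "res_complex B h g D \<epsilon> = \<lparr>fr_basis = (\<lambda>i. {b \<in> B. h b = i}), fr_deg = (\<lambda>_ b. int (mono_deg (g b))),
     fr_mat = (\<lambda>_ c b. single (g b - g c) (D c b)),
     fr_aug = (\<lambda>b. single (g b) (\<epsilon> b))\<rparr>"

lemma res_complex_simps [simp]:
  "fr_basis (res_complex B h g D \<epsilon>) i = {b \<in> B. h b = i}"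
  "fr_deg (res_complex B h g D \<epsilon>) i b = int (mono_deg (g b))"
  "fr_mat (res_complex B h g D \<epsilon>) i c b = single (g b - g c) (D c b)"
  "fr_aug (res_complex B h g D \<epsilon>) b = single (g b) (\<epsilon> b)"
  by (simp_all add: res_complex_def)

text \<open>The part of multidegree \<open>a\<close> of an element of a free module, as a vector of scalars: in front of a basis
  element of degree \<open>g b\<close> it is the coefficient of the monomial \<open>a - g b\<close>.\<close>

definition strand :: "('b \<Rightarrow> ('x \<Rightarrow>\<^sub>0 nat)) \<Rightarrow> ('b \<Rightarrow> ('x, 'k::field) mpoly) \<Rightarrow> ('x \<Rightarrow>\<^sub>0 nat) \<Rightarrow> 'b \<Rightarrow> 'k" where
  "strand g v a b = (if mdvd (g b) a then lookup (v b) (a - g b) else 0)"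

lemma lookup_strand: "lookup (v b) n = strand g v (n + g b) b"
  by (simp add: strand_def)

text \<open>Matrices whose entries are monomials of the right degree act on strands through their scalars.
  The case \<open>e = 0\<close> is the augmentation.\<close>

lemma lookup_monomial_row:
  fixes v :: "'b \<Rightarrow> ('x, 'k::field) mpoly"
  assumes e: "mdvd e a" and k: "\<And>b. b \<in> A \<Longrightarrow> k b \<noteq> 0 \<Longrightarrow> mdvd e (g b)"
  shows "lookup (\<Sum>b\<in>A. single (g b - e) (k b) * v b) (a - e) = (\<Sum>b\<in>A. k b * strand g v a b)"
  unfolding lookup_sum
proof (rule sum.cong[OF refl])
  fix b assume b: "b \<in> A"
  show "lookup (single (g b - e) (k b) * v b) (a - e) = k b * strand g v a b"
  proof (cases "k b = 0")
    case False
    then have eg: "mdvd e (g b)" using k b by simp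
    have n: "y - x \<le> z - x \<longleftrightarrow> y \<le> z" "(z - x) - (y - x) = z - y" if "x \<le> y" "x \<le> z" for x y z :: nat using that by auto
    have 1: "mdvd (g b - e) (a - e) \<longleftrightarrow> mdvd (g b) a"
      using eg e by (simp add: mdvd_def lookup_minus n)
    have 2: "(a - e) - (g b - e) = a - g b"
      using eg e by (intro poly_mapping_eqI) (simp add: mdvd_def lookup_minus n)
    show ?thesis by (simp add: lookup_single_mult strand_def 1 2)
  qed simp
qed

text \<open>Strands can be prescribed freely in finitely many multidegrees.\<close>

lemma vector_of_strands:
  fixes f :: "('x \<Rightarrow>\<^sub>0 nat) \<Rightarrow> 'b \<Rightarrow> 'k::field"
  assumes A: "finite A" "\<forall>a\<in>A. keys a \<subseteq> V" "\<forall>a b. a \<notin> A \<longrightarrow> f a b = 0"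
  shows "\<exists>w. (\<forall>b. w b \<in> carrier (poly_ring V) \<and> (b \<notin> T \<longrightarrow> w b = 0)) \<and>
    (\<forall>a. \<forall>b\<in>T. mdvd (g b) a \<longrightarrow> strand g w a b = f a b)"
proof -
  define w where "w b = (if b \<in> T then Abs_poly_mapping (\<lambda>n. f (n + g b) b) else 0)" for b
  have fin: "finite {n. f (n + g b) b \<noteq> 0}" for b
  proof (rule finite_subset)
    show "{n. f (n + g b) b \<noteq> 0} \<subseteq> (\<lambda>a. a - g b) ` A"
    proof
      fix n assume "n \<in> {n. f (n + g b) b \<noteq> 0}"
      then have "n + g b \<in> A" using A(3) by blast
      then show "n \<in> (\<lambda>a. a - g b) ` A" by (rule rev_image_eqI) simp
    qed
  qed (use A in simp)
  then have look: "lookup (w b) n = (if b \<in> T then f (n + g b) b else 0)" for b n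
    by (simp add: w_def)
  have "w b \<in> carrier (poly_ring V)" for b
    unfolding carrier_poly_ring
  proof
    fix n assume "n \<in> keys (w b)"
    then have "f (n + g b) b \<noteq> 0" by (simp add: in_keys_iff look split: if_splits)
    then have "keys (n + g b) \<subseteq> V" using A(2,3) by blast
    then show "keys n \<subseteq> V" by (simp add: keys_add_nat)
  qed
  moreover have "strand g w a b = f a b" if "b \<in> T" "mdvd (g b) a" for a b
    using that by (simp add: strand_def look mdvd_minus_add)
  ultimately show ?thesis by (intro exI[of _ w]) (simp add: w_def)
qed

context
  fixes V :: "'x set" and U :: "('x \<Rightarrow>\<^sub>0 nat) set" and B :: "nat set" and h g
    and D :: "nat \<Rightarrow> nat \<Rightarrow> 'k::field" and \<epsilon>
  assumes r: "monomial_resolution U B h g D \<epsilon>" and UV: "\<And>u. u \<in> U \<Longrightarrow> keys u \<subseteq> V"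
begin

abbreviation (input) "cx \<equiv> res_complex B h g D \<epsilon>"
abbreviation (input) "fp i \<equiv> free_part (poly_ring V) cx i"

lemma res_aug_complex: "augmented_complex B h D \<epsilon>" using r by (simp add: monomial_resolution_def)
lemma res_finite: "finite B" using res_aug_complex by (simp add: augmented_complex_def)
lemma res_mdvd: "x \<in> B \<Longrightarrow> y \<in> B \<Longrightarrow> D x y \<noteq> 0 \<Longrightarrow> mdvd (g x) (g y)" using r by (simp add: monomial_resolution_def)
lemma res_height: "x \<in> B \<Longrightarrow> y \<in> B \<Longrightarrow> D x y \<noteq> 0 \<Longrightarrow> h y = Suc (h x)"
  using res_aug_complex by (simp add: augmented_complex_def)
lemma res_aug_height: "x \<in> B \<Longrightarrow> \<epsilon> x \<noteq> 0 \<Longrightarrow> h x = 0"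
  using res_aug_complex by (simp add: augmented_complex_def)
lemma res_keys: assumes "b \<in> B" shows "keys (g b) \<subseteq> V"
proof -
  have "keys (g b) \<subseteq> (\<Union>u\<in>U. keys u)" using r assms by (simp add: monomial_resolution_def)
  also have "\<dots> \<subseteq> V" using UV by blast
  finally show ?thesis .
qed

lemma res_in_ideal: "b \<in> B \<Longrightarrow> mdvd (g b) a \<Longrightarrow> \<exists>u\<in>U. mdvd u a"
  using r by (auto simp: monomial_resolution_def below_def)

lemma strand_support: "v \<in> fp i \<Longrightarrow> strand g v a b \<noteq> 0 \<Longrightarrow> b \<in> B \<and> h b = i \<and> mdvd (g b) a"
  by (auto simp: strand_def free_part_def split: if_splits)

lemma strand_eqI:
  assumes v: "v \<in> fp i" and w: "w \<in> fp i"
    and eq: "\<And>a b. b \<in> B \<Longrightarrow> h b = i \<Longrightarrow> mdvd (g b) a \<Longrightarrow> strand g v a b = strand g w a b"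
  shows "v = w"
proof
  fix b show "v b = w b"
  proof (cases "b \<in> B \<and> h b = i")
    case True
    show ?thesis by (rule poly_mapping_eqI) (simp add: lookup_strand[of _ _ _ g] eq True)
  qed (use v w in \<open>auto simp: free_part_def\<close>)
qed

lemma free_map_res_in:
  assumes v: "v \<in> fp (Suc i)" shows "free_map cx i v \<in> fp i"
proof -
  have "single (g b - g c) (D c b) * v b \<in> carrier (poly_ring V)" if "b \<in> B" for b c
    using res_keys[OF that] keys_minus_nat[of "g b" "g c"] v
    by (intro poly_ring_mult poly_ring_single) (auto simp: free_part_def)
  then show ?thesis by (auto simp: free_part_def free_map_def intro!: poly_ring_sum)
qed

lemma strand_free_map:
  assumes v: "v \<in> fp (Suc i)" and c: "c \<in> B" "mdvd (g c) a"
  shows "strand g (free_map cx i v) a c = (\<Sum>b\<in>below g B a. D c b * strand g v a b)"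
proof -
  have 1: "(\<Sum>b\<in>{b \<in> B. h b = Suc i}. D c b * strand g v a b) = (\<Sum>b\<in>below g B a. D c b * strand g v a b)"
  proof -
    have "(\<Sum>b\<in>A. D c b * strand g v a b) = (\<Sum>b\<in>{b \<in> B. h b = Suc i \<and> mdvd (g b) a}. D c b * strand g v a b)"
      if "finite A" "{b \<in> B. h b = Suc i \<and> mdvd (g b) a} \<subseteq> A" for A
      using that strand_support[OF v, of a] by (intro sum.mono_neutral_right) auto
    from this[of "{b \<in> B. h b = Suc i}"] this[of "below g B a"] show ?thesis
      using res_finite by (simp add: below_def subset_iff)
  qed
  show ?thesis
  proof (cases "h c = i")
    case True
    then have "strand g (free_map cx i v) a c =
       lookup (\<Sum>b\<in>{b \<in> B. h b = Suc i}. single (g b - g c) (D c b) * v b) (a - g c)"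
      using c by (simp add: strand_def free_map_def)
    also have "\<dots> = (\<Sum>b\<in>{b \<in> B. h b = Suc i}. D c b * strand g v a b)"
      by (rule lookup_monomial_row) (use c res_mdvd in auto)
    finally show ?thesis unfolding 1 .
  next
    case False
    then have "D c b * strand g v a b = 0" if "b \<in> below g B a" for b
      using that strand_support[OF v, of a b] res_height[OF c(1), of b] by (cases "D c b = 0") (auto simp: below_def)
    then have "(\<Sum>b\<in>below g B a. D c b * strand g v a b) = 0" by (rule sum.neutral[rule_format])
    then show ?thesis using False by (simp add: strand_def free_map_def)
  qed
qed

definition aug_poly :: "(nat \<Rightarrow> ('x, 'k) mpoly) \<Rightarrow> ('x, 'k) mpoly" where
  "aug_poly v = (\<Sum>b\<in>{b \<in> B. h b = 0}. single (g b) (\<epsilon> b) * v b)"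

lemma lookup_aug_poly:
  assumes v: "v \<in> fp 0"
  shows "lookup (aug_poly v) a = (\<Sum>b\<in>below g B a. \<epsilon> b * strand g v a b)"
proof -
  have "lookup (aug_poly v) a = (\<Sum>b\<in>{b \<in> B. h b = 0}. \<epsilon> b * strand g v a b)"
    unfolding aug_poly_def using lookup_monomial_row[of 0 a "{b \<in> B. h b = 0}" \<epsilon> g v] by simp
  also have "\<dots> = (\<Sum>b\<in>{b \<in> B. h b = 0 \<and> mdvd (g b) a}. \<epsilon> b * strand g v a b)"
    using res_finite by (intro sum.mono_neutral_right) (auto simp: strand_def)
  also have "\<dots> = (\<Sum>b\<in>below g B a. \<epsilon> b * strand g v a b)"
    using res_finite res_aug_height by (intro sum.mono_neutral_left) (auto simp: below_def)
  finally show ?thesis .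
qed

lemma free_aug_res: 
  assumes "v \<in> fp 0"
  shows "free_aug (ideal_gmodule (poly_ring V) (monomial_ideal V U)) cx v = aug_poly v"
proof -
  have "free_aug (ideal_gmodule (poly_ring V) (monomial_ideal V U)) cx v = (\<Sum>b\<in>fr_basis cx 0. fr_aug cx b * v b)"
  proof (rule free_aug_ideal[OF monomial_ideal_ideal])
    fix b assume "b \<in> fr_basis cx 0"
    then show "fr_aug cx b \<in> monomial_ideal V U"
      using res_in_ideal[of b "g b"] res_keys[of b] by (auto simp: monomial_ideal_def poly_ring_single)
  qed (use assms res_finite in auto)
  then show ?thesis by (simp add: aug_poly_def)
qed

lemma aug_poly_in: 
  assumes v: "v \<in> fp 0" shows "aug_poly v \<in> monomial_ideal V U"
proof -
  have "aug_poly v \<in> carrier (poly_ring V)"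
    unfolding aug_poly_def using v res_keys by (auto simp: free_part_def intro!: poly_ring_sum poly_ring_mult poly_ring_single)
  moreover have "\<exists>u\<in>U. mdvd u m" if m: "m \<in> keys (aug_poly v)" for m
  proof -
    have "below g B m \<noteq> {}" using m by (auto simp: in_keys_iff lookup_aug_poly[OF v])
    then show ?thesis using res_in_ideal by (auto simp: below_def)
  qed
  ultimately show ?thesis by (simp add: monomial_ideal_def)
qed

lemma strand_degrees:
  assumes v: "v \<in> fp i"
  defines "A \<equiv> {a. \<exists>b. strand g v a b \<noteq> 0}"
  shows "finite A" "\<forall>a\<in>A. keys a \<subseteq> V"
proof -
  have *: "a - g b \<in> keys (v b) \<and> b \<in> B \<and> a = (a - g b) + g b" if "strand g v a b \<noteq> 0" for a b
    using that strand_support[OF v that] by (auto simp: strand_def in_keys_iff mdvd_minus_add)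
  then have "A \<subseteq> (\<Union>b\<in>B. (\<lambda>n. n + g b) ` keys (v b))" unfolding A_def by blast
  then show "finite A" by (rule finite_subset) (use res_finite in auto)
  show "\<forall>a\<in>A. keys a \<subseteq> V"
  proof
    fix a assume "a \<in> A"
    then obtain b where b: "strand g v a b \<noteq> 0" by (auto simp: A_def)
    have "keys (a - g b) \<subseteq> V" using *[OF b] v by (auto simp: free_part_def carrier_poly_ring)
    moreover have "keys (g b) \<subseteq> V" using *[OF b] res_keys by blast
    ultimately show "keys a \<subseteq> V" using *[OF b] keys_add_nat by (metis le_sup_iff)
  qed
qed

lemma contraction_below:
  "\<exists>s u. \<forall>a. below g B a \<noteq> {} \<longrightarrow> contraction (below g B a) h D \<epsilon> (s a) (u a)"
proof -
  have "\<forall>a. \<exists>s u. below g B a \<noteq> {} \<longrightarrow> contraction (below g B a) h D \<epsilon> s u"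
    using r by (simp add: monomial_resolution_def contractible_def)
  then show ?thesis by metis
qed

text \<open>The homotopies of all strands together produce a preimage: on the strand of a cycle \<open>v\<close> the identity
  \<open>D s + s D + u \<epsilon> = 1\<close> reduces to \<open>D s v = v\<close>.\<close>

lemma res_exact:
  assumes v: "v \<in> fp i"
    and Dv: "\<And>a c. c \<in> below g B a \<Longrightarrow> (\<Sum>b\<in>below g B a. D c b * strand g v a b) = 0"
    and \<epsilon>v: "\<And>a. (\<Sum>b\<in>below g B a. \<epsilon> b * strand g v a b) = 0"
  shows "\<exists>w\<in>fp (Suc i). free_map cx i w = v"
proof -
  obtain s u where s: "\<And>a. below g B a \<noteq> {} \<Longrightarrow> contraction (below g B a) h D \<epsilon> (s a) (u a)"
    using contraction_below by blast
  define f where "f a b = (\<Sum>y\<in>below g B a. s a b y * strand g v a y)" for a b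
  have f0: "\<forall>a b. a \<notin> {a. \<exists>b. strand g v a b \<noteq> 0} \<longrightarrow> f a b = 0"
    by (auto simp: f_def)
  obtain w where w: "\<And>b. w b \<in> carrier (poly_ring V)" "\<And>b. b \<notin> fr_basis cx (Suc i) \<Longrightarrow> w b = 0"
    "\<And>a b. b \<in> fr_basis cx (Suc i) \<Longrightarrow> mdvd (g b) a \<Longrightarrow> strand g w a b = f a b"
    using vector_of_strands[OF strand_degrees[OF v] f0, where T = "fr_basis cx (Suc i)" and g = g] by blast
  have wfp: "w \<in> fp (Suc i)" using w by (simp add: free_part_def)
  have wf: "strand g w a b = f a b" if b: "b \<in> below g B a" for a b
  proof (cases "h b = Suc i")
    case True then show ?thesis using w(3)[of b a] b by (simp add: below_def)
  next
    case False
    have "s a b y * strand g v a y = 0" if "y \<in> below g B a" for y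
    proof -
      have "below g B a \<noteq> {}" using b by auto
      then have "h b = Suc (h y)" if "s a b y \<noteq> 0"
        using s[of a] that b \<open>y \<in> below g B a\<close> by (auto simp: contraction_def)
      then show ?thesis using strand_support[OF v, of a y] False by auto
    qed
    then have "f a b = 0" unfolding f_def by (rule sum.neutral[rule_format])
    then show ?thesis using strand_support[OF wfp, of a b] False by auto
  qed
  have "free_map cx i w = v"
  proof (rule strand_eqI[OF free_map_res_in[OF wfp] v])
    fix a c assume c: "c \<in> B" "h c = i" "mdvd (g c) a"
    let ?B = "below g B a" and ?v = "\<lambda>y (_::unit). strand g v a y"
    have cB: "c \<in> ?B" using c by (simp add: below_def)
    have fin: "finite ?B" using res_finite by (simp add: below_def)
    have con: "contraction ?B h D \<epsilon> (s a) (u a)" using s cB by blast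
    have "strand g (free_map cx i w) a c = (\<Sum>b\<in>?B. D c b * f a b)"
      using c by (simp add: strand_free_map[OF wfp] wf)
    also have "\<dots> = mat_mult ?B D (mat_mult ?B (s a) ?v) c ()" by (simp add: mat_mult_def f_def)
    also have "\<dots> = mat_mult ?B (mat_mult ?B D (s a)) ?v c ()" by (simp add: mat_mult_assoc)
    also have "\<dots> = mat_mult ?B id_mat ?v c () - mat_mult ?B (mat_mult ?B (s a) D) ?v c ()
        - u a c * (\<Sum>b\<in>?B. \<epsilon> b * strand g v a b)"
    proof -
      have "mat_mult ?B D (s a) c y = id_mat c y - mat_mult ?B (s a) D c y - u a c * \<epsilon> y" if "y \<in> ?B" for y
        using con cB that by (auto simp: contraction_def algebra_simps dest!: bspec)
      then have "mat_mult ?B (mat_mult ?B D (s a)) ?v c () =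
          mat_mult ?B (\<lambda>c y. id_mat c y - mat_mult ?B (s a) D c y - u a c * \<epsilon> y) ?v c ()"
        by (rule mat_mult_cong) simp_all
      then show ?thesis
        by (simp add: mat_mult_def[of ?B _ ?v] sum_distrib_left sum_subtractf left_diff_distrib mult.assoc)
    qed
    also have "mat_mult ?B (mat_mult ?B (s a) D) ?v c () = mat_mult ?B (s a) (mat_mult ?B D ?v) c ()" by (rule mat_mult_assoc)
    also have "\<dots> = 0"
      unfolding mat_mult_def[of ?B "s a"] using Dv[of _ a] by (intro sum.neutral) (simp add: mat_mult_def)
    also have "mat_mult ?B id_mat ?v c () = strand g v a c" using fin cB by (rule mat_mult_id_left)
    finally show "strand g (free_map cx i w) a c = strand g v a c" by (simp add: \<epsilon>v)
  qed
  then show ?thesis using wfp by blast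
qed

text \<open>In multidegree \<open>a\<close>, the coefficient of \<open>p\<close> times \<open>u a\<close> is a preimage, because \<open>\<epsilon> (u a) = 1\<close>.\<close>

lemma aug_surj:
  assumes p: "p \<in> monomial_ideal V U"
  shows "\<exists>v\<in>fp 0. aug_poly v = p"
proof -
  obtain s u where s: "\<And>a. below g B a \<noteq> {} \<Longrightarrow> contraction (below g B a) h D \<epsilon> (s a) (u a)"
    using contraction_below by blast
  define f where "f a b = u a b * lookup p a" for a b
  have k: "\<forall>a\<in>keys p. keys a \<subseteq> V"
    using p by (simp add: monomial_ideal_def carrier_poly_ring)
  have f0: "\<forall>a b. a \<notin> keys p \<longrightarrow> f a b = 0" by (simp add: f_def in_keys_iff)
  obtain v where v: "\<And>b. v b \<in> carrier (poly_ring V)" "\<And>b. b \<notin> fr_basis cx 0 \<Longrightarrow> v b = 0"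
    "\<And>a b. b \<in> fr_basis cx 0 \<Longrightarrow> mdvd (g b) a \<Longrightarrow> strand g v a b = f a b"
    using vector_of_strands[OF finite_keys[of p] k f0, where T = "fr_basis cx 0" and g = g] by blast
  have vfp: "v \<in> fp 0" using v by (simp add: free_part_def)
  have "lookup (aug_poly v) a = lookup p a" for a
  proof -
    have "\<epsilon> b * strand g v a b = \<epsilon> b * f a b" if "b \<in> below g B a" for b
      using v(3)[of b a] that res_aug_height[of b] by (cases "\<epsilon> b = 0") (auto simp: below_def)
    then have *: "lookup (aug_poly v) a = (\<Sum>b\<in>below g B a. \<epsilon> b * u a b) * lookup p a"
      unfolding lookup_aug_poly[OF vfp] sum_distrib_right by (intro sum.cong) (simp_all add: f_def mult.assoc)
    show ?thesis
    proof (cases "a \<in> keys p")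
      case True
      then have "below g B a \<noteq> {}" using p r by (simp add: monomial_ideal_def monomial_resolution_def)
      then show ?thesis using s[of a] * by (simp add: contraction_def)
    next
      case False then show ?thesis using * by (simp add: in_keys_iff)
    qed
  qed
  then show ?thesis using vfp by (blast intro: poly_mapping_eqI)
qed

lemma res_complex_dd:
  assumes w: "w \<in> fp (Suc (Suc i))" shows "free_map cx i (free_map cx (Suc i) w) = (\<lambda>_. 0)"
proof (rule strand_eqI)
  note fw = free_map_res_in[OF w]
  show "free_map cx i (free_map cx (Suc i) w) \<in> fp i" by (rule free_map_res_in[OF fw])
  show "(\<lambda>_. 0) \<in> fp i" by (simp add: free_part_def)
  fix a c assume c: "c \<in> B" "h c = i" "mdvd (g c) a"
  let ?B = "below g B a" and ?w = "\<lambda>y (_::unit). strand g w a y"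
  have "strand g (free_map cx i (free_map cx (Suc i) w)) a c = (\<Sum>b\<in>?B. D c b * (\<Sum>y\<in>?B. D b y * strand g w a y))"
    unfolding strand_free_map[OF fw c(1,3)] by (intro sum.cong) (auto simp: below_def strand_free_map[OF w])
  also have "\<dots> = mat_mult ?B D (mat_mult ?B D ?w) c ()" by (simp add: mat_mult_def)
  also have "\<dots> = mat_mult ?B (mat_mult ?B D D) ?w c ()" by (simp add: mat_mult_assoc)
  also have "\<dots> = 0"
    using augmented_complex_below[OF res_aug_complex res_mdvd, where a = a] c
    unfolding mat_mult_def[of _ "mat_mult ?B D D"]
    by (intro sum.neutral) (auto simp: augmented_complex_def below_def)
  finally show "strand g (free_map cx i (free_map cx (Suc i) w)) a c = strand g (\<lambda>_. 0) a c" by (simp add: strand_def)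
qed

lemma aug_poly_free_map:
  assumes w: "w \<in> fp (Suc 0)" shows "aug_poly (free_map cx 0 w) = 0"
proof (rule poly_mapping_eqI)
  fix a
  let ?B = "below g B a" and ?w = "\<lambda>y (_::unit). strand g w a y"
  have "lookup (aug_poly (free_map cx 0 w)) a = (\<Sum>b\<in>?B. \<epsilon> b * (\<Sum>y\<in>?B. D b y * strand g w a y))"
    unfolding lookup_aug_poly[OF free_map_res_in[OF w]] by (intro sum.cong) (auto simp: below_def strand_free_map[OF w])
  also have "\<dots> = mat_mult ?B (\<lambda>_. \<epsilon>) (mat_mult ?B D ?w) () ()" by (simp add: mat_mult_def)
  also have "\<dots> = mat_mult ?B (mat_mult ?B (\<lambda>_. \<epsilon>) D) ?w () ()" by (simp add: mat_mult_assoc)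
  also have "\<dots> = 0"
    using augmented_complex_below[OF res_aug_complex res_mdvd, where a = a]
    unfolding mat_mult_def by (intro sum.neutral) (auto simp: augmented_complex_def)
  finally show "lookup (aug_poly (free_map cx 0 w)) a = lookup 0 a" by simp
qed

lemma graded_free_resolution_res_complex:
  "graded_free_resolution (poly_ring V) (ideal_gmodule (poly_ring V) (monomial_ideal V U)) cx"
proof -
  let ?M = "ideal_gmodule (poly_ring V) (monomial_ideal V U) :: (('x, 'k) mpoly, ('x, 'k) mpoly) gmodule"
  have 1: "finite (fr_basis cx i)" for i using res_finite by simp
  have 2: "fr_mat cx i c b \<in> carrier (poly_ring V) \<inter> homog (fr_deg cx (Suc i) b - fr_deg cx i c)"
    if "c \<in> fr_basis cx i" "b \<in> fr_basis cx (Suc i)" for i c b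
  proof -
    have "keys (g b - g c) \<subseteq> V" using that res_keys[of b] keys_minus_nat[of "g b" "g c"] by auto
    moreover have "D c b \<noteq> 0 \<Longrightarrow> mdvd (g c) (g b)" using that res_mdvd by auto
    ultimately show ?thesis by (auto intro!: homog_single poly_ring_single mono_deg_minus)
  qed
  have 3: "fr_aug cx b \<in> gcomp ?M (fr_deg cx 0 b)" if "b \<in> fr_basis cx 0" for b
    using that res_in_ideal[of b "g b"] res_keys[of b] 
    by (auto simp: monomial_ideal_def poly_ring_single intro!: homog_single)
  have 4: "free_aug ?M cx ` fp 0 = carrier ?M"
    using aug_surj aug_poly_in by (force simp: free_aug_res image_iff)
  have 5: "free_map cx 0 ` fp 1 = {v \<in> fp 0. free_aug ?M cx v = \<zero>\<^bsub>?M\<^esub>}"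
  proof (intro subset_antisym subsetI)
    fix v assume "v \<in> free_map cx 0 ` fp 1"
    then show "v \<in> {v \<in> fp 0. free_aug ?M cx v = \<zero>\<^bsub>?M\<^esub>}"
      using free_map_res_in[of _ 0] aug_poly_free_map by (auto simp: free_aug_res)
  next
    fix v assume "v \<in> {v \<in> fp 0. free_aug ?M cx v = \<zero>\<^bsub>?M\<^esub>}"
    then have v: "v \<in> fp 0" "aug_poly v = 0" by (auto simp: free_aug_res)
    have "D c b * strand g v a b = 0" if "c \<in> B" "b \<in> B" for a b c
      using strand_support[OF v(1), of a b] res_height[OF that] by (cases "D c b = 0") auto
    then have "\<exists>w\<in>fp (Suc 0). free_map cx 0 w = v"
      using v lookup_aug_poly[OF v(1)] by (intro res_exact) (auto simp: below_def intro!: sum.neutral)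
    then show "v \<in> free_map cx 0 ` fp 1" by auto
  qed
  have 6: "free_map cx (Suc i) ` fp (Suc (Suc i)) = {v \<in> fp (Suc i). free_map cx i v = (\<lambda>_. 0)}" for i
  proof (intro subset_antisym subsetI)
    fix v assume "v \<in> free_map cx (Suc i) ` fp (Suc (Suc i))"
    then show "v \<in> {v \<in> fp (Suc i). free_map cx i v = (\<lambda>_. 0)}"
      using free_map_res_in[of _ "Suc i"] res_complex_dd by auto
  next
    fix v assume "v \<in> {v \<in> fp (Suc i). free_map cx i v = (\<lambda>_. 0)}"
    then have v: "v \<in> fp (Suc i)" "free_map cx i v = (\<lambda>_. 0)" by auto
    have "(\<Sum>b\<in>below g B a. D c b * strand g v a b) = 0" if "c \<in> below g B a" for a c
      using strand_free_map[OF v(1), of c a] that v(2) by (simp add: below_def strand_def)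
    moreover have "\<epsilon> b * strand g v a b = 0" if "b \<in> B" for a b
      using strand_support[OF v(1), of a b] res_aug_height[OF that] by (cases "\<epsilon> b = 0") auto
    ultimately have "\<exists>w\<in>fp (Suc (Suc i)). free_map cx (Suc i) w = v"
      using v by (intro res_exact) (auto simp: below_def intro!: sum.neutral)
    then show "v \<in> free_map cx (Suc i) ` fp (Suc (Suc i))" by auto
  qed
  show ?thesis unfolding graded_free_resolution_def using 1 2 3 4 5 6 by blast
qed

end

text \<open>The fiber of a minimal resolution has zero differentials, so its homology is spanned by the basis.\<close>

lemma betti_minimal_resolution:
  fixes D :: "nat \<Rightarrow> nat \<Rightarrow> 'k::field"
  assumes r: "minimal_resolution U B h g D \<epsilon>" and UV: "\<And>u. u \<in> U \<Longrightarrow> keys u \<subseteq> V"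
  shows "betti (poly_ring V) (ideal_gmodule (poly_ring V) (monomial_ideal V U :: ('x, 'k) mpoly set)) i j \<noteq> 0 \<longleftrightarrow>
    (\<exists>b\<in>B. h b = i \<and> int (mono_deg (g b)) = j)"
proof -
  let ?F = "res_complex B h g D \<epsilon>"
  have r': "monomial_resolution U B h g D \<epsilon>" using r by (simp add: minimal_resolution_def)
  note res = graded_free_resolution_res_complex[OF r' UV]
  have "const_coeff (single (g b - g c) (D c b)) = 0" if cb: "c \<in> B" "b \<in> B" for c b
  proof (cases "D c b = 0")
    case False
    then have m: "mdvd (g c) (g b)" "g c \<noteq> g b"
      using r cb by (auto simp: minimal_resolution_def monomial_resolution_def)
    then have "g b - g c \<noteq> 0" using mdvd_minus_add by fastforce
    then show ?thesis by (simp add: const_coeff_def lookup_single_not_eq)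
  qed (simp add: const_coeff_def)
  then have zero: "fiber_map ?F i v = 0" for i v
    by (auto simp: fiber_map_def fun_eq_iff intro!: sum.neutral)
  have "betti (poly_ring V) (ideal_gmodule (poly_ring V) (monomial_ideal V U :: ('x, 'k) mpoly set)) i j \<noteq> 0
      \<longleftrightarrow> \<not> fiber_exact (augment ?F) i j"
    using res monomial_ideal_ideal by (rule betti_nonzero_iff)
  also have "fiber_exact (augment ?F) i j \<longleftrightarrow> (\<forall>v\<in>fiber_part ?F i j. v = 0)"
  proof -
    have "i = 0 \<or> fiber_map (augment ?F) i v = 0" for v by (cases i) (simp_all add: zero)
    moreover have "(0 :: nat \<Rightarrow> 'k) \<in> fiber_part ?F (Suc i) j" by (simp add: fiber_part_def)
    ultimately show ?thesis by (auto simp: fiber_exact_def zero image_iff)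
  qed
  also have "\<dots> \<longleftrightarrow> \<not> (\<exists>b\<in>B. h b = i \<and> int (mono_deg (g b)) = j)"
  proof
    assume L: "\<forall>v\<in>fiber_part ?F i j. v = 0"
    have False if "b \<in> B" "h b = i" "int (mono_deg (g b)) = j" for b
    proof -
      have "unit_vec b \<in> fiber_part ?F i j" using that by (auto simp: fiber_part_def unit_vec_def)
      then have "unit_vec b b = (0 :: 'k)" using L by (metis zero_fun_apply)
      then show False by (simp add: unit_vec_def)
    qed
    then show "\<not> (\<exists>b\<in>B. h b = i \<and> int (mono_deg (g b)) = j)" by blast
  next
    assume R: "\<not> (\<exists>b\<in>B. h b = i \<and> int (mono_deg (g b)) = j)"
    show "\<forall>v\<in>fiber_part ?F i j. v = 0" using R by (auto simp: fiber_part_def fun_eq_iff)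
  qed
  finally show ?thesis by simp
qed

section \<open>Projective dimension and regularity of products\<close>

lemma proj_dim_regularity_minimal_resolution:
  fixes D :: "nat \<Rightarrow> nat \<Rightarrow> 'k::field"
  assumes r: "minimal_resolution U B h g D \<epsilon>" and UV: "\<forall>u\<in>U. keys u \<subseteq> V"
  shows "proj_dim (poly_ring V) (ideal_gmodule (poly_ring V) (monomial_ideal V U :: ('x, 'k) mpoly set)) = Max (h ` B)"
    and "regularity (poly_ring V) (ideal_gmodule (poly_ring V) (monomial_ideal V U :: ('x, 'k) mpoly set)) =
      Max ((\<lambda>b. int (mono_deg (g b)) - int (h b)) ` B)"
proof -
  have b: "betti (poly_ring V) (ideal_gmodule (poly_ring V) (monomial_ideal V U :: ('x, 'k) mpoly set)) i j \<noteq> 0 \<longleftrightarrow>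
      (\<exists>b\<in>B. h b = i \<and> int (mono_deg (g b)) = j)" for i j
    by (rule betti_minimal_resolution[OF r]) (use UV in blast)
  have "{i. \<exists>j. betti (poly_ring V) (ideal_gmodule (poly_ring V) (monomial_ideal V U :: ('x, 'k) mpoly set)) i j \<noteq> 0} = h ` B"
    unfolding b by auto
  then show "proj_dim (poly_ring V) (ideal_gmodule (poly_ring V) (monomial_ideal V U :: ('x, 'k) mpoly set)) = Max (h ` B)"
    by (simp add: proj_dim_def)
  have "{j. \<exists>i. betti (poly_ring V) (ideal_gmodule (poly_ring V) (monomial_ideal V U :: ('x, 'k) mpoly set)) i (int i + j) \<noteq> 0}
      = (\<lambda>b. int (mono_deg (g b)) - int (h b)) ` B"
    unfolding b by force
  then show "regularity (poly_ring V) (ideal_gmodule (poly_ring V) (monomial_ideal V U :: ('x, 'k) mpoly set)) =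
      Max ((\<lambda>b. int (mono_deg (g b)) - int (h b)) ` B)"
    by (simp add: regularity_def)
qed

lemma Max_add_Times:
  fixes p :: "'a \<Rightarrow> 'c::linordered_ab_group_add" and q :: "'b \<Rightarrow> 'c"
  assumes "finite A" "A \<noteq> {}" "finite B" "B \<noteq> {}"
  shows "Max ((\<lambda>x. p (fst x) + q (snd x)) ` (A \<times> B)) = Max (p ` A) + Max (q ` B)"
proof (rule Max_eqI)
  have "Max (p ` A) \<in> p ` A" "Max (q ` B) \<in> q ` B" using assms by (auto intro: Max_in)
  then obtain a b where "a \<in> A" "Max (p ` A) = p a" "b \<in> B" "Max (q ` B) = q b" by blast
  then show "Max (p ` A) + Max (q ` B) \<in> (\<lambda>x. p (fst x) + q (snd x)) ` (A \<times> B)"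
    by (intro image_eqI[of _ _ "(a, b)"]) auto
qed (use assms in \<open>auto intro!: add_mono\<close>)

text \<open>A minimal resolution of the product has the products of basis elements as its basis. Both
  homological degree and degree minus homological degree are additive on such products, and the
  maximum of a sum of independent quantities is the sum of the maxima.\<close>

lemma proj_dim_regularity_product:
  fixes V :: "'x set"
  assumes U: "finite U" "U \<noteq> {}" "\<forall>u\<in>U. keys u \<subseteq> V"
    and W: "finite W" "W \<noteq> {}" "\<forall>u\<in>W. keys u \<subseteq> V"
    and disj: "\<forall>u\<in>U. \<forall>w\<in>W. keys u \<inter> keys w = {}"
  defines "M X \<equiv> ideal_gmodule (poly_ring V) (monomial_ideal V X :: ('x, 'k::field) mpoly set)"
  defines "UW \<equiv> {u + w | u w. u \<in> U \<and> w \<in> W}"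
  shows "proj_dim (poly_ring V) (M UW) = proj_dim (poly_ring V) (M U) + proj_dim (poly_ring V) (M W)"
    and "regularity (poly_ring V) (M UW) = regularity (poly_ring V) (M U) + regularity (poly_ring V) (M W)"
proof -
  obtain A hA gA and DA :: "nat \<Rightarrow> nat \<Rightarrow> 'k" and \<epsilon>A where A: "minimal_resolution U A hA gA DA \<epsilon>A"
    using minimal_resolution_exists[OF U(1)] by blast
  obtain B hB gB and DB :: "nat \<Rightarrow> nat \<Rightarrow> 'k" and \<epsilon>B where B: "minimal_resolution W B hB gB DB \<epsilon>B"
    using minimal_resolution_exists[OF W(1)] by blast
  let ?h = "\<lambda>x. hA (fst x) + hB (snd x)" and ?g = "\<lambda>x. gA (fst x) + gB (snd x)"
  have "minimal_resolution UW (A \<times> B) ?h ?g (tensor_diff hA DA DB) (\<lambda>x. \<epsilon>A (fst x) * \<epsilon>B (snd x))"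
    unfolding UW_def by (rule minimal_resolution_tensor[OF A B]) (use disj in blast)
  from minimal_resolution_reindex[OF this] obtain f :: "nat \<times> nat \<Rightarrow> nat" and h g and D :: "nat \<Rightarrow> nat \<Rightarrow> 'k" and \<epsilon>
    where UW: "minimal_resolution UW (f ` (A \<times> B)) h g D \<epsilon>"
      and hg: "\<And>b. b \<in> A \<times> B \<Longrightarrow> h (f b) = ?h b \<and> g (f b) = ?g b" by blast
  have UWV: "\<forall>u\<in>UW. keys u \<subseteq> V"
    using U(3) W(3) by (force simp: UW_def keys_add_nat)
  have fin: "finite A" "finite B"
    using A B by (auto simp: minimal_resolution_def monomial_resolution_def augmented_complex_def)
  have "below gA A u \<noteq> {}" if "u \<in> U" for u
    using A that unfolding minimal_resolution_def monomial_resolution_def by (metis mdvd_refl)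
  moreover have "below gB B w \<noteq> {}" if "w \<in> W" for w
    using B that unfolding minimal_resolution_def monomial_resolution_def by (metis mdvd_refl)
  ultimately have ne: "A \<noteq> {}" "B \<noteq> {}" using U(2) W(2) by fastforce+
  have "proj_dim (poly_ring V) (M UW) = Max (?h ` (A \<times> B))"
    unfolding M_def proj_dim_regularity_minimal_resolution(1)[OF UW UWV] image_image
    using hg by (intro arg_cong[where f = Max] image_cong) auto
  also have "\<dots> = Max (hA ` A) + Max (hB ` B)"
  proof -
    have "int (Max (?h ` (A \<times> B))) = Max ((\<lambda>x. int (hA (fst x)) + int (hB (snd x))) ` (A \<times> B))"
      using fin ne by (subst mono_Max_commute[of int]) (auto simp: mono_def image_image)
    also have "\<dots> = int (Max (hA ` A)) + int (Max (hB ` B))"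
      using fin ne by (subst Max_add_Times) (auto simp: mono_Max_commute[of int] mono_def image_image)
    finally show ?thesis by simp
  qed
  finally show "proj_dim (poly_ring V) (M UW) = proj_dim (poly_ring V) (M U) + proj_dim (poly_ring V) (M W)"
    unfolding M_def by (simp add: proj_dim_regularity_minimal_resolution(1)[OF A U(3)]
      proj_dim_regularity_minimal_resolution(1)[OF B W(3)])
  have "regularity (poly_ring V) (M UW) = Max ((\<lambda>x. (int (mono_deg (gA (fst x))) - int (hA (fst x))) +
      (int (mono_deg (gB (snd x))) - int (hB (snd x)))) ` (A \<times> B))"
    unfolding M_def proj_dim_regularity_minimal_resolution(2)[OF UW UWV] image_image
    using hg by (intro arg_cong[where f = Max] image_cong) (auto simp: mono_deg_add)
  also have "\<dots> = Max ((\<lambda>b. int (mono_deg (gA b)) - int (hA b)) ` A) + Max ((\<lambda>b. int (mono_deg (gB b)) - int (hB b)) ` B)"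
    using fin ne by (intro Max_add_Times)
  finally show "regularity (poly_ring V) (M UW) = regularity (poly_ring V) (M U) + regularity (poly_ring V) (M W)"
    unfolding M_def by (simp add: proj_dim_regularity_minimal_resolution(2)[OF A U(3)]
      proj_dim_regularity_minimal_resolution(2)[OF B W(3)])
qed

section \<open>Cut ideals\<close>

definition cut_exp :: "'v set set \<Rightarrow> 'v set \<Rightarrow> 'v cut_var \<Rightarrow>\<^sub>0 nat" where
  "cut_exp E A = (\<Sum>e\<in>E. single (if card (e \<inter> A) = 1 then SVar e else TVar e) 1)"

definition cut_exps :: "'v graph \<Rightarrow> ('v cut_var \<Rightarrow>\<^sub>0 nat) set" where
  "cut_exps G = cut_exp (edges G) ` Pow (verts G)"

definition cut_vars :: "'v set set \<Rightarrow> 'v cut_var set" where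
  "cut_vars E = SVar ` E \<union> TVar ` E"

lemma cut_vars_mono: "E \<subseteq> E' \<Longrightarrow> cut_vars E \<subseteq> cut_vars E'"
  by (auto simp: cut_vars_def)

lemma cut_monomial_eq: "cut_monomial G A = single (cut_exp (edges G) A) (1 :: 'k::field)"
proof -
  have "(\<Prod>e\<in>E. if card (e \<inter> A) = 1 then var (SVar e) else var (TVar e)) = single (cut_exp E A) (1 :: 'k)" for E
    by (induction E rule: infinite_finite_induct) (simp_all add: cut_exp_def var_def mult_single)
  then show ?thesis by (simp add: cut_monomial_def)
qed

lemma keys_cut_exp: "keys (cut_exp E A) \<subseteq> cut_vars E"
proof (induction E rule: infinite_finite_induct)
  case (insert e E)
  then show ?case by (auto simp: cut_exp_def cut_vars_def keys_add_nat split: if_splits)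
qed (simp_all add: cut_exp_def)

lemma cut_exp_cong: "(\<And>e. e \<in> E \<Longrightarrow> card (e \<inter> A) = 1 \<longleftrightarrow> card (e \<inter> A') = 1) \<Longrightarrow> cut_exp E A = cut_exp E A'"
  unfolding cut_exp_def by (intro sum.cong) auto

lemma finite_cut_exps: "finite_simple_graph G \<Longrightarrow> finite (cut_exps G)"
  by (simp add: finite_simple_graph_def cut_exps_def)

lemma cut_exps_nonempty: "cut_exps G \<noteq> {}" by (auto simp: cut_exps_def)

lemma keys_cut_exps: "u \<in> cut_exps G \<Longrightarrow> keys u \<subseteq> cut_vars (edges G)"
  using keys_cut_exp by (auto simp: cut_exps_def)

lemma cut_ideal_eq: "cut_ideal G = (monomial_ideal (cut_vars (edges G)) (cut_exps G) :: ('v cut_var, 'k::field) mpoly set)"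
proof -
  have "{cut_monomial G A |A. A \<subseteq> verts G} = (\<lambda>u. single u (1 :: 'k)) ` cut_exps G"
    by (auto simp: cut_monomial_eq cut_exps_def)
  moreover have "Idl\<^bsub>poly_ring (cut_vars (edges G))\<^esub> ((\<lambda>u. single u (1 :: 'k)) ` cut_exps G) =
      monomial_ideal (cut_vars (edges G)) (cut_exps G)"
    by (rule genideal_monomials) (use keys_cut_exps in \<open>blast intro: single_in_monomial_ideal\<close>)+
  ultimately show ?thesis
    unfolding cut_ideal_def cut_ring_def cut_vars_def[symmetric] by simp
qed

lemma extended_cut_ideal_eq:
  assumes "cut_vars (edges G) \<subseteq> V"
  shows "Idl\<^bsub>poly_ring V\<^esub> (cut_ideal G) = (monomial_ideal V (cut_exps G) :: ('v cut_var, 'k::field) mpoly set)"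
proof (rule genideal_monomials)
  show "(\<lambda>u. single u 1) ` cut_exps G \<subseteq> (cut_ideal G :: ('v cut_var, 'k) mpoly set)"
    unfolding cut_ideal_eq using keys_cut_exps by (blast intro: single_in_monomial_ideal)
  show "cut_ideal G \<subseteq> (monomial_ideal V (cut_exps G) :: ('v cut_var, 'k) mpoly set)"
    using assms by (auto simp: cut_ideal_eq monomial_ideal_def carrier_poly_ring)
  show "keys u \<subseteq> V" if "u \<in> cut_exps G" for u using keys_cut_exps[OF that] assms by blast
qed

text \<open>An edge has exactly one end in \<open>A\<close> if and only if it has exactly one end outside \<open>A\<close>.\<close>

lemma cut_exp_complement:
  assumes "finite_simple_graph G" shows "cut_exp (edges G) (verts G - A) = cut_exp (edges G) A"
proof (rule cut_exp_cong)
  fix e assume "e \<in> edges G"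
  then have e: "e \<subseteq> verts G" "card e = 2" using assms by (auto simp: finite_simple_graph_def)
  then have "finite e" by (metis card.infinite zero_neq_numeral)
  moreover have "e \<inter> (verts G - A) = e - e \<inter> A" using e by blast
  ultimately have "card (e \<inter> (verts G - A)) + card (e \<inter> A) = 2"
    using e(2) card_Diff_subset[of "e \<inter> A" e] card_mono[of e "e \<inter> A"] by simp
  then show "(card (e \<inter> (verts G - A)) = 1) = (card (e \<inter> A) = 1)" by linarith
qed

lemma edges_disjoint:
  assumes G: "finite_simple_graph G" and H: "finite_simple_graph H"
    and VV: "card (verts G \<inter> verts H) \<le> 1"
  shows "edges G \<inter> edges H = {}"
proof (rule ccontr)
  assume "edges G \<inter> edges H \<noteq> {}"
  then obtain e where e: "e \<in> edges G" "e \<in> edges H" by blast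
  then have "e \<subseteq> verts G \<inter> verts H" "card e = 2" using G H by (auto simp: finite_simple_graph_def)
  then have "2 \<le> card (verts G \<inter> verts H)" using G card_mono[of "verts G \<inter> verts H" e] by (auto simp: finite_simple_graph_def)
  then show False using VV by simp
qed

text \<open>A cut of the union restricts to both graphs. Conversely, two vertex sets that agree on the
  common vertices have a union that restricts to each of them.\<close>

lemma cut_exps_union:
  assumes G: "finite_simple_graph G" and H: "finite_simple_graph H"
    and VV: "card (verts G \<inter> verts H) \<le> 1"
    and K: "verts K = verts G \<union> verts H" "edges K = edges G \<union> edges H"
  shows "cut_exps K = {u + w | u w. u \<in> cut_exps G \<and> w \<in> cut_exps H}"
proof -
  have fin: "finite (edges G)" "finite (edges H)"
    using G H finite_subset[of "edges G" "Pow (verts G)"] finite_subset[of "edges H" "Pow (verts H)"]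
    by (auto simp: finite_simple_graph_def)
  have split: "cut_exp (edges K) A = cut_exp (edges G) A + cut_exp (edges H) A" for A
    unfolding cut_exp_def K(2) using fin edges_disjoint[OF G H VV] by (rule sum.union_disjoint)
  have loc: "cut_exp (edges L) (A \<inter> verts L) = cut_exp (edges L) A" if L: "finite_simple_graph L" for A and L :: "'a graph"
  proof (rule cut_exp_cong)
    fix e assume "e \<in> edges L"
    then have "e \<inter> (A \<inter> verts L) = e \<inter> A" using L by (auto simp: finite_simple_graph_def)
    then show "(card (e \<inter> (A \<inter> verts L)) = 1) = (card (e \<inter> A) = 1)" by simp
  qed
  have "finite (verts G \<inter> verts H)" using G by (simp add: finite_simple_graph_def)
  then have vv: "x = y" if "x \<in> verts G \<inter> verts H" "y \<in> verts G \<inter> verts H" for x y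
    using VV that by (metis One_nat_def card_le_Suc0_iff_eq)
  show ?thesis
  proof (intro subset_antisym subsetI)
    fix u assume "u \<in> cut_exps K"
    then obtain A where "u = cut_exp (edges K) A" by (auto simp: cut_exps_def)
    then have "u = cut_exp (edges G) (A \<inter> verts G) + cut_exp (edges H) (A \<inter> verts H)"
      by (simp add: split loc G H)
    then show "u \<in> {u + w | u w. u \<in> cut_exps G \<and> w \<in> cut_exps H}" by (auto simp: cut_exps_def)
  next
    fix u assume "u \<in> {u + w | u w. u \<in> cut_exps G \<and> w \<in> cut_exps H}"
    then obtain A B where AB: "u = cut_exp (edges G) A + cut_exp (edges H) B" "A \<subseteq> verts G" "B \<subseteq> verts H"
      by (auto simp: cut_exps_def)
    \<comment> \<open>If the sets differ at the common vertex, the complement of \<open>B\<close> agrees with \<open>A\<close> there.\<close>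
    obtain B' where B': "cut_exp (edges H) B' = cut_exp (edges H) B" "B' \<subseteq> verts H"
      "A \<inter> (verts G \<inter> verts H) = B' \<inter> (verts G \<inter> verts H)"
    proof (cases "A \<inter> (verts G \<inter> verts H) = B \<inter> (verts G \<inter> verts H)")
      case True
      then show ?thesis using that AB by blast
    next
      case False
      then have "A \<inter> (verts G \<inter> verts H) = (verts H - B) \<inter> (verts G \<inter> verts H)" using vv by blast
      then show ?thesis using that[of "verts H - B"] cut_exp_complement[OF H] by blast
    qed
    have "(A \<union> B') \<inter> verts G = A" "(A \<union> B') \<inter> verts H = B'" using AB B' by blast+
    then have "u = cut_exp (edges K) (A \<union> B')"
      using AB(1) B'(1) loc[OF G, of "A \<union> B'"] loc[OF H, of "A \<union> B'"] by (simp add: split)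
    moreover have "A \<union> B' \<subseteq> verts K" using AB B' K by blast
    ultimately show "u \<in> cut_exps K" by (auto simp: cut_exps_def)
  qed
qed

theorem corollary4p1:
  fixes Gs :: "nat \<Rightarrow> 'v graph" and r :: nat and G :: "'v graph"
    and S :: "('v cut_var, 'k::field) mpoly ring"
  assumes "r \<ge> 1"
    and "\<forall>k\<in>{1..r}. finite_simple_graph (Gs k) \<and> edges (Gs k) \<noteq> {}"
    and "\<forall>i\<in>{2..r}. card ((\<Union>k\<in>{1..<i}. verts (Gs k)) \<inter> verts (Gs i)) \<le> 1"
    and "G = graph_Union {1..r} Gs"
    and "S = cut_ring G"
  shows "proj_dim S (ideal_gmodule S (cut_ideal G)) =
           (\<Sum>k=1..r. proj_dim S (ideal_gmodule S (Idl\<^bsub>S\<^esub> (cut_ideal (Gs k))))) \<and>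
         regularity S (ideal_gmodule S (cut_ideal G)) =
           (\<Sum>k=1..r. regularity S (ideal_gmodule S (Idl\<^bsub>S\<^esub> (cut_ideal (Gs k)))))"
proof -
  define V where "V = cut_vars (edges G)"
  have S: "S = poly_ring V" using assms(5) by (simp add: cut_ring_def V_def cut_vars_def)
  define M where "M X = ideal_gmodule S (monomial_ideal V X)" for X
  define H where "H n = graph_Union {1..n} Gs" for n
  have fsg: "finite_simple_graph (Gs k)" if "1 \<le> k" "k \<le> r" for k using assms(2) that by simp
  have H: "finite_simple_graph (H n)" if "n \<le> r" for n
  proof -
    have "finite (verts (H n))"
      using fsg that by (auto simp: H_def graph_Union_def finite_simple_graph_def)
    moreover have "e \<subseteq> verts (H n) \<and> card e = 2" if e: "e \<in> edges (H n)" for e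
    proof -
      obtain k where k: "k \<in> {1..n}" "e \<in> edges (Gs k)" using e by (auto simp: H_def graph_Union_def)
      then have "e \<subseteq> verts (Gs k) \<and> card e = 2"
        using fsg[of k] \<open>n \<le> r\<close> by (auto simp: finite_simple_graph_def)
      then show ?thesis using k by (auto simp: H_def graph_Union_def)
    qed
    ultimately show ?thesis by (simp add: finite_simple_graph_def)
  qed
  have Hr: "H r = G" by (simp add: H_def assms(4))
  have edges_H: "edges (H n) = (\<Union>k\<in>{1..n}. edges (Gs k))" for n by (simp add: H_def graph_Union_def)
  have sub: "cut_vars (edges (H n)) \<subseteq> V" if "n \<le> r" for n
  proof -
    have "{1..n} \<subseteq> {1..r}" using that by auto
    then have "edges (H n) \<subseteq> edges (H r)" unfolding edges_H by (rule UN_mono) simp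
    then show ?thesis unfolding V_def Hr by (rule cut_vars_mono)
  qed
  have subk: "cut_vars (edges (Gs k)) \<subseteq> V" if "1 \<le> k" "k \<le> r" for k
  proof -
    have "edges (Gs k) \<subseteq> edges (H r)" unfolding edges_H using that by (intro UN_upper) simp
    then show ?thesis unfolding V_def Hr by (rule cut_vars_mono)
  qed
  have main: "proj_dim S (M (cut_exps (H n))) = (\<Sum>k=1..n. proj_dim S (M (cut_exps (Gs k)))) \<and>
      regularity S (M (cut_exps (H n))) = (\<Sum>k=1..n. regularity S (M (cut_exps (Gs k))))"
    if "1 \<le> n" "n \<le> r" for n
    using that
  proof (induction n rule: nat_induct_at_least)
    case base
    have "cut_exps (H 1) = cut_exps (Gs 1)" by (simp add: cut_exps_def H_def graph_Union_def)
    then show ?case by simp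
  next
    case (Suc n)
    note Hn = H[of n] and Gn = fsg[of "Suc n"]
    have "{1..<Suc n} = {1..n}" by auto
    then have c: "card (verts (H n) \<inter> verts (Gs (Suc n))) \<le> 1"
      using assms(3)[rule_format, of "Suc n"] Suc by (simp add: H_def graph_Union_def)
    have "{1..Suc n} = insert (Suc n) {1..n}" by auto
    then have u: "cut_exps (H (Suc n)) = {u + w | u w. u \<in> cut_exps (H n) \<and> w \<in> cut_exps (Gs (Suc n))}"
      using Suc by (intro cut_exps_union Hn Gn c) (auto simp: H_def graph_Union_def)
    have disj: "\<forall>u\<in>cut_exps (H n). \<forall>w\<in>cut_exps (Gs (Suc n)). keys u \<inter> keys w = {}"
    proof -
      have "edges (H n) \<inter> edges (Gs (Suc n)) = {}" using Suc by (intro edges_disjoint Hn Gn c) auto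
      then have "cut_vars (edges (H n)) \<inter> cut_vars (edges (Gs (Suc n))) = {}" by (auto simp: cut_vars_def)
      then show ?thesis using keys_cut_exps[of _ "H n"] keys_cut_exps[of _ "Gs (Suc n)"] by fast
    qed
    have kH: "\<forall>u\<in>cut_exps (H n). keys u \<subseteq> V"
      using keys_cut_exps[of _ "H n"] sub[of n] Suc.prems by fastforce
    have kG: "\<forall>u\<in>cut_exps (Gs (Suc n)). keys u \<subseteq> V"
      using keys_cut_exps[of _ "Gs (Suc n)"] subk[of "Suc n"] Suc.prems by fastforce
    have fin: "finite (cut_exps (H n))" "finite (cut_exps (Gs (Suc n)))"
      using Hn Gn Suc.prems by (auto intro: finite_cut_exps)
    note product = proj_dim_regularity_product[OF fin(1) cut_exps_nonempty kH fin(2) cut_exps_nonempty kG disj]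
    have "proj_dim S (M (cut_exps (H (Suc n)))) = proj_dim S (M (cut_exps (H n))) + proj_dim S (M (cut_exps (Gs (Suc n))))"
      unfolding u M_def S by (rule product(1))
    moreover have "regularity S (M (cut_exps (H (Suc n)))) = regularity S (M (cut_exps (H n))) + regularity S (M (cut_exps (Gs (Suc n))))"
      unfolding u M_def S by (rule product(2))
    ultimately show ?case using Suc by simp
  qed
  have ext: "Idl\<^bsub>S\<^esub> (cut_ideal (Gs k)) = monomial_ideal V (cut_exps (Gs k))" if "k \<in> {1..r}" for k
    unfolding S using that by (intro extended_cut_ideal_eq subk) auto
  have "cut_ideal G = (monomial_ideal V (cut_exps (H r)) :: ('v cut_var, 'k) mpoly set)"
    by (simp add: Hr cut_ideal_eq V_def)
  then have "ideal_gmodule S (cut_ideal G) = M (cut_exps (H r))" by (simp add: M_def)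
  moreover have "(\<Sum>k=1..r. proj_dim S (ideal_gmodule S (Idl\<^bsub>S\<^esub> (cut_ideal (Gs k))))) = (\<Sum>k=1..r. proj_dim S (M (cut_exps (Gs k))))"
    by (rule sum.cong) (simp_all add: M_def ext)
  moreover have "(\<Sum>k=1..r. regularity S (ideal_gmodule S (Idl\<^bsub>S\<^esub> (cut_ideal (Gs k))))) = (\<Sum>k=1..r. regularity S (M (cut_exps (Gs k))))"
    by (rule sum.cong) (simp_all add: M_def ext)
  ultimately show ?thesis using main[of r] assms(1) by simp
qed

end
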